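(* Let $\lambda>0$, $\phi>0$, $\gamma\ge 0$, $0<\rho\le 1$, $0<\mu\le 1$, and, if $\gamma\neq 0$, assume $0<\mu\lceil\gamma\rceil/\gamma-r\rho<1$ for all $r=0,\dots,\lceil\gamma\rceil$. The solution to the Cauchy problem (in the time variable $t$, with parameter $v$) $$\begin{cases}{}^C\mathcal{D}^{\gamma,\mu}_{\rho,-\phi,0^+}G(v,t)=-\lambda(1-v)\,G(v,t), & t>0,\ |v|\le 1,\\ G(v,0)=1,\end{cases}$$ is $$G(v,t)=\sum_{k=0}^{\infty}(-\lambda t^{\mu})^k(1-v)^k\,E^{\gamma k}_{\rho,\mu k+1}(-\phi t^{\rho}),\qquad |v|\le 1.$$
   Context: The three-parameter (Prabhakar) Mittag--Leffler function is $E^{\gamma}_{\rho,\mu}(x)=\sum_{k=0}^{\infty}\frac{\Gamma(\gamma+k)}{\Gamma(\gamma)\Gamma(\rho k+\mu)}\frac{x^k}{k!}$, where $\Gamma(\gamma+k)/\Gamma(\gamma)$ is read as the Pochhammer symbol $\gamma(\gamma+1)\cdots(\gamma+k-1)$ (so that $E^0_{\rho,\mu}(x)=1/\Gamma(\mu)$). Prabhakar integral, for $\rho,\mu>0$: $\mathbf{E}^{\gamma}_{\rho,\mu,\omega,0^+}f(t)=\int_0^t (t-y)^{\mu-1}E^{\gamma}_{\rho,\mu}[\omega(t-y)^{\rho}]f(y)\,dy$; by convention $\mathbf{E}^{0}_{\rho,0,\omega,0^+}f=f$. Regularized Hilfer--Prabhakar derivative, for $f$ absolutely continuous (on finite intervals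 of $[0,\infty)$): ${}^C\mathcal{D}^{\gamma,\mu}_{\rho,\omega,0^+}f(t)=\left(\mathbf{E}^{-\gamma}_{\rho,1-\mu,\omega,0^+}\frac{d}{dt}f\right)(t)$. (Under the stated parameter conditions $\mu=1$ is possible only when $\gamma=0$, in which case this operator is $d/dt$.) $G(v,t)=\sum_{k\ge0}v^kp_k(t)$ is the probability generating function of the generalized fractional Poisson process, whose state probabilities $p_k(t)$ satisfy ${}^C\mathcal{D}^{\gamma,\mu}_{\rho,-\phi,0^+}p_k(t)=-\lambda p_k(t)+\lambda p_{k-1}(t)$, $k\ge 0$ (with $p_{-1}\equiv0$), $p_0(0)=1$, $p_k(0)=0$ for $k\ge1$. *)

theory Defs
  imports "HOL-Analysis.Analysis"
begin

text \<open>The three-parameter Mittag--Leffler function; the quotient of \<open>Gamma (\<gamma> + k)\<close> by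
  \<open>Gamma \<gamma>\<close> is read as a Pochhammer symbol, so \<open>\<gamma>\<close> may be zero or negative.\<close>

definition prabhakar_E :: "real \<Rightarrow> real \<Rightarrow> real \<Rightarrow> real \<Rightarrow> real" where
  "prabhakar_E \<gamma> \<rho> \<mu> x = (\<Sum>k. pochhammer \<gamma> k * rGamma (\<rho> * real k + \<mu>) * x ^ k / fact k)"

definition prabhakar_kernel :: "real \<Rightarrow> real \<Rightarrow> real \<Rightarrow> real \<Rightarrow> real \<Rightarrow> real" where
  "prabhakar_kernel \<gamma> \<rho> \<mu> \<omega> s = s powr (\<mu> - 1) * prabhakar_E \<gamma> \<rho> \<mu> (\<omega> * s powr \<rho>)"

definition prabhakar_integral ::
    "real \<Rightarrow> real \<Rightarrow> real \<Rightarrow> real \<Rightarrow> (real \<Rightarrow> complex) \<Rightarrow> real \<Rightarrow> complex" where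
  "prabhakar_integral \<gamma> \<rho> \<mu> \<omega> f t =
     (if \<gamma> = 0 \<and> \<mu> = 0 then f t
      else (LINT y:{0..t}|lebesgue. prabhakar_kernel \<gamma> \<rho> \<mu> \<omega> (t - y) *\<^sub>R f y))"

text \<open>The derivative of an absolutely continuous \<open>f\<close> exists almost everywhere; the arbitrary value
  of \<open>vector_derivative\<close> on the exceptional null set does not affect the integral.\<close>

definition regularized_HP_derivative ::
    "real \<Rightarrow> real \<Rightarrow> real \<Rightarrow> real \<Rightarrow> (real \<Rightarrow> complex) \<Rightarrow> real \<Rightarrow> complex" where
  "regularized_HP_derivative \<gamma> \<mu> \<rho> \<omega> f t =
     prabhakar_integral (- \<gamma>) \<rho> (1 - \<mu>) \<omega> (\<lambda>y. vector_derivative f (at y)) t"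

text \<open>Since Isabelle's integral and derivative are total, this records that
  the regularized derivative of \<open>f\<close> really exists at \<open>t\<close>.\<close>

definition regularized_HP_differentiable ::
    "real \<Rightarrow> real \<Rightarrow> real \<Rightarrow> real \<Rightarrow> (real \<Rightarrow> complex) \<Rightarrow> real \<Rightarrow> bool" where
  "regularized_HP_differentiable \<gamma> \<mu> \<rho> \<omega> f t \<longleftrightarrow>
     (if \<gamma> = 0 \<and> \<mu> = 1 then f differentiable (at t)
      else set_integrable lebesgue {0..t}
             (\<lambda>y. prabhakar_kernel (- \<gamma>) \<rho> (1 - \<mu>) \<omega> (t - y) *\<^sub>R vector_derivative f (at y)))"

text \<open>A pair \<open>(x, y)\<close> in \<open>D\<close> stands for the open interval from \<open>x\<close> to \<open>y\<close>.\<close>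

definition abs_continuous_on_interval :: "real \<Rightarrow> real \<Rightarrow> (real \<Rightarrow> complex) \<Rightarrow> bool" where
  "abs_continuous_on_interval a b f \<longleftrightarrow>
     (\<forall>\<epsilon>>0. \<exists>\<delta>>0. \<forall>D :: (real \<times> real) set.
        finite D \<longrightarrow> (\<forall>(x, y)\<in>D. a \<le> x \<and> x \<le> y \<and> y \<le> b) \<longrightarrow>
        disjoint_family_on (\<lambda>(x, y). {x<..<y}) D \<longrightarrow>
        (\<Sum>(x, y)\<in>D. y - x) < \<delta> \<longrightarrow>
        (\<Sum>(x, y)\<in>D. norm (f y - f x)) < \<epsilon>)"

text \<open>Solutions \<open>G v t\<close> of the Cauchy problem, with \<open>t\<close> the time variable and \<open>v\<close> a parameter in
  the closed unit disc. Values of \<open>G\<close> outside \<open>norm v \<le> 1\<close>, \<open>t \<ge> 0\<close> are irrelevant.\<close>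

definition pgf_cauchy_solution ::
    "real \<Rightarrow> real \<Rightarrow> real \<Rightarrow> real \<Rightarrow> real \<Rightarrow> (complex \<Rightarrow> real \<Rightarrow> complex) \<Rightarrow> bool" where
  "pgf_cauchy_solution lam \<phi> \<gamma> \<rho> \<mu> G \<longleftrightarrow>
     (\<forall>v. norm v \<le> 1 \<longrightarrow>
        (\<forall>T>0. abs_continuous_on_interval 0 T (G v)) \<and>
        (\<forall>t>0. regularized_HP_differentiable \<gamma> \<mu> \<rho> (- \<phi>) (G v) t \<and>
               regularized_HP_derivative \<gamma> \<mu> \<rho> (- \<phi>) (G v) t
                 = - of_real lam * (1 - v) * G v t) \<and>
        G v 0 = 1)"

definition pgf_series_term ::
    "real \<Rightarrow> real \<Rightarrow> real \<Rightarrow> real \<Rightarrow> real \<Rightarrow> complex \<Rightarrow> real \<Rightarrow> nat \<Rightarrow> complex" where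
  "pgf_series_term lam \<phi> \<gamma> \<rho> \<mu> v t k =
     of_real ((- lam * t powr \<mu>) ^ k) * (1 - v) ^ k *
     of_real (prabhakar_E (\<gamma> * real k) \<rho> (\<mu> * real k + 1) (- \<phi> * t powr \<rho>))"

end

theory Submission
  imports Defs
begin

text \<open>
  Write \<open>K \<gamma> \<mu>\<close> for the Prabhakar kernel \<open>s \<mapsto> s\<^bsup>\<mu>-1\<^esup> E\<^bsup>\<gamma>\<^esup>\<^bsub>\<rho>,\<mu>\<^esub>(- \<phi> s\<^bsup>\<rho>\<^esup>)\<close> on the positive half line.
  Its Laplace transform is \<open>s\<^bsup>-\<mu>\<^esup> (1 + \<phi> s\<^bsup>-\<rho>\<^esup>)\<^bsup>-\<gamma>\<^esup>\<close>, so these kernels form a semigroup under convolution: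
  \<open>K \<gamma> \<mu> * K \<gamma>' \<mu>' = K (\<gamma> + \<gamma>') (\<mu> + \<mu>')\<close>. Here this is derived without Laplace transforms
  (\<open>causal_kernel_conv\<close>): expand both kernels into powers of \<open>s\<close>, convolve power by power with the
  Beta integral, and collect the coefficients with Vandermonde's identity for Pochhammer symbols.

  The regularized derivative is convolution of \<open>G'\<close> with \<open>K (- \<gamma>) (1 - \<mu>)\<close>, and the semigroup law
  says that \<open>K \<gamma> \<mu>\<close> inverts this kernel up to one integration, because \<open>K 0 1 = 1\<close>. With
  \<open>z = - \<lambda> (1 - v)\<close> the Cauchy problem is therefore the Volterra equation \<open>G = 1 + z (K \<gamma> \<mu> * G)\<close>.
  Its Neumann series is \<open>\<Sum>k. z\<^sup>k K (\<gamma> k) (\<mu> k + 1)\<close>, which is the asserted one. On a bounded interval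
  \<open>K \<gamma> \<mu>\<close> is dominated by a multiple \<open>C\<close> of the Riemann--Liouville kernel \<open>s\<^bsup>\<mu>-1\<^esup> / \<Gamma>(\<mu>)\<close>, so the
  \<open>k\<close>-fold convolution is dominated by \<open>C\<^sup>k s\<^bsup>\<mu>k-1\<^esup> / \<Gamma>(\<mu>k)\<close>; this controls the convergence of the
  series, its differentiation (\<open>pgf_series_has_vector_derivative\<close>), and uniqueness
  (\<open>volterra_unique\<close>). The excluded value \<open>1 - \<mu> = 0\<close> occurs only for \<open>\<gamma> = 0\<close>, where the derivative
  is \<open>d/dt\<close> and the Volterra equation is an integrated differential equation.

  Passing from an arbitrary solution to the Volterra equation needs \<open>G t - G 0 = \<integral> G'\<close> for a
  function that is only known to be absolutely continuous. The first half of the theory proves this.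
  Lebesgue's theorem on the differentiability of functions of bounded variation
  (\<open>negligible_nondifferentiable_real\<close>) follows an idea of Austin: an interval on which \<open>f\<close> moves against
  its overall direction contributes twice to the variation, so where the difference quotients of \<open>f\<close>
  oscillate, a majorant of the variation can be lowered in proportion to the outer measure
  of the oscillation set; for a nearly optimal majorant there is no room for that. The integral formula
  (\<open>abs_continuous_has_integral\<close>) is then a gauge argument in which absolute continuity absorbs the
  tags in the exceptional null set.
\<close>

section \<open>Functions of bounded variation\<close>

text \<open>The disjointness condition has the form used for absolute continuity. A degenerate pair \<open>(x, x)\<close>
  stands for an empty interval and may lie anywhere; such pairs contribute nothing and are filtered
  out.\<close>

lemma sum_increments_le:
  fixes W :: "real \<Rightarrow> real"
  assumes "finite D" and "mono_on {a..b} W" and "a \<le> b"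
    and "\<And>x y. (x, y) \<in> D \<Longrightarrow> a \<le> x \<and> x \<le> y \<and> y \<le> b"
    and "disjoint_family_on (\<lambda>(x, y). {x<..<y}) D"
  shows "(\<Sum>(x, y)\<in>D. W y - W x) \<le> W b - W a"
proof -
  have *: "(\<Sum>(x, y)\<in>D. W y - W x) \<le> W b - W a"
    if "finite D" "mono_on {a..b} W" "a \<le> b"
      "\<And>x y. (x, y) \<in> D \<Longrightarrow> a \<le> x \<and> x < y \<and> y \<le> b"
      "disjoint_family_on (\<lambda>(x, y). {x<..<y}) D" for D b
    using that
  proof (induction D arbitrary: b rule: finite_psubset_induct)
    case (psubset D b)
    show ?case
    proof (cases "D = {}")
      case True
      then show ?thesis
        using psubset.prems by (auto intro: mono_onD)
    next
      case False
      \<comment> \<open>Split off the rightmost interval; the others lie to the left of its left end.\<close>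
      have "Max (fst ` D) \<in> fst ` D"
        using False psubset.hyps by (intro Max_in) auto
      then obtain u v where uv: "(u, v) \<in> D" "u = Max (fst ` D)"
        by force
      have u_max: "x \<le> u" if "(x, y) \<in> D" for x y
        unfolding uv(2) using psubset.hyps that by (intro Max_ge) force+
      have uv': "a \<le> u" "u < v" "v \<le> b"
        using psubset.prems(3)[OF uv(1)] by auto
      have le_u: "a \<le> x \<and> x < y \<and> y \<le> u" if "(x, y) \<in> D - {(u, v)}" for x y
      proof -
        have xy: "(x, y) \<in> D" "(x, y) \<noteq> (u, v)"
          using that by auto
        have "{x<..<y} \<inter> {u<..<v} = {}"
          using psubset.prems(4) xy uv(1) unfolding disjoint_family_on_def by fastforce
        moreover have "(u + min y v) / 2 \<in> {x<..<y} \<inter> {u<..<v}" if "u < y"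
          using u_max[OF xy(1)] that uv' psubset.prems(3)[OF xy(1)]
          by (auto simp: min_def)
        ultimately show ?thesis
          using psubset.prems(3)[OF xy(1)] by force
      qed
      have "(\<Sum>(x, y)\<in>D. W y - W x) = (W v - W u) + (\<Sum>(x, y)\<in>D - {(u, v)}. W y - W x)"
        using uv(1) psubset.hyps by (simp add: sum.remove)
      also have "(\<Sum>(x, y)\<in>D - {(u, v)}. W y - W x) \<le> W u - W a"
      proof (rule psubset.IH)
        show "mono_on {a..u} W"
          using psubset.prems(1) by (rule mono_on_subset) (use uv' in auto)
        show "disjoint_family_on (\<lambda>(x, y). {x<..<y}) (D - {(u, v)})"
          using psubset.prems(4) by (rule disjoint_family_on_mono[rotated]) auto
      qed (use uv uv' le_u in auto)
      also have "(W v - W u) + (W u - W a) \<le> W b - W a"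
        using mono_onD[OF psubset.prems(1), of v b] uv' by auto
      finally show ?thesis
        by simp
    qed
  qed
  have "(\<Sum>(x, y)\<in>D. W y - W x) = (\<Sum>(x, y)\<in>{p\<in>D. fst p < snd p}. W y - W x)"
  proof (rule sum.mono_neutral_right)
    show "\<forall>p\<in>D - {p \<in> D. fst p < snd p}. (case p of (x, y) \<Rightarrow> W y - W x) = 0"
      using assms(4) by (auto simp: not_less) (metis order.antisym order.refl order_le_less)
  qed (use assms(1) in auto)
  also have "\<dots> \<le> W b - W a"
  proof (rule *)
    show "disjoint_family_on (\<lambda>(x, y). {x<..<y}) {p \<in> D. fst p < snd p}"
      using assms(5) by (rule disjoint_family_on_mono[rotated]) auto
  qed (use assms in auto)
  finally show ?thesis .
qed

text \<open>Vitali's covering theorem selects disjoint steep intervals that cover \<open>S\<close> up to a null set, and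
  their total length is at most the total increase of \<open>W\<close> divided by \<open>\<beta>\<close>. The bound is
  stated for a measurable superset because \<open>S\<close> is an arbitrary set.\<close>

lemma steep_points_small:
  fixes W :: "real \<Rightarrow> real"
  assumes mono: "mono_on {a..b} W" and "a \<le> b" and "\<beta> > 0"
    and steep: "\<And>x d. x \<in> S \<Longrightarrow> d > 0 \<Longrightarrow>
        \<exists>u v. a \<le> u \<and> u < v \<and> v \<le> b \<and> x \<in> {u..v} \<and> v - u < d \<and> \<beta> * (v - u) \<le> W v - W u"
  shows "\<exists>T. T \<in> lmeasurable \<and> S \<subseteq> T \<and> measure lebesgue T \<le> (W b - W a) / \<beta>"
proof -
  define K where "K = {(u, v). a \<le> u \<and> u < v \<and> v \<le> b \<and> \<beta> * (v - u) \<le> W v - W u}"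
  define c where "c = (\<lambda>(u::real, v). (u + v) / 2)"
  define r where "r = (\<lambda>(u::real, v). (v - u) / 2)"
  have ball: "cball (c p) (r p) = {fst p..snd p}" for p
    by (cases p) (auto simp: c_def r_def cball_eq_atLeastAtMost field_simps)
  have "\<exists>p. p \<in> K \<and> x \<in> cball (c p) (r p) \<and> r p < d" if x: "x \<in> S" and d: "d > 0" for x d
  proof -
    from steep[OF x d] obtain u v where "a \<le> u" "u < v" "v \<le> b" "x \<in> {u..v}" "v - u < d"
      "\<beta> * (v - u) \<le> W v - W u"
      by auto
    then show ?thesis
      using ball[of "(u, v)"] d by (intro exI[of _ "(u, v)"]) (auto simp: K_def r_def)
  qed
  moreover have "0 < r p" if "p \<in> K" for p
    using that by (auto simp: K_def r_def)
  ultimately obtain C where C: "countable C" "C \<subseteq> K"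
      "pairwise (\<lambda>i j. disjnt (cball (c i) (r i)) (cball (c j) (r j))) C"
      "negligible (S - (\<Union>i \<in> C. cball (c i) (r i)))"
    using Vitali_covering_theorem_cballs[of K r S c] by blast
  define U where "U = (\<Union>p\<in>C. {fst p..snd p})"
  have bound: "measure lebesgue (\<Union>p\<in>F. {fst p..snd p}) \<le> (W b - W a) / \<beta>"
    if F: "F \<subseteq> C" "finite F" for F
  proof -
    have "measure lebesgue (\<Union>p\<in>F. {fst p..snd p}) \<le> (\<Sum>p\<in>F. measure lebesgue {fst p..snd p})"
      using F by (intro measure_UNION_le) auto
    also have "\<dots> = (\<Sum>(u, v)\<in>F. v - u)"
      using F C(2) by (intro sum.cong) (auto simp: K_def)
    also have "\<dots> \<le> (\<Sum>(u, v)\<in>F. (W v - W u) / \<beta>)"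
      using F C(2) \<open>\<beta> > 0\<close> by (intro sum_mono) (auto simp: K_def field_simps)
    also have "\<dots> = (\<Sum>(u, v)\<in>F. W v - W u) / \<beta>"
      by (simp add: sum_divide_distrib case_prod_unfold)
    also have "\<dots> \<le> (W b - W a) / \<beta>"
    proof (rule divide_right_mono)
      show "(\<Sum>(u, v)\<in>F. W v - W u) \<le> W b - W a"
      proof (rule sum_increments_le)
        have "{fst p<..<snd p} \<inter> {fst q<..<snd q} = {}" if "p \<in> F" "q \<in> F" "p \<noteq> q" for p q
          using C(3) F(1) that unfolding pairwise_def disjnt_def ball
          by (smt (verit) disjoint_iff greaterThanLessThan_subseteq_atLeastAtMost_iff subsetD subset_eq order_refl)
        then show "disjoint_family_on (\<lambda>(x, y). {x<..<y}) F"
          unfolding disjoint_family_on_def by (simp add: case_prod_unfold)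
      qed (use F C(2) mono \<open>a \<le> b\<close> in \<open>auto simp: K_def\<close>)
    qed (use \<open>\<beta> > 0\<close> in auto)
    finally show ?thesis .
  qed
  have U: "U \<in> lmeasurable" "measure lebesgue U \<le> (W b - W a) / \<beta>"
    unfolding U_def
    by (rule fmeasurable_UN_bound[OF C(1) _ bound] measure_UN_bound[OF C(1) _ bound]; simp)+
  have N: "negligible (S - U)"
    using C(4) by (simp add: U_def ball)
  show ?thesis
  proof (intro exI conjI)
    show "U \<union> (S - U) \<in> lmeasurable"
      by (rule fmeasurable.Un[OF U(1) negligible_imp_measurable[OF N]])
    show "measure lebesgue (U \<union> (S - U)) \<le> (W b - W a) / \<beta>"
      using U(2) measure_Un_le[of U lebesgue "S - U"] U(1) N
      by (auto simp: negligible_imp_measure0 negligible_imp_sets fmeasurableD)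
  qed auto
qed

text \<open>A function has bounded variation iff it has such a \<open>W\<close>; its variation function is the least
  one. The arguments below only need majorants whose total increase is nearly minimal, and these exist
  by the definition of an infimum.\<close>

definition variation_majorant ::
    "(real \<Rightarrow> real) \<Rightarrow> (real \<Rightarrow> 'a::real_normed_vector) \<Rightarrow> real \<Rightarrow> real \<Rightarrow> bool" where
  "variation_majorant W f a b \<longleftrightarrow>
     (\<forall>x y. a \<le> x \<longrightarrow> x \<le> y \<longrightarrow> y \<le> b \<longrightarrow> norm (f y - f x) \<le> W y - W x)"

lemma variation_majorantD:
  "variation_majorant W f a b \<Longrightarrow> a \<le> x \<Longrightarrow> x \<le> y \<Longrightarrow> y \<le> b \<Longrightarrow> norm (f y - f x) \<le> W y - W x"
  by (auto simp: variation_majorant_def)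

lemma variation_majorant_mono: "variation_majorant W f a b \<Longrightarrow> mono_on {a..b} W"
proof (rule mono_onI)
  fix x y assume "variation_majorant W f a b" "x \<in> {a..b}" "y \<in> {a..b}" "x \<le> y"
  then have "norm (f y - f x) \<le> W y - W x"
    by (intro variation_majorantD[of W f a b]) auto
  then show "W x \<le> W y"
    using norm_ge_zero[of "f y - f x"] by linarith
qed

text \<open>Let \<open>f\<close> rise between \<open>c\<close> and \<open>d\<close>. Then \<open>W - f\<close> is nondecreasing there and gains at least
  \<open>2 \<alpha> (v - u)\<close> on every interval on which \<open>f\<close> falls with slope \<open>-\<alpha>\<close> or steeper, while its total gain
  is the excess of \<open>W d - W c\<close> over \<open>\<bar>f d - f c\<bar>\<close>. If \<open>f\<close> falls, \<open>W + f\<close> takes this part.\<close>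

lemma oscillating_points_small:
  fixes f W :: "real \<Rightarrow> real"
  assumes W: "variation_majorant W f a b" and "a \<le> c" "c \<le> d" "d \<le> b" and "\<alpha> > 0"
    and down: "\<And>x e. x \<in> S \<Longrightarrow> e > 0 \<Longrightarrow>
        \<exists>u v. u < v \<and> x \<in> {u..v} \<and> v - u < e \<and> f v - f u \<le> - \<alpha> * (v - u)"
    and up: "\<And>x e. x \<in> S \<Longrightarrow> e > 0 \<Longrightarrow>
        \<exists>u v. u < v \<and> x \<in> {u..v} \<and> v - u < e \<and> f v - f u \<ge> \<alpha> * (v - u)"
  shows "\<exists>T. T \<in> lmeasurable \<and> S \<inter> {c<..<d} \<subseteq> T \<and>
    measure lebesgue T \<le> (W d - W c - \<bar>f d - f c\<bar>) / (2 * \<alpha>)"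
proof -
  define \<sigma> :: real where "\<sigma> = (if f d \<ge> f c then 1 else - 1)"
  define M where "M x = W x - \<sigma> * f x" for x
  have inc: "\<bar>f y - f x\<bar> \<le> W y - W x" if "c \<le> x" "x \<le> y" "y \<le> d" for x y
    using variation_majorantD[OF W, of x y] that assms by simp
  have "\<exists>T. T \<in> lmeasurable \<and> S \<inter> {c<..<d} \<subseteq> T \<and> measure lebesgue T \<le> (M d - M c) / (2 * \<alpha>)"
  proof (rule steep_points_small[where W = M])
    show "mono_on {c..d} M"
    proof (rule mono_onI)
      fix x y :: real assume "x \<in> {c..d}" "y \<in> {c..d}" "x \<le> y"
      then show "M x \<le> M y"
        using inc[of x y] by (auto simp: M_def \<sigma>_def)
    qed
  next
    fix x e :: real assume x: "x \<in> S \<inter> {c<..<d}" and e: "e > 0"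
    define e' where "e' = min e (min (x - c) (d - x))"
    have e': "e' > 0"
      using x e by (auto simp: e'_def)
    have "\<exists>u v. u < v \<and> x \<in> {u..v} \<and> v - u < e' \<and> - \<sigma> * (f v - f u) \<ge> \<alpha> * (v - u)"
    proof (cases "f d \<ge> f c")
      case True
      then show ?thesis using down[OF _ e', of x] x by (simp add: \<sigma>_def) (smt (verit))
    next
      case False
      then show ?thesis using up[OF _ e', of x] x by (simp add: \<sigma>_def)
    qed
    then obtain u v where uv: "u < v" "x \<in> {u..v}" "v - u < e'" "- \<sigma> * (f v - f u) \<ge> \<alpha> * (v - u)"
      by blast
    have cd: "c \<le> u" "v \<le> d" "v - u < e"
      using uv by (auto simp: e'_def)
    have "\<bar>f v - f u\<bar> \<le> W v - W u"
      using inc[of u v] uv(1) cd by auto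
    then have "- \<sigma> * (f v - f u) \<le> W v - W u"
      by (auto simp: \<sigma>_def)
    then have "2 * (\<alpha> * (v - u)) \<le> M v - M u"
      using uv(4) by (simp add: M_def algebra_simps)
    then show "\<exists>u v. c \<le> u \<and> u < v \<and> v \<le> d \<and> x \<in> {u..v} \<and> v - u < e \<and> 2 * \<alpha> * (v - u) \<le> M v - M u"
      using uv cd by (intro exI[of _ u] exI[of _ v]) auto
  qed (use assms in auto)
  moreover have "M d - M c = W d - W c - \<bar>f d - f c\<bar>"
    by (auto simp: M_def \<sigma>_def)
  ultimately show ?thesis
    by simp
qed

text \<open>Outer measure spares a proof that the sets of oscillation are measurable; subadditivity is
  enough.\<close>

definition outer_lebesgue :: "real set \<Rightarrow> real" where
  "outer_lebesgue S = Inf {measure lebesgue T |T. T \<in> lmeasurable \<and> S \<subseteq> T}"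

lemma outer_lebesgue_le: "T \<in> lmeasurable \<Longrightarrow> S \<subseteq> T \<Longrightarrow> outer_lebesgue S \<le> measure lebesgue T"
  unfolding outer_lebesgue_def by (rule cInf_lower) (auto intro!: bdd_belowI[of _ 0])

lemma outer_lebesgue_approx:
  assumes "bounded S" "e > 0"
  obtains T where "T \<in> lmeasurable" "S \<subseteq> T" "measure lebesgue T < outer_lebesgue S + e"
proof -
  obtain a b where "S \<subseteq> cbox a b"
    using bounded_subset_cbox_symmetric[OF assms(1)] by blast
  then have "{measure lebesgue T |T. T \<in> lmeasurable \<and> S \<subseteq> T} \<noteq> {}"
    using lmeasurable_cbox by blast
  from cInf_lessD[OF this, of "outer_lebesgue S + e"] assms(2)
  obtain r where "r \<in> {measure lebesgue T |T. T \<in> lmeasurable \<and> S \<subseteq> T}" "r < outer_lebesgue S + e"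
    unfolding outer_lebesgue_def by auto
  then show ?thesis
    using that by blast
qed

lemma outer_lebesgue_mono:
  assumes "S \<subseteq> T" "bounded T"
  shows "outer_lebesgue S \<le> outer_lebesgue T"
proof (rule field_le_epsilon)
  fix e :: real assume "e > 0"
  then obtain A where "A \<in> lmeasurable" "T \<subseteq> A" "measure lebesgue A < outer_lebesgue T + e"
    using outer_lebesgue_approx assms by metis
  then show "outer_lebesgue S \<le> outer_lebesgue T + e"
    using outer_lebesgue_le[of A S] assms(1) by force
qed

lemma outer_lebesgue_Un:
  assumes "bounded S" "bounded T"
  shows "outer_lebesgue (S \<union> T) \<le> outer_lebesgue S + outer_lebesgue T"
proof (rule field_le_epsilon)
  fix e :: real assume "e > 0"
  then obtain A B where A: "A \<in> lmeasurable" "S \<subseteq> A" "measure lebesgue A < outer_lebesgue S + e / 2"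
      and B: "B \<in> lmeasurable" "T \<subseteq> B" "measure lebesgue B < outer_lebesgue T + e / 2"
    using outer_lebesgue_approx assms by (metis half_gt_zero)
  have "outer_lebesgue (S \<union> T) \<le> measure lebesgue (A \<union> B)"
    using A B by (intro outer_lebesgue_le) auto
  also have "\<dots> \<le> measure lebesgue A + measure lebesgue B"
    using A B by (intro measure_Un_le) auto
  finally show "outer_lebesgue (S \<union> T) \<le> outer_lebesgue S + outer_lebesgue T + e"
    using A B by simp
qed

lemma outer_lebesgue_negligible:
  assumes "negligible S" shows "outer_lebesgue S \<le> 0"
  using outer_lebesgue_le[of S S] assms by (simp add: negligible_imp_measurable negligible_imp_measure0)

text \<open>Subtracting \<open>2 \<alpha>\<close> times the outer measure of \<open>S \<inter> {a<..<x}\<close> from a majorant \<open>W x\<close> leaves a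
  majorant, by the bound on \<open>S \<inter> {c<..<d}\<close> just obtained. If the total increase of \<open>W\<close> is within
  \<open>2 \<alpha> \<eta>\<close> of the infimum, the outer measure of \<open>S\<close> is therefore at most \<open>\<eta>\<close>.\<close>

lemma negligible_oscillating_points:
  fixes f :: "real \<Rightarrow> real"
  assumes W0: "variation_majorant W0 f a b" and "a \<le> b" and "\<alpha> > 0"
    and S: "S \<subseteq> {a<..<b}"
    and down: "\<And>x e. x \<in> S \<Longrightarrow> e > 0 \<Longrightarrow>
        \<exists>u v. u < v \<and> x \<in> {u..v} \<and> v - u < e \<and> f v - f u \<le> - \<alpha> * (v - u)"
    and up: "\<And>x e. x \<in> S \<Longrightarrow> e > 0 \<Longrightarrow>
        \<exists>u v. u < v \<and> x \<in> {u..v} \<and> v - u < e \<and> f v - f u \<ge> \<alpha> * (v - u)"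
  shows "negligible S"
proof -
  define V where "V = {W b - W a |W. variation_majorant W f a b}"
  have V0: "V \<noteq> {}"
    using W0 by (auto simp: V_def)
  have bdd: "bdd_below V"
  proof (rule bdd_belowI[of _ 0])
    fix r assume "r \<in> V"
    then show "0 \<le> r"
      using variation_majorantD[of _ f a b a b] \<open>a \<le> b\<close> unfolding V_def by force
  qed
  have bdd_S: "bounded (S \<inter> A)" for A
    by (rule bounded_subset[of "{a<..<b}"]) (use S in auto)
  have "outer_lebesgue S \<le> \<eta>" if "\<eta> > 0" for \<eta>
  proof -
    have "Inf V < Inf V + 2 * \<alpha> * \<eta>"
      using that \<open>\<alpha> > 0\<close> by simp
    from cInf_lessD[OF V0 this]
    obtain W where W: "variation_majorant W f a b" and W_less: "W b - W a < Inf V + 2 * \<alpha> * \<eta>"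
      unfolding V_def by blast
    define m where "m x = outer_lebesgue (S \<inter> {a<..<x})" for x
    define W' where "W' x = W x - 2 * \<alpha> * m x" for x
    have "variation_majorant W' f a b"
      unfolding variation_majorant_def
    proof (intro allI impI)
      fix c d assume cd: "a \<le> c" "c \<le> d" "d \<le> b"
      obtain T where T: "T \<in> lmeasurable" "S \<inter> {c<..<d} \<subseteq> T"
          "measure lebesgue T \<le> (W d - W c - \<bar>f d - f c\<bar>) / (2 * \<alpha>)"
        using oscillating_points_small[OF W cd \<open>\<alpha> > 0\<close> down up] by blast
      have "S \<inter> {a<..<d} \<subseteq> (S \<inter> {a<..<c}) \<union> ((S \<inter> {c<..<d}) \<union> (S \<inter> {c}))"
        by auto
      then have "m d \<le> outer_lebesgue ((S \<inter> {a<..<c}) \<union> ((S \<inter> {c<..<d}) \<union> (S \<inter> {c})))"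
        unfolding m_def by (rule outer_lebesgue_mono) (intro bounded_Un[THEN iffD2] conjI bdd_S)
      also have "\<dots> \<le> m c + (outer_lebesgue (S \<inter> {c<..<d}) + outer_lebesgue (S \<inter> {c}))"
        unfolding m_def
        by (intro order_trans[OF outer_lebesgue_Un] add_left_mono outer_lebesgue_Un)
          (auto simp: bdd_S)
      also have "outer_lebesgue (S \<inter> {c}) \<le> 0"
        by (rule outer_lebesgue_negligible) (rule negligible_subset[of "{c}"], auto)
      also have "outer_lebesgue (S \<inter> {c<..<d}) \<le> (W d - W c - \<bar>f d - f c\<bar>) / (2 * \<alpha>)"
        using outer_lebesgue_le[OF T(1,2)] T(3) by linarith
      finally have "m d - m c \<le> (W d - W c - \<bar>f d - f c\<bar>) / (2 * \<alpha>)"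
        by simp
      then have "2 * \<alpha> * (m d - m c) \<le> W d - W c - \<bar>f d - f c\<bar>"
        using \<open>\<alpha> > 0\<close> by (simp add: field_simps)
      then show "norm (f d - f c) \<le> W' d - W' c"
        by (simp add: W'_def algebra_simps)
    qed
    then have "Inf V \<le> W' b - W' a"
      by (intro cInf_lower bdd) (auto simp: V_def)
    moreover have "m a \<le> 0"
      unfolding m_def by (rule outer_lebesgue_negligible) auto
    moreover from this have "2 * \<alpha> * m a \<le> 0"
      using \<open>\<alpha> > 0\<close> by (simp add: mult_nonneg_nonpos)
    moreover have "2 * \<alpha> * m b = 2 * \<alpha> * outer_lebesgue S"
      using S by (simp add: m_def Int_absorb2)
    ultimately have "2 * \<alpha> * outer_lebesgue S \<le> 2 * \<alpha> * \<eta>"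
      using W_less unfolding W'_def by linarith
    then show ?thesis
      using \<open>\<alpha> > 0\<close> by simp
  qed
  then have "outer_lebesgue S \<le> 0"
    by (rule field_le_epsilon) auto
  show ?thesis
    unfolding negligible_outer
  proof (intro allI impI)
    fix e :: real assume "e > 0"
    then obtain T where "T \<in> lmeasurable" "S \<subseteq> T" "measure lebesgue T < outer_lebesgue S + e"
      using outer_lebesgue_approx[of S e thesis] bdd_S[of UNIV] by simp
    then show "\<exists>T. S \<subseteq> T \<and> T \<in> lmeasurable \<and> measure lebesgue T < e"
      using \<open>outer_lebesgue S \<le> 0\<close> by (intro exI[of _ T]) auto
  qed
qed

text \<open>Vitali's theorem wants ordered intervals; the slope of a secant does not depend on the order of
  its end points.\<close>

lemma secant_interval:
  fixes f :: "real \<Rightarrow> real"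
  assumes "y \<noteq> x" "\<bar>y - x\<bar> < e"
  obtains u v where "u < v" "x \<in> {u..v}" "v - u < e" "{u, v} = {x, y}"
    "f v - f u = (f y - f x) / (y - x) * (v - u)"
proof (cases "x < y")
  case True
  then show ?thesis
    using assms that[of x y] by (auto simp: field_simps)
next
  case False
  have "f x - f y = (f y - f x) / (y - x) * (x - y)"
    using assms by (simp add: field_simps)
  then show ?thesis
    using assms False that[of y x] by auto
qed

lemma negligible_unbounded_slopes:
  fixes f :: "real \<Rightarrow> real"
  assumes W: "variation_majorant W f a b" and "a \<le> b"
  shows "negligible {x \<in> {a<..<b}. \<forall>n::nat. \<forall>e>0. \<exists>y. y \<noteq> x \<and> \<bar>y - x\<bar> < e \<and> real n \<le> \<bar>(f y - f x) / (y - x)\<bar>}"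
    (is "negligible ?S")
  unfolding negligible_outer_le
proof (intro allI impI)
  fix \<epsilon> :: real assume "\<epsilon> > 0"
  obtain n :: nat where n: "n > 0" "(W b - W a) / real n < \<epsilon>"
  proof -
    obtain n :: nat where "real n > (W b - W a) / \<epsilon>"
      using reals_Archimedean2 by blast
    then have "(W b - W a) / \<epsilon> < real (Suc n)"
      by simp
    then show ?thesis
      using \<open>\<epsilon> > 0\<close> by (intro that[of "Suc n"]) (simp_all add: field_simps)
  qed
  have "\<exists>T. T \<in> lmeasurable \<and> ?S \<subseteq> T \<and> measure lebesgue T \<le> (W b - W a) / real n"
  proof (rule steep_points_small[where W = W])
    fix x d :: real assume x: "x \<in> ?S" and "d > 0"
    define d' where "d' = min d (min (x - a) (b - x))"
    have "d' > 0"
      using x \<open>d > 0\<close> by (auto simp: d'_def)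
    then obtain y where y: "y \<noteq> x" "\<bar>y - x\<bar> < d'" "real n \<le> \<bar>(f y - f x) / (y - x)\<bar>"
      using x by blast
    obtain u v where uv: "u < v" "x \<in> {u..v}" "v - u < d'"
        "f v - f u = (f y - f x) / (y - x) * (v - u)"
      using secant_interval[OF y(1,2), of f] by metis
    have "real n * (v - u) \<le> \<bar>f v - f u\<bar>"
      unfolding uv(4) abs_mult using y(3) uv(1) by (simp add: mult_right_mono del: abs_divide)
    moreover have "\<bar>f v - f u\<bar> \<le> W v - W u"
      using variation_majorantD[OF W, of u v] uv by (auto simp: d'_def)
    ultimately show "\<exists>u v. a \<le> u \<and> u < v \<and> v \<le> b \<and> x \<in> {u..v} \<and> v - u < d \<and> real n * (v - u) \<le> W v - W u"
      using uv by (intro exI[of _ u] exI[of _ v]) (auto simp: d'_def)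
  qed (use assms n variation_majorant_mono[OF W] in auto)
  then show "\<exists>T. ?S \<subseteq> T \<and> T \<in> lmeasurable \<and> measure lebesgue T \<le> \<epsilon>"
    using n(2) by (meson less_imp_le order_trans)
qed

text \<open>Subtracting the line of slope \<open>(p + q) / 2\<close> turns slopes below \<open>p\<close> and above \<open>q\<close> into slopes
  below \<open>-\<alpha>\<close> and above \<open>\<alpha>\<close> with \<open>\<alpha> = (q - p) / 2\<close>, and preserves bounded variation.\<close>

lemma negligible_slope_gap:
  fixes f :: "real \<Rightarrow> real"
  assumes W: "variation_majorant W f a b" and "a \<le> b" and "p < q"
  shows "negligible {x \<in> {a<..<b}. \<forall>e>0. (\<exists>y. y \<noteq> x \<and> \<bar>y - x\<bar> < e \<and> (f y - f x) / (y - x) < p) \<and>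
      (\<exists>y. y \<noteq> x \<and> \<bar>y - x\<bar> < e \<and> (f y - f x) / (y - x) > q)}"
    (is "negligible ?S")
proof -
  define m where "m = (p + q) / 2"
  define g where "g x = f x - m * x" for x
  define \<alpha> where "\<alpha> = (q - p) / 2"
  have g_diff: "g v - g u = (s - m) * (v - u)" if "f v - f u = s * (v - u)" for u v s
    using that by (simp add: g_def algebra_simps)
  have slope_p: "s - m \<le> - \<alpha>" if "s < p" for s
    using that by (simp add: m_def \<alpha>_def field_simps)
  have slope_q: "s - m \<ge> \<alpha>" if "s > q" for s
    using that by (simp add: m_def \<alpha>_def field_simps)
  have "variation_majorant (\<lambda>x. W x + \<bar>m\<bar> * x) g a b"
    unfolding variation_majorant_def
  proof (intro allI impI)
    fix x y assume "a \<le> x" "x \<le> y" "y \<le> b"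
    then have "\<bar>f y - f x\<bar> \<le> W y - W x" "\<bar>m * (y - x)\<bar> = \<bar>m\<bar> * (y - x)"
      using variation_majorantD[OF W, of x y] by (auto simp: abs_mult)
    moreover have "norm (g y - g x) \<le> \<bar>f y - f x\<bar> + \<bar>m * (y - x)\<bar>"
      by (simp add: g_def algebra_simps)
    ultimately show "norm (g y - g x) \<le> (W y + \<bar>m\<bar> * y) - (W x + \<bar>m\<bar> * x)"
      by (simp add: algebra_simps)
  qed
  then show ?thesis
  proof (rule negligible_oscillating_points[where \<alpha> = \<alpha>])
    fix x e :: real assume x: "x \<in> ?S" and e: "e > 0"
    from x e obtain y where y: "y \<noteq> x" "\<bar>y - x\<bar> < e" "(f y - f x) / (y - x) < p"
      by blast
    from secant_interval[OF y(1,2), of f] obtain u v where uv: "u < v" "x \<in> {u..v}" "v - u < e"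
        "f v - f u = (f y - f x) / (y - x) * (v - u)"
      by metis
    have "(f y - f x) / (y - x) - m \<le> - \<alpha>"
      by (rule slope_p[OF y(3)])
    then have "g v - g u \<le> - \<alpha> * (v - u)"
      unfolding g_diff[OF uv(4)] using uv(1) by (intro mult_right_mono) auto
    then show "\<exists>u v. u < v \<and> x \<in> {u..v} \<and> v - u < e \<and> g v - g u \<le> - \<alpha> * (v - u)"
      using uv by blast
    from x e obtain y where y: "y \<noteq> x" "\<bar>y - x\<bar> < e" "(f y - f x) / (y - x) > q"
      by blast
    from secant_interval[OF y(1,2), of f] obtain u v where uv: "u < v" "x \<in> {u..v}" "v - u < e"
        "f v - f u = (f y - f x) / (y - x) * (v - u)"
      by metis
    have "(f y - f x) / (y - x) - m \<ge> \<alpha>"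
      by (rule slope_q[OF y(3)])
    then have "g v - g u \<ge> \<alpha> * (v - u)"
      unfolding g_diff[OF uv(4)] using uv(1) by (intro mult_right_mono) auto
    then show "\<exists>u v. u < v \<and> x \<in> {u..v} \<and> v - u < e \<and> g v - g u \<ge> \<alpha> * (v - u)"
      using uv by blast
  qed (use assms in \<open>auto simp: \<alpha>_def\<close>)
qed

text \<open>The derivative is the lower limit of the difference quotients, the supremum of all eventual lower
  bounds \<open>p\<close>. For rationals \<open>p < q\<close> just above it, \<open>p\<close> is not an eventual lower bound, so \<open>q\<close> is an eventual
  upper bound. Rational gaps make the exceptional set below a countable union.\<close>

lemma convergent_slopes_imp_differentiable:
  fixes f :: "real \<Rightarrow> real"
  assumes bdd: "\<exists>n::nat. \<exists>e>0. \<forall>y. y \<noteq> x \<longrightarrow> \<bar>y - x\<bar> < e \<longrightarrow> \<bar>(f y - f x) / (y - x)\<bar> < real n"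
    and gap: "\<And>p q. p \<in> \<rat> \<Longrightarrow> q \<in> \<rat> \<Longrightarrow> p < q \<Longrightarrow> \<exists>e>0.
      (\<forall>y. y \<noteq> x \<longrightarrow> \<bar>y - x\<bar> < e \<longrightarrow> p \<le> (f y - f x) / (y - x)) \<or>
      (\<forall>y. y \<noteq> x \<longrightarrow> \<bar>y - x\<bar> < e \<longrightarrow> (f y - f x) / (y - x) \<le> q)"
  shows "f differentiable (at x)"
proof -
  define s where "s y = (f y - f x) / (y - x)" for y
  have ev: "eventually P (at x)" if "e > 0" "\<And>y. y \<noteq> x \<Longrightarrow> \<bar>y - x\<bar> < e \<Longrightarrow> P y" for e P
    unfolding eventually_at using that by (intro exI[of _ e]) (auto simp: dist_real_def)
  define A where "A = {p. eventually (\<lambda>y. p \<le> s y) (at x)}"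
  obtain n :: nat and e where n: "e > 0" "\<And>y. y \<noteq> x \<Longrightarrow> \<bar>y - x\<bar> < e \<Longrightarrow> \<bar>s y\<bar> < real n"
    using bdd unfolding s_def by blast
  have "- real n \<le> s y \<and> s y < real n" if "y \<noteq> x" "\<bar>y - x\<bar> < e" for y
    using n(2)[OF that] by linarith
  then have lower: "eventually (\<lambda>y. - real n \<le> s y) (at x)"
      and upper: "eventually (\<lambda>y. s y < real n) (at x)"
    by (simp_all add: ev[OF n(1)])
  have A_le: "p \<le> real n" if "p \<in> A" for p
  proof -
    have "eventually (\<lambda>y. p \<le> s y \<and> s y < real n) (at x)"
      using that upper by (auto simp: A_def eventually_conj)
    then have "\<exists>y. p \<le> s y \<and> s y < real n"
      using eventually_happens'[OF at_neq_bot[of x]] by blast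
    then show ?thesis by auto
  qed
  have A_ne: "A \<noteq> {}" and A_bdd: "bdd_above A"
    using lower A_le by (auto simp: A_def intro!: bdd_aboveI)
  have "(s \<longlongrightarrow> Sup A) (at x)"
  proof (rule order_tendstoI)
    fix r assume "r < Sup A"
    then obtain p where "p \<in> A" "r < p"
      using less_cSupD[OF A_ne] by blast
    then show "eventually (\<lambda>y. r < s y) (at x)"
      unfolding A_def by (auto elim: eventually_mono)
  next
    fix r assume r: "Sup A < r"
    obtain p where p: "p \<in> \<rat>" "Sup A < p" "p < r"
      using Rats_dense_in_real[OF r] by blast
    obtain q where q: "q \<in> \<rat>" "p < q" "q < r"
      using Rats_dense_in_real[OF p(3)] by blast
    from gap[OF p(1) q(1) q(2)] obtain e where e: "e > 0"
      "(\<forall>y. y \<noteq> x \<longrightarrow> \<bar>y - x\<bar> < e \<longrightarrow> p \<le> s y) \<or> (\<forall>y. y \<noteq> x \<longrightarrow> \<bar>y - x\<bar> < e \<longrightarrow> s y \<le> q)"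
      unfolding s_def by blast
    have "\<not> (\<forall>y. y \<noteq> x \<longrightarrow> \<bar>y - x\<bar> < e \<longrightarrow> p \<le> s y)"
    proof
      assume "\<forall>y. y \<noteq> x \<longrightarrow> \<bar>y - x\<bar> < e \<longrightarrow> p \<le> s y"
      then have "p \<in> A"
        by (simp add: A_def ev[OF e(1)])
      then show False
        using cSup_upper[OF _ A_bdd, of p] p(2) by simp
    qed
    then have "\<forall>y. y \<noteq> x \<longrightarrow> \<bar>y - x\<bar> < e \<longrightarrow> s y \<le> q"
      using e(2) by blast
    then show "eventually (\<lambda>y. s y < r) (at x)"
      using q(3) by (intro ev[OF e(1)]) (meson order_le_less_trans)
  qed
  then have "(f has_field_derivative Sup A) (at x)"
    by (simp add: has_field_derivative_iff s_def[abs_def])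
  then show ?thesis
    by (auto simp: differentiable_def has_field_derivative_def)
qed

text \<open>Lebesgue's theorem on functions of bounded variation.\<close>

theorem negligible_nondifferentiable_real:
  fixes f :: "real \<Rightarrow> real"
  assumes W: "variation_majorant W f a b" and "a \<le> b"
  shows "negligible {x \<in> {a<..<b}. \<not> f differentiable (at x)}"
proof -
  define U where "U = {x \<in> {a<..<b}. \<forall>n::nat. \<forall>e>0. \<exists>y. y \<noteq> x \<and> \<bar>y - x\<bar> < e \<and> real n \<le> \<bar>(f y - f x) / (y - x)\<bar>}"
  define G where "G = (\<lambda>(p, q). {x \<in> {a<..<b}. \<forall>e>0. (\<exists>y. y \<noteq> x \<and> \<bar>y - x\<bar> < e \<and> (f y - f x) / (y - x) < p) \<and>
      (\<exists>y. y \<noteq> x \<and> \<bar>y - x\<bar> < e \<and> (f y - f x) / (y - x) > q)})"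
  define P where "P = {(p, q). p \<in> \<rat> \<and> q \<in> \<rat> \<and> p < (q::real)}"
  have sub: "{x \<in> {a<..<b}. \<not> f differentiable (at x)} \<subseteq> U \<union> (\<Union>pq\<in>P. G pq)"
  proof (intro subsetI, rule ccontr)
    fix x assume x: "x \<in> {x \<in> {a<..<b}. \<not> f differentiable (at x)}" and nin: "x \<notin> U \<union> (\<Union>pq\<in>P. G pq)"
    have "f differentiable (at x)"
    proof (rule convergent_slopes_imp_differentiable)
      show "\<exists>n::nat. \<exists>e>0. \<forall>y. y \<noteq> x \<longrightarrow> \<bar>y - x\<bar> < e \<longrightarrow> \<bar>(f y - f x) / (y - x)\<bar> < real n"
        using x nin unfolding U_def not_le[symmetric] by blast
    next
      fix p q :: real assume pq: "p \<in> \<rat>" "q \<in> \<rat>" "p < q"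
      then have "x \<notin> G (p, q)"
        using nin by (auto simp: P_def)
      then show "\<exists>e>0. (\<forall>y. y \<noteq> x \<longrightarrow> \<bar>y - x\<bar> < e \<longrightarrow> p \<le> (f y - f x) / (y - x)) \<or>
          (\<forall>y. y \<noteq> x \<longrightarrow> \<bar>y - x\<bar> < e \<longrightarrow> (f y - f x) / (y - x) \<le> q)"
        using x unfolding G_def not_le[symmetric] by blast
    qed
    then show False
      using x by blast
  qed
  have "countable P"
    by (rule countable_subset[of _ "\<rat> \<times> \<rat>"]) (auto simp: P_def countable_rat)
  moreover have "negligible (G pq)" if "pq \<in> P" for pq
    using that negligible_slope_gap[OF W \<open>a \<le> b\<close>, of "fst pq" "snd pq"]
    by (cases pq) (simp add: P_def G_def)
  ultimately have "negligible (\<Union>pq\<in>P. G pq)"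
    by (intro negligible_countable_Union) auto
  moreover have "negligible U"
    unfolding U_def by (rule negligible_unbounded_slopes[OF assms])
  ultimately show ?thesis
    using negligible_subset[OF negligible_Un sub] by simp
qed

section \<open>Absolutely continuous functions\<close>

text \<open>On an interval shorter than the \<open>\<delta>\<close> that belongs to \<open>\<epsilon> = 1\<close>, the supremum of the sums
  \<open>\<Sum>\<bar>f y - f x\<bar>\<close> over disjoint intervals up to \<open>t\<close> is a majorant. Majorants on adjacent
  intervals can be glued, and bisection reaches the whole interval.\<close>

lemma abs_continuous_imp_majorant:
  fixes f :: "real \<Rightarrow> complex"
  assumes ac: "abs_continuous_on_interval a b f" and "a \<le> b"
  shows "\<exists>W. variation_majorant W f a b"
proof -
  from ac obtain \<delta> where \<delta>: "\<delta> > 0" and small: "\<And>D. finite D \<Longrightarrow>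
      (\<And>x y. (x, y) \<in> D \<Longrightarrow> a \<le> x \<and> x \<le> y \<and> y \<le> b) \<Longrightarrow>
      disjoint_family_on (\<lambda>(x, y). {x<..<y}) D \<Longrightarrow> (\<Sum>(x, y)\<in>D. y - x) < \<delta> \<Longrightarrow>
      (\<Sum>(x, y)\<in>D. norm (f y - f x)) < 1"
    unfolding abs_continuous_on_interval_def by (metis (no_types, lifting) case_prodI2 zero_less_one)
  have short: "\<exists>W. variation_majorant W f c d" if cd: "a \<le> c" "d \<le> b" "d - c < \<delta>" for c d
  proof -
    define F where "F t = {D. finite D \<and> (\<forall>(x, y)\<in>D. c \<le> x \<and> x \<le> y \<and> y \<le> t) \<and>
      disjoint_family_on (\<lambda>(x, y). {x<..<y}) D}" for t
    define s where "s D = (\<Sum>(x, y)\<in>D. norm (f y - f x))" for D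
    define W where "W t = Sup (s ` F t)" for t
    have empty: "{} \<in> F t" for t
      by (auto simp: F_def disjoint_family_on_def)
    have s_le: "s D \<le> 1" if D: "D \<in> F t" and t: "c \<le> t" "t \<le> d" for D t
    proof -
      have "(\<Sum>(x, y)\<in>D. y - x) \<le> t - c"
        by (rule sum_increments_le[where W = "\<lambda>x. x"])
          (use D t in \<open>auto simp: F_def intro!: mono_onI\<close>)
      then have "s D < 1"
        unfolding s_def using D t cd by (intro small) (force simp: F_def)+
      then show ?thesis by simp
    qed
    have bdd: "bdd_above (s ` F t)" if "c \<le> t" "t \<le> d" for t
      using s_le that by (intro bdd_aboveI[of _ 1]) auto
    have "norm (f y - f x) \<le> W y - W x" if xy: "c \<le> x" "x \<le> y" "y \<le> d" for x y
    proof (cases "x = y")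
      case False
      have "W x \<le> W y - norm (f y - f x)"
        unfolding W_def[of x]
      proof (rule cSup_least)
        show "s ` F x \<noteq> {}"
          using empty by blast
      next
        fix r assume "r \<in> s ` F x"
        then obtain D where D: "D \<in> F x" "r = s D"
          by blast
        have D': "a' < y \<and> b' \<le> x" if "(a', b') \<in> D" for a' b'
          using D(1) that xy False unfolding F_def by force
        have new: "(x, y) \<notin> D"
          using D'[of x y] xy False by auto
        have "insert (x, y) D \<in> F y"
          unfolding F_def mem_Collect_eq
        proof (intro conjI)
          show "finite (insert (x, y) D)"
            using D(1) by (simp add: F_def)
          show "\<forall>(u, v)\<in>insert (x, y) D. c \<le> u \<and> u \<le> v \<and> v \<le> y"
            using D(1) xy unfolding F_def by force
          have "{x<..<y} \<inter> (\<Union>(u, v)\<in>D. {u<..<v}) = {}"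
            using D' by fastforce
          then show "disjoint_family_on (\<lambda>(x, y). {x<..<y}) (insert (x, y) D)"
            using D(1) new by (simp add: disjoint_family_on_insert F_def case_prod_unfold)
        qed
        then have "s (insert (x, y) D) \<le> W y"
          unfolding W_def using bdd[of y] xy by (intro cSup_upper) auto
        moreover have "s (insert (x, y) D) = norm (f y - f x) + s D"
          unfolding s_def using D(1) new by (simp add: F_def)
        ultimately show "r \<le> W y - norm (f y - f x)"
          using D(2) by simp
      qed
      then show ?thesis by simp
    qed simp
    then show ?thesis
      unfolding variation_majorant_def by (intro exI[of _ W]) auto
  qed
  have "a \<le> a \<longrightarrow> b \<le> b \<longrightarrow> (\<exists>W. variation_majorant W f a b)"
    using \<open>a \<le> b\<close>
  proof (induction rule: Bolzano[where P = "\<lambda>c d. a \<le> c \<longrightarrow> d \<le> b \<longrightarrow> (\<exists>W. variation_majorant W f c d)"])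
    case (trans c d e)
    show ?case
    proof (intro impI)
      assume "a \<le> c" "e \<le> b"
      then obtain W1 W2 where W: "variation_majorant W1 f c d" "variation_majorant W2 f d e"
        using trans by fastforce
      \<comment> \<open>Both parts are normalized to vanish at the common end point \<open>d\<close>.\<close>
      define W where "W x = (if x \<le> d then W1 x - W1 d else W2 x - W2 d)" for x
      have "norm (f y - f x) \<le> W y - W x" if xy: "c \<le> x" "x \<le> y" "y \<le> e" for x y
      proof -
        consider "y \<le> d" | "d < x" | "x \<le> d" "d < y" by linarith
        then show ?thesis
        proof cases
          case 1
          then show ?thesis
            using variation_majorantD[OF W(1), of x y] xy by (simp add: W_def)
        next
          case 2
          then show ?thesis
            using variation_majorantD[OF W(2), of x y] xy by (simp add: W_def)
        next
          case 3
          have "norm (f y - f x) \<le> norm (f y - f d) + norm (f d - f x)"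
            using norm_triangle_ineq[of "f y - f d" "f d - f x"] by simp
          then show ?thesis
            using variation_majorantD[OF W(1), of x d] variation_majorantD[OF W(2), of d y] xy 3
            by (simp add: W_def)
        qed
      qed
      then show "\<exists>W. variation_majorant W f c e"
        unfolding variation_majorant_def by (intro exI[of _ W]) auto
    qed
  next
    case (local x)
    show ?case
      by (rule exI[of _ \<delta>]) (use \<delta> short in auto)
  qed
  then show ?thesis by simp
qed

lemma negligible_nondifferentiable:
  fixes f :: "real \<Rightarrow> complex"
  assumes W: "variation_majorant W f a b" and "a \<le> b"
  shows "negligible {x \<in> {a<..<b}. \<not> f differentiable (at x)}"
proof -
  have "\<bar>Re (f y) - Re (f x)\<bar> \<le> W y - W x \<and> \<bar>Im (f y) - Im (f x)\<bar> \<le> W y - W x"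
    if "a \<le> x" "x \<le> y" "y \<le> b" for x y
    using variation_majorantD[OF W that] abs_Re_le_cmod[of "f y - f x"] abs_Im_le_cmod[of "f y - f x"]
    by simp
  then have re: "variation_majorant W (\<lambda>x. Re (f x)) a b" and im: "variation_majorant W (\<lambda>x. Im (f x)) a b"
    by (simp_all add: variation_majorant_def)
  have "f differentiable (at x)"
    if "(\<lambda>x. Re (f x)) differentiable (at x)" "(\<lambda>x. Im (f x)) differentiable (at x)" for x
  proof -
    define r i where "r = vector_derivative (\<lambda>x. Re (f x)) (at x)"
      and "i = vector_derivative (\<lambda>x. Im (f x)) (at x)"
    have "((\<lambda>x. Re (f x)) has_vector_derivative r) (at x)" "((\<lambda>x. Im (f x)) has_vector_derivative i) (at x)"
      using that unfolding r_def i_def vector_derivative_works by blast+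
    then have "(f has_vector_derivative Complex r i) (at x)"
      by (simp add: has_vector_derivative_complex_iff has_real_derivative_iff_has_vector_derivative)
    then show ?thesis
      by (meson differentiableI_vector)
  qed
  then have "{x \<in> {a<..<b}. \<not> f differentiable (at x)} \<subseteq>
      {x \<in> {a<..<b}. \<not> (\<lambda>x. Re (f x)) differentiable (at x)} \<union>
      {x \<in> {a<..<b}. \<not> (\<lambda>x. Im (f x)) differentiable (at x)}"
    by blast
  then show ?thesis
    using negligible_nondifferentiable_real[OF re \<open>a \<le> b\<close>] negligible_nondifferentiable_real[OF im \<open>a \<le> b\<close>]
      negligible_subset negligible_Un by blast
qed

text \<open>A gauge integral may be tested tag by tag. At a tag outside \<open>N\<close>, differentiability bounds the
  error by a small multiple of the length. At a tag in \<open>N\<close> the integrand may be taken to be \<open>0\<close> and the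
  error is an increment of \<open>f\<close>; the gauge confines the intervals with such tags to an open set of small
  measure, so absolute continuity makes the sum of these increments small.\<close>

lemma fundamental_theorem_abs_continuous_negligible:
  fixes f :: "real \<Rightarrow> complex"
  assumes ac: "abs_continuous_on_interval a b f" and "a \<le> b" and N: "negligible N"
    and deriv: "\<And>x. x \<in> {a..b} - N \<Longrightarrow> (f has_vector_derivative f' x) (at x within {a..b})"
  shows "(f' has_integral (f b - f a)) {a..b}"
proof -
  define g where "g x = (if x \<in> N then 0 else f' x)" for x
  have "(g has_integral (f b - f a)) (cbox a b)"
    unfolding has_integral
  proof (intro allI impI)
    fix e :: real assume "e > 0"
    define e1 where "e1 = e / (2 * (b - a + 1))"
    have "e1 > 0" "e1 * (b - a) < e / 2"
      using \<open>e > 0\<close> \<open>a \<le> b\<close> by (auto simp: e1_def field_simps)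
    have "\<exists>d>0. x \<in> {a..b} - N \<longrightarrow>
        (\<forall>y\<in>{a..b}. norm (y - x) < d \<longrightarrow> norm (f y - f x - (y - x) *\<^sub>R f' x) \<le> e1 * norm (y - x))" for x
      using deriv[of x] \<open>e1 > 0\<close>
      unfolding has_vector_derivative_def has_derivative_within_alt by (metis zero_less_one)
    then obtain d where d: "\<And>x. d x > 0"
      "\<And>x y. x \<in> {a..b} - N \<Longrightarrow> y \<in> {a..b} \<Longrightarrow> norm (y - x) < d x \<Longrightarrow>
          norm (f y - f x - (y - x) *\<^sub>R f' x) \<le> e1 * norm (y - x)"
      by metis
    have "e / 2 > 0"
      using \<open>e > 0\<close> by simp
    with ac obtain \<delta> where \<delta>: "\<delta> > 0" and small: "\<forall>D. finite D \<longrightarrow>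
        (\<forall>(x, y)\<in>D. a \<le> x \<and> x \<le> y \<and> y \<le> b) \<longrightarrow>
        disjoint_family_on (\<lambda>(x, y). {x<..<y}) D \<longrightarrow> (\<Sum>(x, y)\<in>D. y - x) < \<delta> \<longrightarrow>
        (\<Sum>(x, y)\<in>D. norm (f y - f x)) < e / 2"
      unfolding abs_continuous_on_interval_def by meson
    have "N \<in> sets lebesgue"
      using N by (rule negligible_imp_sets)
    then obtain T where T: "open T" "N \<subseteq> T" "T - N \<in> lmeasurable" "emeasure lebesgue (T - N) < ennreal \<delta>"
      using sets_lebesgue_outer_open[of N \<delta>] \<delta> by blast
    have T': "T \<in> lmeasurable" "measure lebesgue T < \<delta>"
    proof -
      have eq: "T = (T - N) \<union> N"
        using T(2) by blast
      show "T \<in> lmeasurable"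
        by (subst eq) (intro fmeasurable.Un T negligible_imp_measurable N)
      have "measure lebesgue T \<le> measure lebesgue (T - N) + measure lebesgue N"
        by (subst eq, rule measure_Un_le) (use T(3) N negligible_imp_sets in auto)
      also have "measure lebesgue N = 0"
        using N by (rule negligible_imp_measure0)
      also have "measure lebesgue (T - N) < \<delta>"
        using T(3,4) \<delta> by (simp add: emeasure_eq_measure2 ennreal_less_iff)
      finally show "measure lebesgue T < \<delta>"
        by simp
    qed
    have "\<exists>r>0. x \<in> N \<longrightarrow> ball x r \<subseteq> T" for x
      using T(1,2) unfolding open_contains_ball by (metis subsetD zero_less_one)
    then obtain r where r: "\<And>x. r x > 0" "\<And>x. x \<in> N \<Longrightarrow> ball x (r x) \<subseteq> T"
      by metis
    define \<gamma> where "\<gamma> x = (if x \<in> N then ball x (r x) else ball x (d x))" for x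
    have "gauge \<gamma>"
      by (auto simp: gauge_def \<gamma>_def d r)
    moreover have "norm ((\<Sum>(x, K)\<in>p. measure lborel K *\<^sub>R g x) - (f b - f a)) < e"
      if p: "p tagged_division_of cbox a b" "\<gamma> fine p" for p
    proof -
      have fin: "finite p"
        using p(1) by blast
      have pK: "\<exists>u v. K = cbox u v" "x \<in> K" "K \<subseteq> {a..b}" if "(x, K) \<in> p" for x K
        using tagged_division_ofD[OF p(1)] that by auto
      have ends: "K = {Inf K..Sup K}" "Inf K \<le> Sup K" "interior K = {Inf K<..<Sup K}"
          "a \<le> Inf K" "Sup K \<le> b" "measure lborel K = Sup K - Inf K" if xK: "(x, K) \<in> p" for x K
      proof -
        obtain u v where K: "K = cbox u v"
          using pK(1)[OF xK] by blast
        then have "u \<le> v" "K = {u..v}"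
          using pK(2)[OF xK] by auto
        then show "K = {Inf K..Sup K}" "Inf K \<le> Sup K" "interior K = {Inf K<..<Sup K}"
            "a \<le> Inf K" "Sup K \<le> b" "measure lborel K = Sup K - Inf K"
          using pK(3)[OF xK] by (auto simp: interior_atLeastAtMost_real)
      qed
      have total: "b - a = (\<Sum>(x, K)\<in>p. Sup K - Inf K)" "f b - f a = (\<Sum>(x, K)\<in>p. f (Sup K) - f (Inf K))"
        using additive_tagged_division_1[of a b p "\<lambda>x. x"] additive_tagged_division_1[of a b p f]
          \<open>a \<le> b\<close> p(1) by auto
      define P where "P = {(x, K) \<in> p. x \<notin> N}"
      define Q where "Q = {(x, K) \<in> p. x \<in> N}"
      \<comment> \<open>Intervals with disjoint interiors can share both end points only if they are degenerate; those contribute nothing.\<close>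
      define Q' where "Q' = {(x, K) \<in> p. x \<in> N \<and> Inf K < Sup K}"
      have PQ: "p = P \<union> Q" "P \<inter> Q = {}" "finite P" "finite Q" "finite Q'"
        using fin by (auto simp: P_def Q_def Q'_def intro: finite_subset[OF _ fin])
      have good: "norm (measure lborel K *\<^sub>R g x - (f (Sup K) - f (Inf K))) \<le> e1 * (Sup K - Inf K)"
        if xK: "(x, K) \<in> P" for x K
      proof -
        have xK': "(x, K) \<in> p" "x \<notin> N"
          using xK by (auto simp: P_def)
        note E = ends[OF xK'(1)]
        define u v where "u = Inf K" and "v = Sup K"
        have K: "K = {u..v}" "u \<le> v" "a \<le> u" "v \<le> b" "measure lborel K = v - u"
          using E by (simp_all add: u_def v_def)
        have x: "u \<le> x" "x \<le> v"
          using pK(2)[OF xK'(1)] K(1) by auto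
        have "K \<subseteq> ball x (d x)"
          using fineD[OF p(2) xK'(1)] xK'(2) by (simp add: \<gamma>_def)
        then have uv: "u \<in> ball x (d x)" "v \<in> ball x (d x)"
          using K(1,2) by auto
        have "norm ((v - u) *\<^sub>R f' x - (f v - f u)) =
            norm ((f u - f x - (u - x) *\<^sub>R f' x) - (f v - f x - (v - x) *\<^sub>R f' x))"
          by (rule arg_cong[of _ _ norm]) (simp add: algebra_simps)
        also have "\<dots> \<le> norm (f u - f x - (u - x) *\<^sub>R f' x) + norm (f v - f x - (v - x) *\<^sub>R f' x)"
          by (rule norm_triangle_ineq4)
        also have "\<dots> \<le> e1 * norm (u - x) + e1 * norm (v - x)"
          using K x xK' uv by (intro add_mono d(2)) (auto simp: dist_norm norm_minus_commute)
        also have "\<dots> = e1 * (v - u)"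
          using x by (simp add: algebra_simps)
        finally show ?thesis
          using xK'(2) K(5) by (simp add: g_def u_def[symmetric] v_def[symmetric])
      qed
      have "norm ((\<Sum>(x, K)\<in>p. measure lborel K *\<^sub>R g x) - (f b - f a)) =
          norm ((\<Sum>(x, K)\<in>P. measure lborel K *\<^sub>R g x - (f (Sup K) - f (Inf K))) +
                (\<Sum>(x, K)\<in>Q. measure lborel K *\<^sub>R g x - (f (Sup K) - f (Inf K))))"
        unfolding total(2) using PQ
        by (simp add: sum_subtractf[symmetric] case_prod_unfold sum.union_disjoint[symmetric])
      also have "\<dots> \<le> norm (\<Sum>(x, K)\<in>P. measure lborel K *\<^sub>R g x - (f (Sup K) - f (Inf K))) +
                norm (\<Sum>(x, K)\<in>Q. measure lborel K *\<^sub>R g x - (f (Sup K) - f (Inf K)))"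
        by (rule norm_triangle_ineq)
      also have "norm (\<Sum>(x, K)\<in>P. measure lborel K *\<^sub>R g x - (f (Sup K) - f (Inf K))) \<le>
          (\<Sum>(x, K)\<in>P. e1 * (Sup K - Inf K))"
        using good by (intro sum_norm_le) auto
      also have "\<dots> \<le> (\<Sum>(x, K)\<in>p. e1 * (Sup K - Inf K))"
        using fin ends \<open>e1 > 0\<close> by (intro sum_mono2) (auto simp: P_def)
      also have "\<dots> = e1 * (b - a)"
        unfolding total(1) by (simp add: sum_distrib_left case_prod_unfold)
      also have "\<dots> < e / 2"
        by fact
      also have "norm (\<Sum>(x, K)\<in>Q. measure lborel K *\<^sub>R g x - (f (Sup K) - f (Inf K))) \<le>
          (\<Sum>(x, K)\<in>Q. norm (f (Sup K) - f (Inf K)))"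
        by (intro sum_norm_le) (auto simp: Q_def g_def norm_minus_commute)
      also have "\<dots> = (\<Sum>(x, K)\<in>Q'. norm (f (Sup K) - f (Inf K)))"
      proof (rule sum.mono_neutral_right)
        show "\<forall>i\<in>Q - Q'. (case i of (x, K) \<Rightarrow> norm (f (Sup K) - f (Inf K))) = 0"
        proof clarify
          fix x K assume "(x, K) \<in> Q" "(x, K) \<notin> Q'"
          then have "Sup K = Inf K"
            using ends(2)[of x K] by (auto simp: Q_def Q'_def)
          then show "norm (f (Sup K) - f (Inf K)) = 0"
            by simp
        qed
      qed (use PQ in \<open>auto simp: Q_def Q'_def\<close>)
      also have "\<dots> = (\<Sum>(u, v)\<in>(\<lambda>(x, K). (Inf K, Sup K)) ` Q'. norm (f v - f u))"
      proof -
        have "inj_on (\<lambda>(x, K). (Inf K, Sup K)) Q'"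
        proof (rule inj_onI, clarify)
          fix x K x' K' assume 1: "(x, K) \<in> Q'" "(x', K') \<in> Q'" "Inf K = Inf K'" "Sup K = Sup K'"
          then have 2: "(x, K) \<in> p" "(x', K') \<in> p" "Inf K < Sup K"
            by (auto simp: Q'_def)
          show "x = x' \<and> K = K'"
          proof (rule ccontr)
            assume "\<not> (x = x' \<and> K = K')"
            then have "interior K \<inter> interior K' = {}"
              using tagged_division_ofD(5)[OF p(1) 2(1,2)] by blast
            then show False
              using ends(3)[OF 2(1)] ends(3)[OF 2(2)] 1 2(3) by (simp add: 1)
          qed
        qed
        then show ?thesis
          by (simp add: sum.reindex case_prod_unfold)
      qed
      also have "\<dots> < e / 2"
      proof -
        define D where "D = (\<lambda>(x, K). (Inf K, Sup K)) ` Q'"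
        have D1: "\<forall>(u, v)\<in>D. a \<le> u \<and> u \<le> v \<and> v \<le> b"
          using ends unfolding D_def Q'_def by fastforce
        have DE: "\<exists>x K. (x, K) \<in> p \<and> x \<in> N \<and> m = (Inf K, Sup K)" if "m \<in> D" for m
          using that by (auto simp: D_def Q'_def)
        have D2: "disjoint_family_on (\<lambda>(x, y). {x<..<y}) D"
          unfolding disjoint_family_on_def
        proof (intro ballI impI)
          fix m n assume "m \<in> D" "n \<in> D" "m \<noteq> n"
          then obtain x K x' K' where 1: "(x, K) \<in> p" "(x', K') \<in> p"
              "m = (Inf K, Sup K)" "n = (Inf K', Sup K')"
            using DE by meson
          then have "(x, K) \<noteq> (x', K')"
            using \<open>m \<noteq> n\<close> by auto
          then have "interior K \<inter> interior K' = {}"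
            using tagged_division_ofD(5)[OF p(1) 1(1,2)] by blast
          then show "(case m of (x, y) \<Rightarrow> {x<..<y}) \<inter> (case n of (x, y) \<Rightarrow> {x<..<y}) = {}"
            using ends(3)[OF 1(1)] ends(3)[OF 1(2)] 1 by simp
        qed
        have fD: "finite D"
          using PQ by (simp add: D_def)
        have "(\<Sum>(u, v)\<in>D. v - u) = (\<Sum>q\<in>D. measure lebesgue (case q of (u, v) \<Rightarrow> {u<..<v}))"
          using D1 by (intro sum.cong) auto
        also have "\<dots> = measure lebesgue (\<Union>q\<in>D. case q of (u, v) \<Rightarrow> {u<..<v})"
        proof (rule measure_finite_Union[symmetric])
          show "emeasure lebesgue (case q of (u, v) \<Rightarrow> {u<..<v}) \<noteq> \<infinity>" if "q \<in> D" for q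
            using D1 that by (cases q) auto
        qed (use fD D2 in \<open>auto split: prod.splits\<close>)
        also have "\<dots> \<le> measure lebesgue T"
        proof (rule measure_mono_fmeasurable)
          show "(\<Union>q\<in>D. case q of (u, v) \<Rightarrow> {u<..<v}) \<subseteq> T"
          proof clarify
            fix u v z assume "(u, v) \<in> D" and z: "z \<in> {u<..<v}"
            then obtain x K where 1: "(x, K) \<in> p" "x \<in> N" "u = Inf K" "v = Sup K"
              using DE by blast
            have "K \<subseteq> T"
              using fineD[OF p(2) 1(1)] 1(2) r(2)[of x] by (simp add: \<gamma>_def)
            moreover have "z \<in> K"
              by (subst ends(1)[OF 1(1)]) (use z 1 in auto)
            ultimately show "z \<in> T"
              by blast
          qed
        qed (use T' fD in \<open>auto split: prod.splits\<close>)
        also have "\<dots> < \<delta>"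
          by (rule T'(2))
        finally have "(\<Sum>(u, v)\<in>D. v - u) < \<delta>" .
        then show ?thesis
          using small[rule_format, OF fD _ D2] D1 unfolding D_def[symmetric] by fastforce
      qed
      finally show ?thesis
        by simp
    qed
    ultimately show "\<exists>\<gamma>. gauge \<gamma> \<and> (\<forall>p. p tagged_division_of cbox a b \<and> \<gamma> fine p \<longrightarrow>
        norm ((\<Sum>(x, K)\<in>p. measure lborel K *\<^sub>R g x) - (f b - f a)) < e)"
      by (intro exI[of _ \<gamma>]) simp
  qed
  then have "(g has_integral (f b - f a)) {a..b}"
    by simp
  then show ?thesis
    by (rule has_integral_spike[OF N, rotated]) (auto simp: g_def)
qed

lemma abs_continuous_on_subinterval:
  assumes "abs_continuous_on_interval a b f" "a \<le> c" "d \<le> b"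
  shows "abs_continuous_on_interval c d f"
  unfolding abs_continuous_on_interval_def
proof (intro allI impI)
  fix e :: real assume "e > 0"
  then obtain \<delta> where \<delta>: "\<delta> > 0" and small: "\<forall>D. finite D \<longrightarrow>
      (\<forall>(x, y)\<in>D. a \<le> x \<and> x \<le> y \<and> y \<le> b) \<longrightarrow>
      disjoint_family_on (\<lambda>(x, y). {x<..<y}) D \<longrightarrow> (\<Sum>(x, y)\<in>D. y - x) < \<delta> \<longrightarrow>
      (\<Sum>(x, y)\<in>D. norm (f y - f x)) < e"
    using assms(1) unfolding abs_continuous_on_interval_def by meson
  have "(\<Sum>(x, y)\<in>D. norm (f y - f x)) < e"
    if "finite D" "\<forall>(x, y)\<in>D. c \<le> x \<and> x \<le> y \<and> y \<le> d"
      "disjoint_family_on (\<lambda>(x, y). {x<..<y}) D" "(\<Sum>(x, y)\<in>D. y - x) < \<delta>" for D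
  proof -
    have "\<forall>(x, y)\<in>D. a \<le> x \<and> x \<le> y \<and> y \<le> b"
      using that(2) assms(2,3) by fastforce
    then show ?thesis
      using small that by blast
  qed
  then show "\<exists>\<delta>>0. \<forall>D. finite D \<longrightarrow> (\<forall>(x, y)\<in>D. c \<le> x \<and> x \<le> y \<and> y \<le> d) \<longrightarrow>
      disjoint_family_on (\<lambda>(x, y). {x<..<y}) D \<longrightarrow> (\<Sum>(x, y)\<in>D. y - x) < \<delta> \<longrightarrow>
      (\<Sum>(x, y)\<in>D. norm (f y - f x)) < e"
    using \<delta> by blast
qed

theorem abs_continuous_has_integral:
  assumes ac: "abs_continuous_on_interval a b f" and "a \<le> b"
  shows "((\<lambda>x. vector_derivative f (at x)) has_integral (f b - f a)) {a..b}"
proof -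
  obtain W where W: "variation_majorant W f a b"
    using abs_continuous_imp_majorant[OF assms] by blast
  define N where "N = {a, b} \<union> {x \<in> {a<..<b}. \<not> f differentiable (at x)}"
  have "negligible N"
    unfolding N_def using negligible_nondifferentiable[OF W \<open>a \<le> b\<close>] by auto
  then show ?thesis
  proof (rule fundamental_theorem_abs_continuous_negligible[OF ac \<open>a \<le> b\<close>])
    fix x assume "x \<in> {a..b} - N"
    then have "f differentiable (at x)"
      by (auto simp: N_def)
    then show "(f has_vector_derivative vector_derivative f (at x)) (at x within {a..b})"
      unfolding vector_derivative_works by (rule has_vector_derivative_at_within)
  qed
qed

text \<open>Gauge integrability becomes Lebesgue integrability because the sums of \<open>\<bar>\<integral>\<^sub>K f'\<bar>\<close> over the
  intervals \<open>K\<close> of a division are sums of increments of \<open>f\<close>, hence bounded by its variation.\<close>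

theorem abs_continuous_absolutely_integrable:
  assumes ac: "abs_continuous_on_interval a b f" and "a \<le> b"
  shows "(\<lambda>x. vector_derivative f (at x)) absolutely_integrable_on {a..b}"
proof -
  obtain W where W: "variation_majorant W f a b"
    using abs_continuous_imp_majorant[OF assms] by blast
  have "(\<lambda>x. vector_derivative f (at x)) absolutely_integrable_on cbox a b"
  proof (rule bounded_variation_absolutely_integrable_interval)
    show "(\<lambda>x. vector_derivative f (at x)) integrable_on cbox a b"
      using abs_continuous_has_integral[OF assms] by auto
  next
    fix p assume p: "p division_of cbox a b"
    have ends: "K = {Inf K..Sup K}" "Inf K \<le> Sup K" "interior K = {Inf K<..<Sup K}"
        "a \<le> Inf K" "Sup K \<le> b" if K: "K \<in> p" for K
    proof -
      obtain u v where K': "K = cbox u v"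
        using division_ofD(4)[OF p K] by blast
      moreover have "K \<noteq> {}" "K \<subseteq> {a..b}"
        using division_ofD(2,3)[OF p K] by auto
      ultimately have "u \<le> v" "K = {u..v}" "a \<le> u" "v \<le> b"
        by auto
      then show "K = {Inf K..Sup K}" "Inf K \<le> Sup K" "interior K = {Inf K<..<Sup K}"
          "a \<le> Inf K" "Sup K \<le> b"
        by (auto simp: interior_atLeastAtMost_real)
    qed
    define D where "D = (\<lambda>K. (Inf K, Sup K)) ` p"
    have inj: "inj_on (\<lambda>K. (Inf K, Sup K)) p"
    proof (rule inj_onI)
      fix K K' assume K: "K \<in> p" "K' \<in> p" and eq: "(Inf K, Sup K) = (Inf K', Sup K')"
      have "K = {Inf K'..Sup K'}"
        using ends(1)[OF K(1)] eq by simp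
      then show "K = K'"
        using ends(1)[OF K(2)] by simp
    qed
    have "(\<Sum>K\<in>p. norm (integral K (\<lambda>x. vector_derivative f (at x)))) = (\<Sum>K\<in>p. norm (f (Sup K) - f (Inf K)))"
    proof (rule sum.cong[OF refl])
      fix K assume K: "K \<in> p"
      have "((\<lambda>x. vector_derivative f (at x)) has_integral (f (Sup K) - f (Inf K))) {Inf K..Sup K}"
        using ends[OF K] by (intro abs_continuous_has_integral abs_continuous_on_subinterval[OF ac]) auto
      then show "norm (integral K (\<lambda>x. vector_derivative f (at x))) = norm (f (Sup K) - f (Inf K))"
        using ends(1)[OF K] by (simp add: integral_unique)
    qed
    also have "\<dots> \<le> (\<Sum>K\<in>p. W (Sup K) - W (Inf K))"
      using ends by (intro sum_mono variation_majorantD[OF W]) auto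
    also have "\<dots> = (\<Sum>(u, v)\<in>D. W v - W u)"
      unfolding D_def using inj by (simp add: sum.reindex)
    also have "\<dots> \<le> W b - W a"
    proof (rule sum_increments_le)
      show "finite D"
        using p by (auto simp: D_def)
      show "disjoint_family_on (\<lambda>(x, y). {x<..<y}) D"
        unfolding disjoint_family_on_def
      proof (intro ballI impI)
        fix m n assume "m \<in> D" "n \<in> D" "m \<noteq> n"
        then obtain K K' where 1: "K \<in> p" "K' \<in> p" "m = (Inf K, Sup K)" "n = (Inf K', Sup K')"
          unfolding D_def by blast
        then have "interior K \<inter> interior K' = {}"
          using division_ofD(5)[OF p 1(1,2)] \<open>m \<noteq> n\<close> by blast
        then show "(case m of (x, y) \<Rightarrow> {x<..<y}) \<inter> (case n of (x, y) \<Rightarrow> {x<..<y}) = {}"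
          using ends(3)[OF 1(1)] ends(3)[OF 1(2)] 1 by simp
      qed
    qed (use ends variation_majorant_mono[OF W] \<open>a \<le> b\<close> in \<open>auto simp: D_def\<close>)
    finally show "(\<Sum>K\<in>p. norm (integral K (\<lambda>x. vector_derivative f (at x)))) \<le> W b - W a" .
  qed
  then show ?thesis
    by simp
qed

text \<open>Cut \<open>\<bar>g\<bar>\<close> at a height \<open>n\<close>: what exceeds \<open>n\<close> has small integral by dominated convergence, and the
  rest contributes at most \<open>n\<close> times the total length of the intervals.\<close>

lemma abs_continuous_indefinite_integral:
  fixes g F :: "real \<Rightarrow> complex"
  assumes g: "integrable lborel g"
    and F: "\<And>x y. a \<le> x \<Longrightarrow> x \<le> y \<Longrightarrow> y \<le> b \<Longrightarrow> F y - F x = (LINT s|lborel. indicator {x<..<y} s *\<^sub>R g s)"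
  shows "abs_continuous_on_interval a b F"
  unfolding abs_continuous_on_interval_def
proof (intro allI impI)
  fix e :: real assume "e > 0"
  have [measurable]: "g \<in> borel_measurable borel"
    using g by auto
  define r where "r n s = (if norm (g s) > real n then norm (g s) else 0)" for n :: nat and s
  have r_le: "norm (r n s) \<le> norm (g s)" for n s
    by (simp add: r_def)
  have [measurable]: "r n \<in> borel_measurable borel" for n
    unfolding r_def[abs_def] by measurable
  have r_int: "integrable lborel (r n)" for n
    by (rule Bochner_Integration.integrable_bound[OF integrable_norm[OF g]]) (use r_le in auto)
  have "(\<lambda>n. LINT s|lborel. r n s) \<longlonglongrightarrow> (LINT s|(lborel::real measure). (0::real))"
  proof (rule integral_dominated_convergence[where w = "\<lambda>s. norm (g s)"])
    have "(\<lambda>n. r n s) \<longlonglongrightarrow> 0" for s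
    proof (rule tendsto_eventually)
      obtain n where "norm (g s) \<le> real n"
        using real_arch_simple by blast
      then show "eventually (\<lambda>n. r n s = 0) sequentially"
        by (intro eventually_sequentiallyI[of n]) (auto simp: r_def)
    qed
    then show "AE s in lborel. (\<lambda>n. r n s) \<longlonglongrightarrow> 0"
      by simp
  qed (use g r_le in auto)
  then have "(\<lambda>n. LINT s|lborel. r n s) \<longlonglongrightarrow> 0"
    by simp
  then have "eventually (\<lambda>n. (LINT s|lborel. r n s) < e / 2) sequentially"
    using \<open>e > 0\<close> by (intro order_tendstoD) auto
  then obtain n where n: "(LINT s|lborel. r n s) < e / 2"
    by (auto simp: eventually_sequentially)
  define \<delta> where "\<delta> = e / (2 * (real n + 1))"
  have "\<delta> > 0"
    using \<open>e > 0\<close> by (simp add: \<delta>_def)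
  moreover have "(\<Sum>(x, y)\<in>D. norm (F y - F x)) < e"
    if D: "finite D" "\<forall>(x, y)\<in>D. a \<le> x \<and> x \<le> y \<and> y \<le> b"
      "disjoint_family_on (\<lambda>(x, y). {x<..<y}) D" "(\<Sum>(x, y)\<in>D. y - x) < \<delta>" for D
  proof -
    have int1: "integrable lborel (\<lambda>s. indicator {x<..<y} s * r n s)" for x y
      using integrable_mult_indicator[OF _ r_int[of n], of "{x<..<y}"] by simp
    have int2: "integrable lborel (\<lambda>s. indicator {x<..<y} s * real n)" if "x \<le> y" for x y :: real
      using that by (intro integrable_mult_left integrable_real_indicator) auto
    have int3: "integrable lborel (\<lambda>s. indicator {x<..<y} s *\<^sub>R g s)" for x y
      using integrable_mult_indicator[OF _ g, of "{x<..<y}"] by simp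
    have "(\<Sum>(x, y)\<in>D. norm (F y - F x)) \<le>
        (\<Sum>(x, y)\<in>D. (LINT s|lborel. indicator {x<..<y} s * r n s) + real n * (y - x))"
    proof (rule sum_mono, clarify)
      fix x y assume "(x, y) \<in> D"
      then have xy: "a \<le> x" "x \<le> y" "y \<le> b"
        using D(2) by auto
      have "norm (F y - F x) \<le> (LINT s|lborel. indicator {x<..<y} s * r n s + indicator {x<..<y} s * real n)"
        unfolding F[OF xy]
      proof (rule Bochner_Integration.integral_norm_bound_integral[OF int3])
        show "integrable lborel (\<lambda>s. indicator {x<..<y} s * r n s + indicator {x<..<y} s * real n)"
          by (intro Bochner_Integration.integrable_add int1 int2 xy)
        show "norm (indicator {x<..<y} s *\<^sub>R g s) \<le> indicator {x<..<y} s * r n s + indicator {x<..<y} s * real n" for s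
          by (simp add: indicator_def r_def)
      qed
      also have "\<dots> = (LINT s|lborel. indicator {x<..<y} s * r n s) + (LINT s|lborel. indicator {x<..<y} s * real n)"
        by (intro Bochner_Integration.integral_add int1 int2 xy)
      also have "(LINT s|lborel. indicator {x<..<y} s * real n) = real n * (y - x)"
        using xy by simp
      finally show "norm (F y - F x) \<le> (LINT s|lborel. indicator {x<..<y} s * r n s) + real n * (y - x)" .
    qed
    also have "\<dots> = (\<Sum>(x, y)\<in>D. LINT s|lborel. indicator {x<..<y} s * r n s) + real n * (\<Sum>(x, y)\<in>D. y - x)"
      by (simp add: sum.distrib case_prod_unfold sum_distrib_left)
    also have "(\<Sum>(x, y)\<in>D. LINT s|lborel. indicator {x<..<y} s * r n s) =
        (LINT s|lborel. (\<Sum>(x, y)\<in>D. indicator {x<..<y} s * r n s))"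
      unfolding case_prod_unfold by (rule Bochner_Integration.integral_sum[symmetric]) (rule int1)
    also have "\<dots> \<le> (LINT s|lborel. r n s)"
    proof (rule integral_mono)
      show "integrable lborel (\<lambda>s. \<Sum>(x, y)\<in>D. indicator {x<..<y} s * r n s)"
        unfolding case_prod_unfold by (intro Bochner_Integration.integrable_sum int1)
      show "(\<Sum>(x, y)\<in>D. indicator {x<..<y} s * r n s) \<le> r n s" for s
      proof -
        have "(\<Sum>(x, y)\<in>D. indicator {x<..<y} s * r n s) =
            (\<Sum>q\<in>D. indicator ((\<lambda>(x, y). {x<..<y}) q) s) * r n s"
          by (simp add: sum_distrib_right case_prod_unfold)
        also have "\<dots> = indicator (\<Union>q\<in>D. (\<lambda>(x, y). {x<..<y}) q) s * r n s"
          by (simp only: indicator_UN_disjoint[OF D(1,3)])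
        also have "\<dots> \<le> r n s"
          by (simp add: indicator_def r_def)
        finally show ?thesis .
      qed
    qed (rule r_int)
    also have "\<dots> + real n * (\<Sum>(x, y)\<in>D. y - x) < e / 2 + e / 2"
    proof (rule add_less_le_mono[OF n])
      have "real n * (\<Sum>(x, y)\<in>D. y - x) \<le> real n * \<delta>"
        using D(4) by (intro mult_left_mono) auto
      also have "\<dots> \<le> e / 2"
        using \<open>e > 0\<close> by (simp add: \<delta>_def field_simps)
      finally show "real n * (\<Sum>(x, y)\<in>D. y - x) \<le> e / 2" .
    qed
    finally show ?thesis
      by simp
  qed
  ultimately show "\<exists>\<delta>>0. \<forall>D. finite D \<longrightarrow> (\<forall>(x, y)\<in>D. a \<le> x \<and> x \<le> y \<and> y \<le> b) \<longrightarrow>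
      disjoint_family_on (\<lambda>(x, y). {x<..<y}) D \<longrightarrow> (\<Sum>(x, y)\<in>D. y - x) < \<delta> \<longrightarrow>
      (\<Sum>(x, y)\<in>D. norm (F y - F x)) < e"
    by blast
qed

lemma abs_continuous_imp_continuous_on:
  assumes ac: "abs_continuous_on_interval a b f"
  shows "continuous_on {a..b} f"
  unfolding continuous_on_iff
proof (intro ballI allI impI)
  fix x e :: real assume x: "x \<in> {a..b}" and "e > 0"
  then obtain \<delta> where \<delta>: "\<delta> > 0" and small: "\<forall>D. finite D \<longrightarrow>
      (\<forall>(x, y)\<in>D. a \<le> x \<and> x \<le> y \<and> y \<le> b) \<longrightarrow>
      disjoint_family_on (\<lambda>(x, y). {x<..<y}) D \<longrightarrow> (\<Sum>(x, y)\<in>D. y - x) < \<delta> \<longrightarrow>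
      (\<Sum>(x, y)\<in>D. norm (f y - f x)) < e"
    using ac unfolding abs_continuous_on_interval_def by meson
  have pair: "norm (f v - f u) < e" if "a \<le> u" "u \<le> v" "v \<le> b" "v - u < \<delta>" for u v
    using small[rule_format, of "{(u, v)}"] that by (simp add: disjoint_family_on_def)
  have "dist (f y) (f x) < e" if "y \<in> {a..b}" "dist y x < \<delta>" for y
    using pair[of x y] pair[of y x] x that
    by (cases "x \<le> y") (auto simp: dist_norm norm_minus_commute)
  then show "\<exists>d>0. \<forall>y\<in>{a..b}. dist y x < d \<longrightarrow> dist (f y) (f x) < e"
    using \<delta> by blast
qed

section \<open>The convolution semigroup of Prabhakar kernels\<close>

text \<open>Restrict Euler's integral to \<open>{R..2 * R}\<close>, where the integrand is at least
  \<open>R\<^bsup>z-1\<^esup> e\<^bsup>-2R\<^esup>\<close>.\<close>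

lemma Gamma_lower_bound:
  fixes z R :: real
  assumes "z \<ge> 1" "R > 0"
  shows "R powr z * exp (- (2 * R)) \<le> Gamma z"
proof -
  define c where "c = R powr (z - 1) * exp (- (2 * R))"
  have "((\<lambda>t::real. c) has_integral R * c) {R..2 * R}"
    using has_integral_const_real[of c R "2 * R"] assms by simp
  then have 1: "((\<lambda>t. if t \<in> {R..2 * R} then c else 0) has_integral R * c) {0..}"
    using assms by (subst has_integral_restrict) auto
  have "R * c \<le> Gamma z"
  proof (rule has_integral_le[OF 1])
    show "((\<lambda>t. t powr (z - 1) / exp t) has_integral Gamma z) {0..}"
      using assms by (intro Gamma_integral_real) auto
    show "(if t \<in> {R..2 * R} then c else 0) \<le> t powr (z - 1) / exp t" if "t \<in> {0..}" for t
    proof (cases "t \<in> {R..2 * R}")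
      case True
      have "c \<le> t powr (z - 1) * exp (- t)"
        unfolding c_def using True assms by (intro mult_mono powr_mono2) auto
      then show ?thesis
        using True by (simp add: exp_minus field_simps)
    qed auto
  qed
  moreover have "R * c = R powr z * exp (- (2 * R))"
    using assms by (simp add: c_def powr_diff)
  ultimately show ?thesis by simp
qed

lemma rGamma_pos: "z > 0 \<Longrightarrow> rGamma (z::real) > 0"
  by (simp add: rGamma_inverse_Gamma)

text \<open>As \<open>R\<close> is free in the lower bound for \<open>\<Gamma>\<close>, the reciprocal decays faster than any geometric
  sequence; \<open>R\<^bsup>\<rho>\<^esup> = 2 x + 1\<close> leaves the ratio \<open>x / (2 x + 1) < 1\<close>.\<close>

lemma summable_power_rGamma:
  fixes x \<rho> \<mu> :: real
  assumes "\<rho> > 0" "\<mu> > 0" "x \<ge> 0"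
  shows "summable (\<lambda>k. x ^ k * rGamma (\<rho> * real k + \<mu>))"
proof -
  define R where "R = (2 * x + 1) powr (1 / \<rho>)"
  define q where "q = x / (2 * x + 1)"
  have R: "R > 0" "R powr \<rho> = 2 * x + 1"
    using assms by (auto simp: R_def powr_powr)
  have "eventually (\<lambda>k. norm (x ^ k * rGamma (\<rho> * real k + \<mu>)) \<le> (exp (2 * R) * R powr (- \<mu>)) * q ^ k) sequentially"
  proof -
    \<comment> \<open>The bound for \<open>\<Gamma>\<close> needs arguments of at least \<open>1\<close>.\<close>
    obtain n :: nat where n: "real n \<ge> 1 / \<rho>"
      using real_arch_simple by blast
    show ?thesis
      using eventually_ge_at_top[of n]
    proof eventually_elim
      case (elim k)
      have "1 \<le> \<rho> * real n"
        using n assms by (simp add: field_simps)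
      also have "\<dots> \<le> \<rho> * real k"
        using elim assms by simp
      finally have z: "\<rho> * real k + \<mu> \<ge> 1"
        using assms by simp
      then have pos: "\<rho> * real k + \<mu> > 0"
        by simp
      have "rGamma (\<rho> * real k + \<mu>) \<le> 1 / (R powr (\<rho> * real k + \<mu>) * exp (- (2 * R)))"
        unfolding rGamma_inverse_Gamma inverse_eq_divide
        using Gamma_lower_bound[OF z R(1)] R(1) pos by (intro divide_left_mono) auto
      also have "\<dots> = exp (2 * R) * R powr (- \<mu>) / (2 * x + 1) ^ k"
        using R(1) assms(3) by (simp add: powr_add powr_mult exp_minus powr_minus field_simps
          powr_powr[symmetric] R(2) powr_realpow add_pos_nonneg)
      finally have "x ^ k * rGamma (\<rho> * real k + \<mu>) \<le> x ^ k * (exp (2 * R) * R powr (- \<mu>) / (2 * x + 1) ^ k)"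
        using assms by (intro mult_left_mono) auto
      also have "\<dots> = (exp (2 * R) * R powr (- \<mu>)) * q ^ k"
        by (simp add: q_def power_divide)
      finally show ?case
        using assms rGamma_pos[OF pos] by simp
    qed
  qed
  moreover have "summable (\<lambda>k. (exp (2 * R) * R powr (- \<mu>)) * q ^ k)"
    using assms by (intro summable_mult summable_geometric) (auto simp: q_def field_simps)
  ultimately show ?thesis
    by (rule summable_comparison_test_ev)
qed

text \<open>The Riemann--Liouville kernel. With the value \<open>0\<close> on the negative half line, a convolution over
  \<open>{0..t}\<close> becomes one over the whole line, which needs no indicator functions and can be shifted
  freely.\<close>

definition riemann_kernel :: "real \<Rightarrow> real \<Rightarrow> real" where
  "riemann_kernel \<alpha> s = (if 0 < s then s powr (\<alpha> - 1) * rGamma \<alpha> else 0)"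

lemma riemann_kernel_nonneg: "\<alpha> > 0 \<Longrightarrow> riemann_kernel \<alpha> s \<ge> 0"
  using rGamma_pos[of \<alpha>] by (simp add: riemann_kernel_def)

lemma riemann_kernel_add:
  assumes "s > 0"
  shows "riemann_kernel (\<alpha> + \<mu>) s = s powr \<alpha> * s powr (\<mu> - 1) * rGamma (\<alpha> + \<mu>)"
proof -
  have "\<alpha> + \<mu> - 1 = \<alpha> + (\<mu> - 1)"
    by simp
  then show ?thesis
    using assms by (simp only: riemann_kernel_def powr_add) simp
qed

lemma measurable_riemann_kernel [measurable]: "riemann_kernel \<alpha> \<in> borel_measurable borel"
  unfolding riemann_kernel_def[abs_def] by measurable

lemma summable_riemann_kernel:
  assumes "\<rho> > 0" "\<mu> > 0" "x \<ge> 0"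
  shows "summable (\<lambda>k. x ^ k * riemann_kernel (\<rho> * real k + \<mu>) s)"
proof (cases "s > 0")
  case True
  have "summable (\<lambda>k. s powr (\<mu> - 1) * ((x * s powr \<rho>) ^ k * rGamma (\<rho> * real k + \<mu>)))"
    using assms by (intro summable_mult summable_power_rGamma) auto
  moreover have "s powr (\<rho> * real k) = (s powr \<rho>) ^ k" for k
    using True by (simp add: powr_powr[symmetric] powr_realpow)
  ultimately show ?thesis
    using True by (simp add: riemann_kernel_add power_mult_distrib mult_ac)
qed (auto simp: riemann_kernel_def)

text \<open>The substitution \<open>y = t u\<close> reduces this to the Beta integral.\<close>

lemma riemann_kernel_conv:
  assumes "\<alpha> > 0" "\<beta> > 0"
  shows "has_bochner_integral lborel (\<lambda>y. riemann_kernel \<alpha> (t - y) * riemann_kernel \<beta> y) (riemann_kernel (\<alpha> + \<beta>) t)"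
proof (cases "t > 0")
  case False
  then have "riemann_kernel \<alpha> (t - y) * riemann_kernel \<beta> y = 0" for y
    by (auto simp: riemann_kernel_def)
  moreover have "riemann_kernel (\<alpha> + \<beta>) t = 0"
    using False by (simp add: riemann_kernel_def)
  ultimately show ?thesis
    by (simp only: has_bochner_integral_zero)
next
  case True
  define B where "B = (\<lambda>u::real. indicator {0..1} u *\<^sub>R (u powr (\<beta> - 1) * (1 - u) powr (\<alpha> - 1)))"
  have "set_integrable lborel {0..1} (\<lambda>u. u powr (\<beta> - 1) * (1 - u) powr (\<alpha> - 1))"
    using assms by (intro integrable_Beta) auto
  then have B: "has_bochner_integral lborel B (Beta \<beta> \<alpha>)"
    using set_borel_integral_eq_integral(2)[OF \<open>set_integrable lborel {0..1} _\<close>]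
      has_integral_Beta_real[OF assms(2,1)]
    unfolding has_bochner_integral_iff B_def set_integrable_def set_lebesgue_integral_def
    by (simp add: integral_unique)
  define c where "c = t powr (\<alpha> + \<beta> - 2) * rGamma \<alpha> * rGamma \<beta>"
  have eq: "riemann_kernel \<alpha> (t - t * u) * riemann_kernel \<beta> (t * u) = c * B u" for u
  proof (cases "0 < u \<and> u < 1")
    case True
    have "t - t * u = t * (1 - u)"
      by (simp add: algebra_simps)
    moreover have "t powr (\<alpha> + \<beta> - 2) = t powr (\<alpha> - 1) * t powr (\<beta> - 1)"
      by (simp add: powr_add[symmetric])
    ultimately show ?thesis
      using True \<open>t > 0\<close> by (simp add: riemann_kernel_def B_def c_def powr_mult)
  next
    case False
    then consider "u \<le> 0" | "u \<ge> 1"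
      by linarith
    then have "t * u \<le> 0 \<or> t - t * u \<le> 0"
      using \<open>t > 0\<close> by cases (auto simp: mult_le_0_iff)
    then have "riemann_kernel \<alpha> (t - t * u) * riemann_kernel \<beta> (t * u) = 0"
      by (auto simp: riemann_kernel_def)
    moreover have "B u = 0"
      using False by (auto simp: B_def indicator_def)
    ultimately show ?thesis
      by simp
  qed
  have "has_bochner_integral lborel (\<lambda>u. c * B u) (c * Beta \<beta> \<alpha>)"
    by (rule has_bochner_integral_mult_right[OF B])
  also have "c * Beta \<beta> \<alpha> = riemann_kernel (\<alpha> + \<beta>) t /\<^sub>R \<bar>t\<bar>"
  proof -
    have "t powr (\<alpha> + \<beta> - 1) / t = t powr (\<alpha> + \<beta> - 2)"
      using \<open>t > 0\<close> by (simp add: powr_diff powr_numeral power2_eq_square)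
    moreover have "rGamma \<alpha> * rGamma \<beta> * Beta \<beta> \<alpha> = rGamma (\<alpha> + \<beta>)"
      using Gamma_real_pos[OF assms(1)] Gamma_real_pos[OF assms(2)]
      by (simp add: Beta_def rGamma_inverse_Gamma field_simps)
    ultimately show ?thesis
      using \<open>t > 0\<close> by (simp add: c_def riemann_kernel_def field_simps)
  qed
  finally have "has_bochner_integral lborel (\<lambda>u. riemann_kernel \<alpha> (t - (0 + t * u)) * riemann_kernel \<beta> (0 + t * u))
      (riemann_kernel (\<alpha> + \<beta>) t /\<^sub>R \<bar>t\<bar>)"
    by (simp add: eq)
  then show ?thesis
    using \<open>t > 0\<close> by (subst lborel_has_bochner_integral_real_affine_iff[where c = t and t = 0]) auto
qed

text \<open>The coefficients of the kernel with respect to the functions \<open>riemann_kernel (\<rho> k + \<mu>)\<close>. The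
  Gamma factors belong to those functions, which makes the coefficients independent of \<open>\<rho>\<close> and
  \<open>\<mu>\<close>.\<close>

definition prabhakar_coeff :: "real \<Rightarrow> real \<Rightarrow> nat \<Rightarrow> real" where
  "prabhakar_coeff \<omega> \<gamma> k = \<omega> ^ k * (pochhammer \<gamma> k / fact k)"

definition causal_kernel :: "real \<Rightarrow> real \<Rightarrow> real \<Rightarrow> real \<Rightarrow> real \<Rightarrow> real" where
  "causal_kernel \<rho> \<omega> \<gamma> \<mu> s = (if 0 < s then prabhakar_kernel \<gamma> \<rho> \<mu> \<omega> s else 0)"

lemma prabhakar_coeff_bound: "\<bar>prabhakar_coeff \<omega> \<gamma> k\<bar> \<le> (\<bar>\<omega>\<bar> * (1 + \<bar>\<gamma>\<bar>)) ^ k"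
proof -
  have "\<bar>pochhammer \<gamma> k / fact k\<bar> \<le> (1 + \<bar>\<gamma>\<bar>) ^ k"
  proof (induction k)
    case (Suc k)
    have "\<bar>pochhammer \<gamma> (Suc k) / fact (Suc k)\<bar> = \<bar>pochhammer \<gamma> k / fact k\<bar> * (\<bar>\<gamma> + real k\<bar> / (1 + real k))"
      by (simp add: pochhammer_Suc abs_mult)
    also have "\<dots> \<le> (1 + \<bar>\<gamma>\<bar>) ^ k * (1 + \<bar>\<gamma>\<bar>)"
    proof (intro mult_mono Suc)
      have "\<bar>\<gamma> + real k\<bar> \<le> \<bar>\<gamma>\<bar> * 1 + real k"
        by simp
      also have "\<dots> \<le> \<bar>\<gamma>\<bar> * (1 + real k) + (1 + real k)"
        by (intro add_mono mult_left_mono) auto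
      finally show "\<bar>\<gamma> + real k\<bar> / (1 + real k) \<le> 1 + \<bar>\<gamma>\<bar>"
        by (simp add: field_simps)
    qed auto
    finally show ?case
      by (simp add: mult_ac)
  qed simp
  then have "\<bar>\<omega>\<bar> ^ k * \<bar>pochhammer \<gamma> k / fact k\<bar> \<le> \<bar>\<omega>\<bar> ^ k * (1 + \<bar>\<gamma>\<bar>) ^ k"
    by (intro mult_left_mono) auto
  then show ?thesis
    by (simp add: prabhakar_coeff_def abs_mult power_abs power_mult_distrib)
qed

text \<open>This is why the first parameters add up under convolution.\<close>

lemma prabhakar_coeff_vandermonde:
  "(\<Sum>k\<le>n. prabhakar_coeff \<omega> \<gamma> k * prabhakar_coeff \<omega> \<gamma>' (n - k)) = prabhakar_coeff \<omega> (\<gamma> + \<gamma>') n"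
proof -
  have "prabhakar_coeff \<omega> \<gamma> k * prabhakar_coeff \<omega> \<gamma>' (n - k) =
      \<omega> ^ n / fact n * (real (n choose k) * pochhammer \<gamma> k * pochhammer \<gamma>' (n - k))" if "k \<le> n" for k
    using that by (simp add: prabhakar_coeff_def binomial_fact power_add[symmetric] field_simps)
  then have "(\<Sum>k\<le>n. prabhakar_coeff \<omega> \<gamma> k * prabhakar_coeff \<omega> \<gamma>' (n - k)) =
      (\<Sum>k\<le>n. \<omega> ^ n / fact n * (real (n choose k) * pochhammer \<gamma> k * pochhammer \<gamma>' (n - k)))"
    by (intro sum.cong) auto
  then show ?thesis
    by (simp add: prabhakar_coeff_def[of \<omega> "\<gamma> + \<gamma>'"] pochhammer_binomial_sum sum_distrib_left sum_divide_distrib)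
qed

context
  fixes \<rho> \<omega> :: real
  assumes \<rho>: "\<rho> > 0"
begin

lemma summable_prabhakar_coeff:
  assumes "\<mu> > 0"
  shows "summable (\<lambda>k. \<bar>prabhakar_coeff \<omega> \<gamma> k\<bar> * riemann_kernel (\<rho> * real k + \<mu>) s)"
proof (rule summable_comparison_test'[where N = 0])
  show "summable (\<lambda>k. (\<bar>\<omega>\<bar> * (1 + \<bar>\<gamma>\<bar>)) ^ k * riemann_kernel (\<rho> * real k + \<mu>) s)"
    using \<rho> assms by (intro summable_riemann_kernel) auto
  show "norm (\<bar>prabhakar_coeff \<omega> \<gamma> k\<bar> * riemann_kernel (\<rho> * real k + \<mu>) s) \<le>
      (\<bar>\<omega>\<bar> * (1 + \<bar>\<gamma>\<bar>)) ^ k * riemann_kernel (\<rho> * real k + \<mu>) s" for k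
    using prabhakar_coeff_bound[of \<omega> \<gamma> k] riemann_kernel_nonneg[of "\<rho> * real k + \<mu>" s] \<rho> assms
    by (simp add: abs_mult mult_right_mono add_nonneg_pos)
qed

lemma summable_prabhakar_series:
  assumes "\<mu> > 0"
  shows "summable (\<lambda>k. norm (prabhakar_coeff \<omega> \<gamma> k * riemann_kernel (\<rho> * real k + \<mu>) s))"
  using summable_prabhakar_coeff[OF assms, of \<gamma> s] riemann_kernel_nonneg \<rho> assms
  by (simp add: abs_mult add_nonneg_pos)

lemma causal_kernel_series:
  assumes "\<mu> > 0"
  shows "causal_kernel \<rho> \<omega> \<gamma> \<mu> s = (\<Sum>k. prabhakar_coeff \<omega> \<gamma> k * riemann_kernel (\<rho> * real k + \<mu>) s)"
proof (cases "s > 0")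
  case True
  define a where "a k = pochhammer \<gamma> k * rGamma (\<rho> * real k + \<mu>) * (\<omega> * s powr \<rho>) ^ k / fact k" for k
  have eq: "prabhakar_coeff \<omega> \<gamma> k * riemann_kernel (\<rho> * real k + \<mu>) s = s powr (\<mu> - 1) * a k" for k
  proof -
    have "s powr (\<rho> * real k) = (s powr \<rho>) ^ k"
      using True by (simp add: powr_powr[symmetric] powr_realpow)
    then show ?thesis
      using True by (simp add: riemann_kernel_add a_def prabhakar_coeff_def power_mult_distrib)
  qed
  have "summable (\<lambda>k. s powr (\<mu> - 1) * a k)"
    using summable_norm_cancel[OF summable_prabhakar_series[OF assms, of \<gamma> s]] by (simp add: eq)
  then have "summable a"
    using True by (simp add: summable_cmult_iff)
  then have "(\<Sum>k. s powr (\<mu> - 1) * a k) = s powr (\<mu> - 1) * suminf a"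
    by (rule suminf_mult)
  then show ?thesis
    using True unfolding eq by (simp add: causal_kernel_def prabhakar_kernel_def prabhakar_E_def a_def[abs_def])
qed (simp add: causal_kernel_def riemann_kernel_def)

lemma measurable_causal_kernel:
  assumes "\<mu> > 0"
  shows "causal_kernel \<rho> \<omega> \<gamma> \<mu> \<in> borel_measurable borel"
proof -
  have "causal_kernel \<rho> \<omega> \<gamma> \<mu> = (\<lambda>s. \<Sum>k. prabhakar_coeff \<omega> \<gamma> k * riemann_kernel (\<rho> * real k + \<mu>) s)"
    using causal_kernel_series[OF assms] by blast
  then show ?thesis
    by simp
qed

text \<open>After the factor \<open>s\<^bsup>\<mu>-1\<^esup>\<close> is split off, the kernel is a power series in \<open>s\<^bsup>\<rho>\<^esup>\<close>, bounded for
  \<open>s \<le> T\<close>. The convergence and uniqueness estimates below combine this bound with the semigroup law of the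
  Riemann--Liouville kernels.\<close>

lemma causal_kernel_bound:
  assumes "\<mu> > 0"
  obtains C where "C > 0" "\<And>s. s \<le> T \<Longrightarrow> \<bar>causal_kernel \<rho> \<omega> \<gamma> \<mu> s\<bar> \<le> C * riemann_kernel \<mu> s"
proof -
  define A where "A = \<bar>\<omega>\<bar> * (1 + \<bar>\<gamma>\<bar>)"
  have A: "A \<ge> 0"
    by (simp add: A_def)
  define \<tau> where "\<tau> = (max T 0) powr \<rho>"
  define b where "b k = (A * \<tau>) ^ k * rGamma (\<rho> * real k + \<mu>)" for k
  have b: "summable b"
    unfolding b_def using assms \<rho> A by (intro summable_power_rGamma) (auto simp: \<tau>_def)
  have b_nonneg: "b k \<ge> 0" for k
    unfolding b_def using rGamma_pos[of "\<rho> * real k + \<mu>"] A \<rho> assms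
    by (auto simp: \<tau>_def add_nonneg_pos intro!: mult_nonneg_nonneg)
  \<comment> \<open>The summand \<open>1\<close> makes the positivity of the constant immediate.\<close>
  define C where "C = 1 + suminf b / rGamma \<mu>"
  show ?thesis
  proof (rule that[of C])
    show "C > 0"
      using suminf_nonneg[OF b b_nonneg] rGamma_pos[OF assms]
      by (auto simp: C_def intro!: add_pos_nonneg)
    show "\<bar>causal_kernel \<rho> \<omega> \<gamma> \<mu> s\<bar> \<le> C * riemann_kernel \<mu> s" if "s \<le> T" for s
    proof (cases "s > 0")
      case True
      let ?f = "\<lambda>k. prabhakar_coeff \<omega> \<gamma> k * riemann_kernel (\<rho> * real k + \<mu>) s"
      have "\<bar>causal_kernel \<rho> \<omega> \<gamma> \<mu> s\<bar> \<le> (\<Sum>k. norm (?f k))"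
        unfolding causal_kernel_series[OF assms] real_norm_def[symmetric]
        by (rule summable_norm[OF summable_prabhakar_series[OF assms]])
      also have "\<dots> \<le> (\<Sum>k. s powr (\<mu> - 1) * b k)"
      proof (rule suminf_le)
        fix k
        have pos: "\<rho> * real k + \<mu> > 0"
          using \<rho> assms by (simp add: add_nonneg_pos)
        have "s powr \<rho> \<le> \<tau>"
          unfolding \<tau>_def using True that \<rho> by (intro powr_mono2) auto
        then have "(s powr \<rho>) ^ k \<le> \<tau> ^ k"
          by (intro power_mono) auto
        moreover have "s powr (\<rho> * real k) = (s powr \<rho>) ^ k"
          using True by (simp add: powr_powr[symmetric] powr_realpow)
        ultimately have "\<bar>prabhakar_coeff \<omega> \<gamma> k\<bar> * (s powr (\<rho> * real k) * s powr (\<mu> - 1) * rGamma (\<rho> * real k + \<mu>)) \<le>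
            A ^ k * (\<tau> ^ k * s powr (\<mu> - 1) * rGamma (\<rho> * real k + \<mu>))"
          using prabhakar_coeff_bound[of \<omega> \<gamma> k] rGamma_pos[OF pos] A
          by (intro mult_mono mult_right_mono) (auto simp: A_def)
        then show "norm (?f k) \<le> s powr (\<mu> - 1) * b k"
          using True rGamma_pos[OF pos]
          by (simp add: abs_mult riemann_kernel_add b_def power_mult_distrib mult_ac)
      qed (use summable_prabhakar_series[OF assms] b in \<open>auto intro: summable_mult\<close>)
      also have "\<dots> = s powr (\<mu> - 1) * suminf b"
        by (rule suminf_mult[OF b])
      also have "\<dots> = (suminf b / rGamma \<mu>) * riemann_kernel \<mu> s"
        using True rGamma_pos[OF assms] by (simp add: riemann_kernel_def)
      also have "\<dots> \<le> C * riemann_kernel \<mu> s"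
        unfolding C_def using riemann_kernel_nonneg[OF assms, of s] by (intro mult_right_mono) auto
      finally show ?thesis .
    qed (simp add: causal_kernel_def riemann_kernel_def)
  qed
qed

lemma continuous_on_causal_kernel:
  assumes "\<mu> > 0"
  shows "continuous_on {0<..} (causal_kernel \<rho> \<omega> \<gamma> \<mu>)"
proof -
  define a where "a k = pochhammer \<gamma> k * rGamma (\<rho> * real k + \<mu>) / fact k" for k
  have a: "summable (\<lambda>k. a k * x ^ k)" for x
  proof (rule summable_comparison_test'[where N = 0])
    show "summable (\<lambda>k. ((1 + \<bar>\<gamma>\<bar>) * \<bar>x\<bar>) ^ k * rGamma (\<rho> * real k + \<mu>))"
      using assms \<rho> by (intro summable_power_rGamma) auto
    fix k
    have "\<bar>pochhammer \<gamma> k / fact k\<bar> \<le> (1 + \<bar>\<gamma>\<bar>) ^ k"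
      using prabhakar_coeff_bound[of 1 \<gamma> k] by (simp add: prabhakar_coeff_def)
    then have "\<bar>pochhammer \<gamma> k / fact k\<bar> * (\<bar>x\<bar> ^ k * rGamma (\<rho> * real k + \<mu>)) \<le>
        (1 + \<bar>\<gamma>\<bar>) ^ k * (\<bar>x\<bar> ^ k * rGamma (\<rho> * real k + \<mu>))"
      using rGamma_pos[of "\<rho> * real k + \<mu>"] \<rho> assms
      by (intro mult_right_mono) (auto simp: add_nonneg_pos)
    then show "norm (a k * x ^ k) \<le> ((1 + \<bar>\<gamma>\<bar>) * \<bar>x\<bar>) ^ k * rGamma (\<rho> * real k + \<mu>)"
      using rGamma_pos[of "\<rho> * real k + \<mu>"] \<rho> assms
      by (simp add: a_def abs_mult power_abs power_mult_distrib add_nonneg_pos mult_ac)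
  qed
  have "isCont (\<lambda>x. \<Sum>k. a k * x ^ k) x" for x
    by (rule isCont_powser[OF a[of "\<bar>x\<bar> + 1"]]) simp
  moreover have "prabhakar_E \<gamma> \<rho> \<mu> = (\<lambda>x. \<Sum>k. a k * x ^ k)"
    by (simp add: prabhakar_E_def a_def fun_eq_iff)
  ultimately have cont: "continuous_on UNIV (prabhakar_E \<gamma> \<rho> \<mu>)"
    by (simp add: continuous_at_imp_continuous_on)
  have "continuous_on {0<..} (\<lambda>s. s powr (\<mu> - 1) * prabhakar_E \<gamma> \<rho> \<mu> (\<omega> * s powr \<rho>))"
    by (intro continuous_intros continuous_on_compose2[OF cont]) auto
  then show ?thesis
    by (rule continuous_on_eq) (simp add: causal_kernel_def prabhakar_kernel_def)
qed

text \<open>The pointwise product of the two series is their Cauchy product, in which the \<open>n\<close>-th term collects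
  the products of \<open>riemann_kernel (\<rho> k + \<mu>)\<close> and \<open>riemann_kernel (\<rho> (n - k) + \<mu>')\<close>. All of these have
  the same convolution \<open>riemann_kernel (\<rho> n + \<mu> + \<mu>')\<close>, so that the integrated coefficients are added up by
  Vandermonde's identity. Here \<open>F'\<close> dominates the terms \<open>F\<close> and justifies the integration term by
  term.\<close>

theorem causal_kernel_conv:
  assumes "\<mu> > 0" "\<mu>' > 0"
  shows "has_bochner_integral lborel (\<lambda>y. causal_kernel \<rho> \<omega> \<gamma> \<mu> (t - y) * causal_kernel \<rho> \<omega> \<gamma>' \<mu>' y)
    (causal_kernel \<rho> \<omega> (\<gamma> + \<gamma>') (\<mu> + \<mu>') t)"
proof -
  define a where "a y k = prabhakar_coeff \<omega> \<gamma> k * riemann_kernel (\<rho> * real k + \<mu>) (t - y)" for y k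
  define b where "b y k = prabhakar_coeff \<omega> \<gamma>' k * riemann_kernel (\<rho> * real k + \<mu>') y" for y k
  define F where "F n y = (\<Sum>k\<le>n. a y k * b y (n - k))" for n y
  define F' where "F' n y = (\<Sum>k\<le>n. \<bar>a y k\<bar> * \<bar>b y (n - k)\<bar>)" for n y
  define c where "c n = (\<Sum>k\<le>n. \<bar>prabhakar_coeff \<omega> \<gamma> k\<bar> * \<bar>prabhakar_coeff \<omega> \<gamma>' (n - k)\<bar>)" for n
  have pos: "\<rho> * real k + \<mu> > 0" "\<rho> * real k + \<mu>' > 0" for k
    using \<rho> assms by (simp_all add: add_nonneg_pos)
  have norm_a: "summable (\<lambda>k. norm (a y k))" and norm_b: "summable (\<lambda>k. norm (b y k))" for y
    unfolding a_def b_def by (rule summable_prabhakar_series assms)+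
  have base: "has_bochner_integral lborel (\<lambda>y. riemann_kernel (\<rho> * real k + \<mu>) (t - y) *
      riemann_kernel (\<rho> * real (n - k) + \<mu>') y) (riemann_kernel (\<rho> * real n + (\<mu> + \<mu>')) t)" if "k \<le> n" for k n
  proof -
    have "\<rho> * real k + \<mu> + (\<rho> * real (n - k) + \<mu>') = \<rho> * real n + (\<mu> + \<mu>')"
      using that by (simp add: of_nat_diff algebra_simps)
    then show ?thesis
      using riemann_kernel_conv[OF pos(1)[of k] pos(2)[of "n - k"], of t] by (simp only:)
  qed
  have int_F: "has_bochner_integral lborel (F n)
      (prabhakar_coeff \<omega> (\<gamma> + \<gamma>') n * riemann_kernel (\<rho> * real n + (\<mu> + \<mu>')) t)" for n
  proof -
    have "has_bochner_integral lborel (\<lambda>y. \<Sum>k\<le>n. (prabhakar_coeff \<omega> \<gamma> k * prabhakar_coeff \<omega> \<gamma>' (n - k)) *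
         (riemann_kernel (\<rho> * real k + \<mu>) (t - y) * riemann_kernel (\<rho> * real (n - k) + \<mu>') y))
       (\<Sum>k\<le>n. (prabhakar_coeff \<omega> \<gamma> k * prabhakar_coeff \<omega> \<gamma>' (n - k)) * riemann_kernel (\<rho> * real n + (\<mu> + \<mu>')) t)"
      by (intro has_bochner_integral_sum has_bochner_integral_mult_right base) auto
    then show ?thesis
      unfolding F_def a_def b_def sum_distrib_right[symmetric] prabhakar_coeff_vandermonde
      by (simp add: mult_ac)
  qed
  have int_F': "has_bochner_integral lborel (F' n) (c n * riemann_kernel (\<rho> * real n + (\<mu> + \<mu>')) t)" for n
  proof -
    have "has_bochner_integral lborel (\<lambda>y. \<Sum>k\<le>n. (\<bar>prabhakar_coeff \<omega> \<gamma> k\<bar> * \<bar>prabhakar_coeff \<omega> \<gamma>' (n - k)\<bar>) *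
         (riemann_kernel (\<rho> * real k + \<mu>) (t - y) * riemann_kernel (\<rho> * real (n - k) + \<mu>') y))
       (\<Sum>k\<le>n. (\<bar>prabhakar_coeff \<omega> \<gamma> k\<bar> * \<bar>prabhakar_coeff \<omega> \<gamma>' (n - k)\<bar>) * riemann_kernel (\<rho> * real n + (\<mu> + \<mu>')) t)"
      by (intro has_bochner_integral_sum has_bochner_integral_mult_right base) auto
    then show ?thesis
      unfolding F'_def a_def b_def c_def sum_distrib_right[symmetric]
      by (simp add: abs_mult riemann_kernel_nonneg pos mult_ac del: of_nat_diff)
  qed
  have norm_F: "norm (F n y) \<le> F' n y" for n y
    unfolding F_def F'_def by (rule order_trans[OF norm_sum]) (simp add: abs_mult)
  have F'_nonneg: "0 \<le> F' n y" for n y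
    unfolding F'_def by (intro sum_nonneg) auto
  have summable_F: "summable (\<lambda>n. norm (F n y))" for y
  proof (rule summable_comparison_test'[where N = 0])
    show "summable (\<lambda>n. F' n y)"
      unfolding F'_def using norm_a[of y] norm_b[of y] by (intro summable_Cauchy_product) auto
  qed (use norm_F in auto)
  \<comment> \<open>A common growth rate of both coefficient sequences; the factor \<open>2\<^sup>n\<close> below absorbs the number \<open>n + 1\<close> of summands.\<close>
  define A where "A = \<bar>\<omega>\<bar> * (1 + \<bar>\<gamma>\<bar>) + \<bar>\<omega>\<bar> * (1 + \<bar>\<gamma>'\<bar>)"
  have c_bound: "c n \<le> (2 * A) ^ n" for n
  proof -
    have "c n \<le> (\<Sum>k\<le>n. A ^ k * A ^ (n - k))"
      unfolding c_def
    proof (intro sum_mono mult_mono)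
      show "\<bar>prabhakar_coeff \<omega> \<gamma> k\<bar> \<le> A ^ k" for k
        by (rule order_trans[OF prabhakar_coeff_bound]) (auto simp: A_def intro!: power_mono)
      show "\<bar>prabhakar_coeff \<omega> \<gamma>' k\<bar> \<le> A ^ k" for k
        by (rule order_trans[OF prabhakar_coeff_bound]) (auto simp: A_def intro!: power_mono)
    qed (auto simp: A_def)
    also have "\<dots> = real (Suc n) * A ^ n"
      by (simp add: power_add[symmetric])
    also have "\<dots> \<le> 2 ^ n * A ^ n"
    proof (rule mult_right_mono)
      show "real (Suc n) \<le> 2 ^ n"
        using less_exp[of n] by (metis Suc_leI of_nat_le_iff of_nat_numeral of_nat_power)
    qed (auto simp: A_def)
    finally show ?thesis
      by (simp add: power_mult_distrib)
  qed
  have "summable (\<lambda>n. c n * riemann_kernel (\<rho> * real n + (\<mu> + \<mu>')) t)"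
  proof (rule summable_comparison_test'[where N = 0])
    show "summable (\<lambda>n. (2 * A) ^ n * riemann_kernel (\<rho> * real n + (\<mu> + \<mu>')) t)"
      using \<rho> assms by (intro summable_riemann_kernel) (auto simp: A_def)
    fix n
    have "0 \<le> riemann_kernel (\<rho> * real n + (\<mu> + \<mu>')) t"
      using \<rho> assms by (intro riemann_kernel_nonneg) (auto intro!: add_nonneg_pos)
    moreover have "c n \<ge> 0"
      unfolding c_def by (intro sum_nonneg) auto
    ultimately show "norm (c n * riemann_kernel (\<rho> * real n + (\<mu> + \<mu>')) t) \<le>
        (2 * A) ^ n * riemann_kernel (\<rho> * real n + (\<mu> + \<mu>')) t"
      using c_bound[of n] by (simp add: abs_mult mult_right_mono)
  qed
  then have summable_int: "summable (\<lambda>n. \<integral>y. norm (F n y) \<partial>lborel)"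
  proof (rule summable_comparison_test'[where N = 0])
    fix n
    have "(\<integral>y. norm (F n y) \<partial>lborel) \<le> (\<integral>y. F' n y \<partial>lborel)"
      using int_F[of n] int_F'[of n] norm_F
      by (intro integral_mono) (auto simp: has_bochner_integral_iff)
    then show "norm (\<integral>y. norm (F n y) \<partial>lborel) \<le> c n * riemann_kernel (\<rho> * real n + (\<mu> + \<mu>')) t"
      using int_F'[of n] by (simp add: has_bochner_integral_iff)
  qed
  have int: "integrable lborel (F n)" for n
    using int_F by (auto simp: has_bochner_integral_iff)
  have "integrable lborel (\<lambda>y. \<Sum>n. F n y)"
    by (rule integrable_suminf[OF int _ summable_int]) (use summable_F in auto)
  moreover have "(\<integral>y. (\<Sum>n. F n y) \<partial>lborel) = (\<Sum>n. \<integral>y. F n y \<partial>lborel)"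
    by (rule integral_suminf[OF int _ summable_int]) (use summable_F in auto)
  moreover have "(\<Sum>n. \<integral>y. F n y \<partial>lborel) = causal_kernel \<rho> \<omega> (\<gamma> + \<gamma>') (\<mu> + \<mu>') t"
    using int_F assms by (simp add: has_bochner_integral_iff causal_kernel_series)
  moreover have "(\<Sum>n. F n y) = causal_kernel \<rho> \<omega> \<gamma> \<mu> (t - y) * causal_kernel \<rho> \<omega> \<gamma>' \<mu>' y" for y
    unfolding F_def causal_kernel_series[OF assms(1)] causal_kernel_series[OF assms(2)]
      a_def[symmetric] b_def[symmetric]
    using Cauchy_product_sums[OF norm_a norm_b, of y y] by (simp add: sums_iff)
  ultimately show ?thesis
    by (simp add: has_bochner_integral_iff)
qed

end

section \<open>The Neumann series\<close>

text \<open>Convolution with this kernel is integration.\<close>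

lemma causal_kernel_unit: "causal_kernel \<rho> \<omega> 0 1 s = indicator {0<..} s"
proof -
  have "(\<Sum>k. pochhammer 0 k * rGamma (\<rho> * real k + 1) * x ^ k / fact k) = 1" for x :: real
    by (subst suminf_finite[of "{0}"]) (auto simp: pochhammer_0_left)
  then show ?thesis
    by (simp add: causal_kernel_def prabhakar_kernel_def prabhakar_E_def indicator_def)
qed

context
  fixes \<rho> \<omega> \<gamma> \<mu> :: real and z :: complex
  assumes \<rho>: "\<rho> > 0" and \<mu>: "\<mu> > 0"
begin

lemma mu_Suc_pos: "\<mu> * real (Suc k) > 0"
  using \<mu> by simp

text \<open>The kernel on the left is the \<open>(k + 1)\<close>-fold convolution power of \<open>causal_kernel \<rho> \<omega> \<gamma> \<mu>\<close>, so the
  bound for that kernel is propagated by the semigroup law. Powers start at \<open>Suc k\<close> because the zeroth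
  one would be the Dirac measure.\<close>

lemma resolvent_kernel_bound:
  obtains C where "C > 0"
    "\<And>k s. s \<le> T \<Longrightarrow> \<bar>causal_kernel \<rho> \<omega> (\<gamma> * real (Suc k)) (\<mu> * real (Suc k)) s\<bar> \<le>
       C ^ Suc k * riemann_kernel (\<mu> * real (Suc k)) s"
proof -
  obtain C where C: "C > 0" "\<And>s. s \<le> T \<Longrightarrow> \<bar>causal_kernel \<rho> \<omega> \<gamma> \<mu> s\<bar> \<le> C * riemann_kernel \<mu> s"
    using causal_kernel_bound[OF \<rho> \<mu>] by blast
  have "\<bar>causal_kernel \<rho> \<omega> (\<gamma> * real (Suc k)) (\<mu> * real (Suc k)) s\<bar> \<le>
       C ^ Suc k * riemann_kernel (\<mu> * real (Suc k)) s" if "s \<le> T" for k s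
    using that
  proof (induction k arbitrary: s)
    case 0
    then show ?case using C(2) by simp
  next
    case (Suc k)
    have conv: "has_bochner_integral lborel
        (\<lambda>y. causal_kernel \<rho> \<omega> \<gamma> \<mu> (s - y) * causal_kernel \<rho> \<omega> (\<gamma> * real (Suc k)) (\<mu> * real (Suc k)) y)
        (causal_kernel \<rho> \<omega> (\<gamma> * real (Suc (Suc k))) (\<mu> * real (Suc (Suc k))) s)"
      using causal_kernel_conv[OF \<rho> \<mu> mu_Suc_pos[of k], of \<omega> \<gamma> s "\<gamma> * real (Suc k)"]
      by (simp add: algebra_simps)
    have dom: "has_bochner_integral lborel
        (\<lambda>y. (C * C ^ Suc k) * (riemann_kernel \<mu> (s - y) * riemann_kernel (\<mu> * real (Suc k)) y))
        ((C * C ^ Suc k) * riemann_kernel (\<mu> * real (Suc (Suc k))) s)"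
    proof -
      have "\<mu> + \<mu> * real (Suc k) = \<mu> * real (Suc (Suc k))"
        by (simp add: algebra_simps)
      then show ?thesis
        using has_bochner_integral_mult_right[OF riemann_kernel_conv[OF \<mu> mu_Suc_pos[of k], of s], of "C * C ^ Suc k"]
        by (simp only:)
    qed
    have "\<bar>causal_kernel \<rho> \<omega> \<gamma> \<mu> (s - y) * causal_kernel \<rho> \<omega> (\<gamma> * real (Suc k)) (\<mu> * real (Suc k)) y\<bar> \<le>
        (C * C ^ Suc k) * (riemann_kernel \<mu> (s - y) * riemann_kernel (\<mu> * real (Suc k)) y)" for y
    proof (cases "0 < y \<and> y < s")
      case True
      then have "\<bar>causal_kernel \<rho> \<omega> \<gamma> \<mu> (s - y)\<bar> * \<bar>causal_kernel \<rho> \<omega> (\<gamma> * real (Suc k)) (\<mu> * real (Suc k)) y\<bar> \<le>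
          (C * riemann_kernel \<mu> (s - y)) * (C ^ Suc k * riemann_kernel (\<mu> * real (Suc k)) y)"
        using Suc.prems C(1) riemann_kernel_nonneg[OF \<mu>]
        by (intro mult_mono C(2) Suc.IH) auto
      then show ?thesis
        by (simp add: abs_mult mult_ac)
    next
      case False
      then have "causal_kernel \<rho> \<omega> \<gamma> \<mu> (s - y) = 0 \<or> causal_kernel \<rho> \<omega> (\<gamma> * real (Suc k)) (\<mu> * real (Suc k)) y = 0"
        by (auto simp: causal_kernel_def)
      then show ?thesis
        using C(1) riemann_kernel_nonneg[OF \<mu>] riemann_kernel_nonneg[OF mu_Suc_pos[of k]]
        by (auto intro!: mult_nonneg_nonneg)
    qed
    then have "\<bar>LINT y|lborel. causal_kernel \<rho> \<omega> \<gamma> \<mu> (s - y) *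
        causal_kernel \<rho> \<omega> (\<gamma> * real (Suc k)) (\<mu> * real (Suc k)) y\<bar> \<le>
      (LINT y|lborel. (C * C ^ Suc k) * (riemann_kernel \<mu> (s - y) * riemann_kernel (\<mu> * real (Suc k)) y))"
      using conv dom unfolding real_norm_def[symmetric] has_bochner_integral_iff
      by (intro Bochner_Integration.integral_norm_bound_integral) blast+
    then show ?case
      unfolding has_bochner_integral_integral_eq[OF conv] has_bochner_integral_integral_eq[OF dom]
      by (simp only: power_Suc)
  qed
  then show ?thesis
    using that C(1) by blast
qed

text \<open>The resolvent kernel of the Volterra equation; it turns out to be the derivative of the solution.\<close>

definition resolvent :: "real \<Rightarrow> complex" where
  "resolvent s = (\<Sum>k. z ^ Suc k * of_real (causal_kernel \<rho> \<omega> (\<gamma> * real (Suc k)) (\<mu> * real (Suc k)) s))"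

lemma summable_resolvent:
  "summable (\<lambda>k. norm (z ^ Suc k * of_real (causal_kernel \<rho> \<omega> (\<gamma> * real (Suc k)) (\<mu> * real (Suc k)) s)))"
proof -
  obtain C where C: "C > 0" "\<And>k. \<bar>causal_kernel \<rho> \<omega> (\<gamma> * real (Suc k)) (\<mu> * real (Suc k)) s\<bar> \<le>
       C ^ Suc k * riemann_kernel (\<mu> * real (Suc k)) s"
    using resolvent_kernel_bound[of s] by (metis order_refl)
  show ?thesis
  proof (rule summable_comparison_test'[where N = 0])
    have "summable (\<lambda>k. norm z * C * ((norm z * C) ^ k * riemann_kernel (\<mu> * real k + \<mu>) s))"
      using \<mu> C(1) by (intro summable_mult summable_riemann_kernel) auto
    then show "summable (\<lambda>k. (norm z * C) ^ Suc k * riemann_kernel (\<mu> * real (Suc k)) s)"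
      by (simp add: algebra_simps)
    fix k
    have "norm z ^ Suc k * \<bar>causal_kernel \<rho> \<omega> (\<gamma> * real (Suc k)) (\<mu> * real (Suc k)) s\<bar> \<le>
        norm z ^ Suc k * (C ^ Suc k * riemann_kernel (\<mu> * real (Suc k)) s)"
      by (intro mult_left_mono C(2)) auto
    then show "norm (norm (z ^ Suc k * of_real (causal_kernel \<rho> \<omega> (\<gamma> * real (Suc k)) (\<mu> * real (Suc k)) s))) \<le>
        (norm z * C) ^ Suc k * riemann_kernel (\<mu> * real (Suc k)) s"
      by (simp add: norm_mult norm_power power_mult_distrib mult_ac)
  qed
qed

text \<open>Integration term by term, dominated by the Riemann--Liouville kernels.\<close>

lemma resolvent_conv:
  assumes "\<mu>' > 0"
  shows "has_bochner_integral lborel (\<lambda>y. causal_kernel \<rho> \<omega> \<gamma>' \<mu>' (t - y) *\<^sub>R resolvent y)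
      (\<Sum>k. z ^ Suc k * of_real (causal_kernel \<rho> \<omega> (\<gamma>' + \<gamma> * real (Suc k)) (\<mu>' + \<mu> * real (Suc k)) t))"
    (is "has_bochner_integral lborel _ (\<Sum>k. ?I k)")
    and "summable (\<lambda>k. norm (z ^ Suc k * of_real (causal_kernel \<rho> \<omega> (\<gamma>' + \<gamma> * real (Suc k)) (\<mu>' + \<mu> * real (Suc k)) t)))"
proof -
  let ?K = "\<lambda>k. causal_kernel \<rho> \<omega> (\<gamma> * real (Suc k)) (\<mu> * real (Suc k))"
  define f where "f k y = z ^ Suc k * of_real (causal_kernel \<rho> \<omega> \<gamma>' \<mu>' (t - y) * ?K k y)" for k y
  have f: "has_bochner_integral lborel (f k) (?I k)" for k
    unfolding f_def
    by (intro has_bochner_integral_mult_right has_bochner_integral_of_real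
        causal_kernel_conv \<rho> assms mu_Suc_pos)
  obtain C where C: "C > 0" "\<And>k s. s \<le> t \<Longrightarrow> \<bar>?K k s\<bar> \<le> C ^ Suc k * riemann_kernel (\<mu> * real (Suc k)) s"
    using resolvent_kernel_bound[of t] by metis
  obtain C' where C': "C' > 0" "\<And>s. s \<le> t \<Longrightarrow> \<bar>causal_kernel \<rho> \<omega> \<gamma>' \<mu>' s\<bar> \<le> C' * riemann_kernel \<mu>' s"
    using causal_kernel_bound[OF \<rho> assms] by blast
  define F where "F k y = norm z ^ Suc k * C' * C ^ Suc k * (riemann_kernel \<mu>' (t - y) * riemann_kernel (\<mu> * real (Suc k)) y)" for k y
  have F: "has_bochner_integral lborel (F k)
      (norm z ^ Suc k * C' * C ^ Suc k * riemann_kernel (\<mu>' + \<mu> * real (Suc k)) t)" for k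
    unfolding F_def by (intro has_bochner_integral_mult_right riemann_kernel_conv assms mu_Suc_pos)
  have f_le: "norm (f k y) \<le> F k y" for k y
  proof (cases "0 < y \<and> y < t")
    case True
    then have "\<bar>causal_kernel \<rho> \<omega> \<gamma>' \<mu>' (t - y)\<bar> * \<bar>?K k y\<bar> \<le>
        (C' * riemann_kernel \<mu>' (t - y)) * (C ^ Suc k * riemann_kernel (\<mu> * real (Suc k)) y)"
      using C'(1) riemann_kernel_nonneg[OF assms] by (intro mult_mono C(2) C'(2)) auto
    then have "norm z ^ Suc k * (\<bar>causal_kernel \<rho> \<omega> \<gamma>' \<mu>' (t - y)\<bar> * \<bar>?K k y\<bar>) \<le>
        norm z ^ Suc k * ((C' * riemann_kernel \<mu>' (t - y)) * (C ^ Suc k * riemann_kernel (\<mu> * real (Suc k)) y))"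
      by (intro mult_left_mono) auto
    moreover have "norm (f k y) = norm z ^ Suc k * (\<bar>causal_kernel \<rho> \<omega> \<gamma>' \<mu>' (t - y)\<bar> * \<bar>?K k y\<bar>)"
      unfolding f_def norm_mult norm_power norm_of_real abs_mult ..
    ultimately show ?thesis
      unfolding F_def by (simp only: mult_ac)
  next
    case False
    then have "causal_kernel \<rho> \<omega> \<gamma>' \<mu>' (t - y) = 0 \<or> ?K k y = 0"
      by (auto simp: causal_kernel_def)
    then have "f k y = 0"
      by (auto simp: f_def)
    then show ?thesis
      using C(1) C'(1) riemann_kernel_nonneg[OF assms] riemann_kernel_nonneg[OF mu_Suc_pos[of k]]
      by (auto simp: F_def intro!: mult_nonneg_nonneg)
  qed
  have "summable (\<lambda>k. norm z * C' * C * ((norm z * C) ^ k * riemann_kernel (\<mu> * real k + (\<mu>' + \<mu>)) t))"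
    using \<mu> C(1) assms by (intro summable_mult summable_riemann_kernel) auto
  then have "summable (\<lambda>k. norm z ^ Suc k * C' * C ^ Suc k * riemann_kernel (\<mu>' + \<mu> * real (Suc k)) t)"
    by (simp add: algebra_simps power_mult_distrib)
  then have summable_int: "summable (\<lambda>k. \<integral>y. norm (f k y) \<partial>lborel)"
  proof (rule summable_comparison_test'[where N = 0])
    fix k
    have "(\<integral>y. norm (f k y) \<partial>lborel) \<le> (\<integral>y. F k y \<partial>lborel)"
      using f[of k] F[of k] f_le
      by (intro integral_mono) (auto simp: has_bochner_integral_iff)
    then show "norm (\<integral>y. norm (f k y) \<partial>lborel) \<le> norm z ^ Suc k * C' * C ^ Suc k * riemann_kernel (\<mu>' + \<mu> * real (Suc k)) t"
      using F[of k] by (simp add: has_bochner_integral_iff)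
  qed
  have int: "integrable lborel (f k)" for k
    using f by (auto simp: has_bochner_integral_iff)
  have f_eq: "f k y = causal_kernel \<rho> \<omega> \<gamma>' \<mu>' (t - y) *\<^sub>R (z ^ Suc k * of_real (?K k y))" for k y
    by (simp add: f_def scaleR_conv_of_real)
  have summable_f: "summable (\<lambda>k. norm (f k y))" for y
    unfolding f_eq norm_scaleR by (intro summable_mult summable_resolvent)
  have "integrable lborel (\<lambda>y. \<Sum>k. f k y)"
    by (rule integrable_suminf[OF int _ summable_int]) (use summable_f in auto)
  moreover have "(\<integral>y. (\<Sum>k. f k y) \<partial>lborel) = (\<Sum>k. \<integral>y. f k y \<partial>lborel)"
    by (rule integral_suminf[OF int _ summable_int]) (use summable_f in auto)
  moreover have "(\<Sum>k. f k y) = causal_kernel \<rho> \<omega> \<gamma>' \<mu>' (t - y) *\<^sub>R resolvent y" for y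
    unfolding f_eq resolvent_def
    by (rule suminf_scaleR_right[symmetric]) (rule summable_norm_cancel[OF summable_resolvent])
  ultimately show "has_bochner_integral lborel (\<lambda>y. causal_kernel \<rho> \<omega> \<gamma>' \<mu>' (t - y) *\<^sub>R resolvent y) (\<Sum>k. ?I k)"
    using f by (simp add: has_bochner_integral_iff)
  show "summable (\<lambda>k. norm (?I k))"
  proof (rule summable_comparison_test'[where N = 0, OF summable_int])
    fix k
    show "norm (norm (?I k)) \<le> (\<integral>y. norm (f k y) \<partial>lborel)"
      using integral_norm_bound[of lborel "f k"] f[of k]
      unfolding has_bochner_integral_iff by (simp only: norm_ge_zero abs_of_nonneg real_norm_def)
  qed
qed

text \<open>The terms with \<open>\<mu> k < 1\<close> are unbounded at \<open>0\<close>, so uniform convergence is only available away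
  from it. There, \<open>riemann_kernel \<alpha> s\<close> is at most \<open>b / a\<close> times its value at \<open>b\<close>, uniformly in
  \<open>\<alpha>\<close>.\<close>

lemma continuous_on_resolvent:
  assumes "0 < a"
  shows "continuous_on {a..b} resolvent"
proof -
  let ?K = "\<lambda>k. causal_kernel \<rho> \<omega> (\<gamma> * real (Suc k)) (\<mu> * real (Suc k))"
  obtain C where C: "C > 0" "\<And>k s. s \<le> b \<Longrightarrow> \<bar>?K k s\<bar> \<le> C ^ Suc k * riemann_kernel (\<mu> * real (Suc k)) s"
    using resolvent_kernel_bound[of b] by metis
  have mono: "riemann_kernel \<alpha> s \<le> b / a * riemann_kernel \<alpha> b" if "\<alpha> > 0" "a \<le> s" "s \<le> b" for \<alpha> s
  proof -
    have "s powr \<alpha> * (1 / s) \<le> b powr \<alpha> * (1 / a)"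
      using that assms by (intro mult_mono powr_mono2) (auto simp: field_simps)
    then have "s powr (\<alpha> - 1) \<le> b / a * b powr (\<alpha> - 1)"
      using that assms by (simp add: powr_diff)
    then have "s powr (\<alpha> - 1) * rGamma \<alpha> \<le> b / a * b powr (\<alpha> - 1) * rGamma \<alpha>"
      using rGamma_pos[OF that(1)] by (intro mult_right_mono) auto
    then show ?thesis
      using that assms by (simp add: riemann_kernel_def)
  qed
  define M where "M k = b / a * ((norm z * C) ^ Suc k * riemann_kernel (\<mu> * real (Suc k)) b)" for k
  have "summable (\<lambda>k. b / a * (norm z * C * ((norm z * C) ^ k * riemann_kernel (\<mu> * real k + \<mu>) b)))"
    using \<mu> C(1) by (intro summable_mult summable_riemann_kernel) auto
  then have M: "summable M"
    unfolding M_def[abs_def] by (simp add: algebra_simps)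
  have "uniform_limit {a..b} (\<lambda>n s. \<Sum>k<n. z ^ Suc k * of_real (?K k s)) (\<lambda>s. \<Sum>k. z ^ Suc k * of_real (?K k s)) sequentially"
  proof (rule Weierstrass_m_test[OF _ M])
    fix k s assume s: "s \<in> {a..b}"
    have "norm (z ^ Suc k * of_real (?K k s)) = norm z ^ Suc k * \<bar>?K k s\<bar>"
      unfolding norm_mult norm_power norm_of_real ..
    also have "\<dots> \<le> norm z ^ Suc k * (C ^ Suc k * (b / a * riemann_kernel (\<mu> * real (Suc k)) b))"
    proof (intro mult_left_mono)
      have "\<bar>?K k s\<bar> \<le> C ^ Suc k * riemann_kernel (\<mu> * real (Suc k)) s"
        using s by (intro C(2)) auto
      also have "\<dots> \<le> C ^ Suc k * (b / a * riemann_kernel (\<mu> * real (Suc k)) b)"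
        using s C(1) by (intro mult_left_mono mono mu_Suc_pos) auto
      finally show "\<bar>?K k s\<bar> \<le> C ^ Suc k * (b / a * riemann_kernel (\<mu> * real (Suc k)) b)" .
    qed auto
    also have "\<dots> = M k"
      unfolding M_def power_mult_distrib by (simp only: mult_ac)
    finally show "norm (z ^ Suc k * of_real (?K k s)) \<le> M k" .
  qed
  then show ?thesis
    unfolding resolvent_def[abs_def]
  proof (rule uniform_limit_theorem[rotated])
    have "continuous_on {a..b} (?K k)" for k
      by (rule continuous_on_subset[OF continuous_on_causal_kernel[OF \<rho> mu_Suc_pos]]) (use assms in auto)
    then show "\<forall>\<^sub>F n in sequentially. continuous_on {a..b} (\<lambda>s. \<Sum>k<n. z ^ Suc k * of_real (?K k s))"
      by (intro always_eventually allI continuous_intros)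
  qed simp
qed

text \<open>For \<open>z = - \<lambda> (1 - v)\<close> and \<open>\<omega> = - \<phi>\<close> this is the series of the theorem at positive
  times.\<close>

definition pgf_series :: "real \<Rightarrow> complex" where
  "pgf_series t = (\<Sum>k. z ^ k * of_real (causal_kernel \<rho> \<omega> (\<gamma> * real k) (\<mu> * real k + 1) t))"

lemma summable_pgf_series:
  "summable (\<lambda>k. z ^ k * of_real (causal_kernel \<rho> \<omega> (\<gamma> * real k) (\<mu> * real k + 1) t))"
proof -
  have "summable (\<lambda>k. z ^ Suc k * of_real (causal_kernel \<rho> \<omega> (0 + \<gamma> * real (Suc k)) (1 + \<mu> * real (Suc k)) t))"
    by (rule summable_norm_cancel[OF resolvent_conv(2)]) simp
  then show ?thesis
    unfolding add_0 add.commute[of 1]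
    by (subst summable_Suc_iff[symmetric])
qed

lemma resolvent_eq_0: "s \<le> 0 \<Longrightarrow> resolvent s = 0"
  by (simp add: resolvent_def causal_kernel_def)

text \<open>Convolving the resolvent with \<open>causal_kernel \<rho> \<omega> 0 1\<close> gives all terms of the series except the
  constant one.\<close>

lemma pgf_series_eq_integral:
  assumes "t > 0"
  shows "has_bochner_integral lborel (\<lambda>y. indicator {0<..<t} y *\<^sub>R resolvent y) (pgf_series t - 1)"
proof -
  have "has_bochner_integral lborel (\<lambda>y. causal_kernel \<rho> \<omega> 0 1 (t - y) *\<^sub>R resolvent y)
      (\<Sum>k. z ^ Suc k * of_real (causal_kernel \<rho> \<omega> (0 + \<gamma> * real (Suc k)) (1 + \<mu> * real (Suc k)) t))"
    by (rule resolvent_conv) simp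
  moreover have "(\<Sum>k. z ^ Suc k * of_real (causal_kernel \<rho> \<omega> (0 + \<gamma> * real (Suc k)) (1 + \<mu> * real (Suc k)) t)) = pgf_series t - 1"
    using suminf_split_head[OF summable_pgf_series, of t] assms
    unfolding pgf_series_def add_0 add.commute[of 1] by (simp add: causal_kernel_unit)
  moreover have "causal_kernel \<rho> \<omega> 0 1 (t - y) *\<^sub>R resolvent y = indicator {0<..<t} y *\<^sub>R resolvent y" for y
    by (auto simp: causal_kernel_unit indicator_def resolvent_eq_0)
  ultimately show ?thesis
    by simp
qed

text \<open>The kernel of the regularized derivative lowers the parameters \<open>(\<gamma> (k + 1), \<mu> (k + 1))\<close> of each
  term to \<open>(\<gamma> k, \<mu> k + 1)\<close>, which shifts the series by one and frees a factor \<open>z\<close>.\<close>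

lemma caputo_kernel_resolvent:
  assumes "\<mu> < 1"
  shows "has_bochner_integral lborel (\<lambda>y. causal_kernel \<rho> \<omega> (- \<gamma>) (1 - \<mu>) (t - y) *\<^sub>R resolvent y) (z * pgf_series t)"
proof -
  have "has_bochner_integral lborel (\<lambda>y. causal_kernel \<rho> \<omega> (- \<gamma>) (1 - \<mu>) (t - y) *\<^sub>R resolvent y)
      (\<Sum>k. z ^ Suc k * of_real (causal_kernel \<rho> \<omega> (- \<gamma> + \<gamma> * real (Suc k)) (1 - \<mu> + \<mu> * real (Suc k)) t))"
    using assms by (intro resolvent_conv) simp
  also have "(\<Sum>k. z ^ Suc k * of_real (causal_kernel \<rho> \<omega> (- \<gamma> + \<gamma> * real (Suc k)) (1 - \<mu> + \<mu> * real (Suc k)) t)) =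
      (\<Sum>k. z * (z ^ k * of_real (causal_kernel \<rho> \<omega> (\<gamma> * real k) (\<mu> * real k + 1) t)))"
    by (simp add: algebra_simps)
  also have "\<dots> = z * pgf_series t"
    unfolding pgf_series_def by (rule suminf_mult[OF summable_pgf_series])
  finally show ?thesis .
qed

lemma resolvent_integrable: "integrable lborel (\<lambda>s. indicator {..<T} s *\<^sub>R resolvent s)"
proof (cases "T > 0")
  case True
  have "indicator {0<..<T} y *\<^sub>R resolvent y = indicator {..<T} y *\<^sub>R resolvent y" for y
    using resolvent_eq_0[of y] by (cases "y > 0") (auto simp: indicator_def)
  then show ?thesis
    using pgf_series_eq_integral[OF True] unfolding has_bochner_integral_iff by (simp only:)
next
  case False
  have "indicator {..<T} y *\<^sub>R resolvent y = 0" for y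
    using False by (auto simp: indicator_def resolvent_eq_0)
  then show ?thesis
    by (simp only: integrable_zero)
qed

lemma pgf_series_diff:
  assumes "0 < x" "x \<le> y"
  shows "pgf_series y - pgf_series x = (LINT s|lborel. indicator {x<..<y} s *\<^sub>R resolvent s)"
proof -
  note px = pgf_series_eq_integral[OF assms(1)] and py = pgf_series_eq_integral[of y]
  have "has_bochner_integral lborel
      (\<lambda>s. indicator {0<..<y} s *\<^sub>R resolvent s - indicator {0<..<x} s *\<^sub>R resolvent s)
      ((pgf_series y - 1) - (pgf_series x - 1))"
    using assms by (intro has_bochner_integral_diff px py) auto
  then have diff: "pgf_series y - pgf_series x =
      (LINT s|lborel. indicator {0<..<y} s *\<^sub>R resolvent s - indicator {0<..<x} s *\<^sub>R resolvent s)"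
    and int: "integrable lborel (\<lambda>s. indicator {0<..<y} s *\<^sub>R resolvent s - indicator {0<..<x} s *\<^sub>R resolvent s)"
    by (simp_all add: has_bochner_integral_iff)
  have res: "(\<lambda>s. indicator {..<y} s *\<^sub>R resolvent s) \<in> borel_measurable lborel"
    using resolvent_integrable[of y] by (rule borel_measurable_integrable)
  have "(\<lambda>s. indicator {x<..<y} s *\<^sub>R (indicator {..<y} s *\<^sub>R resolvent s)) \<in> borel_measurable lborel"
    by (intro borel_measurable_scaleR borel_measurable_indicator res) auto
  moreover have "indicator {x<..<y} s *\<^sub>R (indicator {..<y} s *\<^sub>R resolvent s) = indicator {x<..<y} s *\<^sub>R resolvent s" for s
    by (auto simp: indicator_def)
  ultimately have meas: "(\<lambda>s. indicator {x<..<y} s *\<^sub>R resolvent s) \<in> borel_measurable lborel"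
    by (simp only:)
  show ?thesis
    unfolding diff
  proof (rule integral_cong_AE)
    show "AE s in lborel. indicator {0<..<y} s *\<^sub>R resolvent s - indicator {0<..<x} s *\<^sub>R resolvent s =
        indicator {x<..<y} s *\<^sub>R resolvent s"
      using AE_lborel_singleton[of x]
      by eventually_elim (use assms in \<open>auto simp: indicator_def\<close>)
  qed (use int meas in auto)
qed

lemma pgf_series_has_vector_derivative:
  assumes "t > 0"
  shows "(pgf_series has_vector_derivative resolvent t) (at t)"
proof -
  define a b where "a = t / 2" and "b = 2 * t"
  have ab: "0 < a" "a < t" "t < b"
    using assms by (auto simp: a_def b_def)
  have cont: "continuous_on {a..b} resolvent"
    using continuous_on_resolvent ab by blast
  have "((\<lambda>x. integral {a..x} resolvent) has_vector_derivative resolvent t) (at t within {a..b})"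
    using ab by (intro integral_has_vector_derivative[OF cont]) auto
  then have "((\<lambda>x. integral {a..x} resolvent) has_vector_derivative resolvent t) (at t)"
    using ab by (simp add: at_within_Icc_at)
  then have "((\<lambda>x. pgf_series a + integral {a..x} resolvent) has_vector_derivative (0 + resolvent t)) (at t)"
    by (intro has_vector_derivative_add has_vector_derivative_const)
  then have "((\<lambda>x. pgf_series a + integral {a..x} resolvent) has_vector_derivative resolvent t) (at t)"
    by simp
  then show ?thesis
  proof (rule has_vector_derivative_transform_within_open)
    show "open {a<..<b}" "t \<in> {a<..<b}"
      using ab by auto
    fix x assume x: "x \<in> {a<..<b}"
    have "set_integrable lborel {a..x} resolvent"
      by (rule borel_integrable_atLeastAtMost') (rule continuous_on_subset[OF cont], use x in auto)
    then have "set_integrable lborel {a<..<x} resolvent"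
      by (rule set_integrable_subset) auto
    then have "(LINT s|lborel. indicator {a<..<x} s *\<^sub>R resolvent s) = integral {a<..<x} resolvent"
      using set_borel_integral_eq_integral(2)[of "{a<..<x}" resolvent]
      by (simp add: set_lebesgue_integral_def)
    then show "pgf_series a + integral {a..x} resolvent = pgf_series x"
      using pgf_series_diff[of a x] ab x by (simp add: integral_open_interval_real algebra_simps)
  qed
qed

lemma pgf_series_abs_continuous:
  assumes F: "\<And>t. t > 0 \<Longrightarrow> F t = pgf_series t" and "F 0 = 1"
  shows "abs_continuous_on_interval 0 T F"
proof (rule abs_continuous_indefinite_integral[OF resolvent_integrable[of T]])
  fix x y assume xy: "0 \<le> x" "x \<le> y" "y \<le> T"
  have eq: "indicator {x<..<y} s *\<^sub>R (indicator {..<T} s *\<^sub>R resolvent s) = indicator {x<..<y} s *\<^sub>R resolvent s" for s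
    using xy by (auto simp: indicator_def)
  show "F y - F x = (LINT s|lborel. indicator {x<..<y} s *\<^sub>R (indicator {..<T} s *\<^sub>R resolvent s))"
    unfolding eq
  proof (cases "x = 0")
    case True
    show "F y - F x = (LINT s|lborel. indicator {x<..<y} s *\<^sub>R resolvent s)"
    proof (cases "y = 0")
      case False
      then show ?thesis
        using pgf_series_eq_integral[of y] F[of y] assms(2) True xy by (simp add: has_bochner_integral_iff)
    qed (use True in simp)
  next
    case False
    then show "F y - F x = (LINT s|lborel. indicator {x<..<y} s *\<^sub>R resolvent s)"
      using F[of x] F[of y] pgf_series_diff[of x y] xy by simp
  qed
qed

end

section \<open>The equivalent Volterra equation\<close>

text \<open>The derivative of an absolutely continuous function is only Lebesgue measurable, while Fubini's
  theorem is applied on the product of Borel measures.\<close>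

lemma integrable_lebesgue_borel_version:
  fixes f :: "real \<Rightarrow> complex"
  assumes "integrable lebesgue f"
  obtains u where "integrable lborel u" "AE x in lebesgue. u x = f x"
proof -
  have "(\<lambda>x. Re (f x)) \<in> borel_measurable lebesgue" "(\<lambda>x. Im (f x)) \<in> borel_measurable lebesgue"
    using borel_measurable_integrable[OF assms] by measurable
  then obtain r i where r[measurable]: "r \<in> borel_measurable lborel" "AE x in lborel. Re (f x) = r x"
      and i[measurable]: "i \<in> borel_measurable lborel" "AE x in lborel. Im (f x) = i x"
    using completion_ex_borel_measurable_real[of "\<lambda>x. Re (f x)" lborel]
      completion_ex_borel_measurable_real[of "\<lambda>x. Im (f x)" lborel] by blast
  define u where "u x = of_real (r x) + \<i> * of_real (i x)" for x
  have u[measurable]: "u \<in> borel_measurable lborel"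
    unfolding u_def[abs_def] by measurable
  have "AE x in lborel. u x = f x"
    using r(2) i(2) by eventually_elim (simp add: u_def complex_eq_iff)
  then have ae: "AE x in lebesgue. u x = f x"
    by (rule AE_completion)
  have "u \<in> borel_measurable lebesgue"
    using u by (rule measurable_completion)
  then have "integrable lebesgue u"
  proof (rule integrable_cong_AE_imp[OF assms])
    show "AE x in lebesgue. f x = u x"
      using ae by eventually_elim simp
  qed
  then have "integrable lborel u"
    using u by (simp add: integrable_completion)
  then show ?thesis
    using ae that by blast
qed

text \<open>Fubini's theorem moves the convolution of the two kernels inside, where the semigroup law turns it
  into \<open>causal_kernel \<rho> \<omega> 0 1\<close>. Absolute integrability holds because the corresponding
  Riemann--Liouville kernels convolve to the constant \<open>1\<close>.\<close>

lemma caputo_kernel_inverse: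
  fixes u :: "real \<Rightarrow> complex"
  assumes \<rho>: "\<rho> > 0" and \<mu>: "0 < \<mu>" "\<mu> < 1"
    and u: "integrable lborel u" and u_0: "\<And>y. y \<le> 0 \<Longrightarrow> u y = 0"
  shows "(LINT s|lborel. causal_kernel \<rho> \<omega> \<gamma> \<mu> (t - s) *\<^sub>R
      (LINT y|lborel. causal_kernel \<rho> \<omega> (- \<gamma>) (1 - \<mu>) (s - y) *\<^sub>R u y)) = (LINT y|lborel. indicator {..<t} y *\<^sub>R u y)"
proof -
  define k1 where "k1 = causal_kernel \<rho> \<omega> \<gamma> \<mu>"
  define k2 where "k2 = causal_kernel \<rho> \<omega> (- \<gamma>) (1 - \<mu>)"
  have \<mu>': "1 - \<mu> > 0"
    using \<mu> by simp
  have k[measurable]: "k1 \<in> borel_measurable borel" "k2 \<in> borel_measurable borel"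
    unfolding k1_def k2_def using measurable_causal_kernel[OF \<rho>] \<mu> \<mu>' by auto
  have um[measurable]: "u \<in> borel_measurable borel"
    using u by auto
  define f where "f y s = (k1 (t - s) * k2 (s - y)) *\<^sub>R u y" for y s
  have f_meas: "case_prod f \<in> borel_measurable (lborel \<Otimes>\<^sub>M lborel)"
    unfolding f_def[abs_def] by measurable
  have shift: "has_bochner_integral lborel (\<lambda>s. F (s - y)) c" if "has_bochner_integral lborel F c" for F :: "real \<Rightarrow> real" and c y
    using that lborel_has_bochner_integral_real_affine_iff[of 1 F c "- y"] by simp
  have conv: "has_bochner_integral lborel (\<lambda>s. k1 (t - s) * k2 (s - y)) (indicator {..<t} y)" for y
    using shift[OF causal_kernel_conv[OF \<rho> \<mu>(1) \<mu>', of \<omega> \<gamma> "t - y" "- \<gamma>"], of y]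
    by (simp add: k1_def k2_def causal_kernel_unit indicator_def)
  have conv_h: "has_bochner_integral lborel (\<lambda>s. riemann_kernel \<mu> (t - s) * riemann_kernel (1 - \<mu>) (s - y)) (riemann_kernel 1 (t - y))" for y
    using shift[OF riemann_kernel_conv[OF \<mu>(1) \<mu>', of "t - y"], of y] by simp
  obtain C1 where C1: "C1 > 0" "\<And>s. s \<le> t \<Longrightarrow> \<bar>k1 s\<bar> \<le> C1 * riemann_kernel \<mu> s"
    using causal_kernel_bound[OF \<rho> \<mu>(1)] unfolding k1_def by blast
  obtain C2 where C2: "C2 > 0" "\<And>s. s \<le> t \<Longrightarrow> \<bar>k2 s\<bar> \<le> C2 * riemann_kernel (1 - \<mu>) s"
    using causal_kernel_bound[OF \<rho> \<mu>'] unfolding k2_def by blast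
  have bound: "\<bar>k1 (t - s) * k2 (s - y)\<bar> \<le> C1 * C2 * (riemann_kernel \<mu> (t - s) * riemann_kernel (1 - \<mu>) (s - y))"
    if "y > 0" for s y
  proof (cases "y < s \<and> s < t")
    case True
    then have "\<bar>k1 (t - s)\<bar> * \<bar>k2 (s - y)\<bar> \<le> (C1 * riemann_kernel \<mu> (t - s)) * (C2 * riemann_kernel (1 - \<mu>) (s - y))"
      using that C1(1) riemann_kernel_nonneg[OF \<mu>(1)] by (intro mult_mono C1(2) C2(2)) auto
    then show ?thesis
      by (simp add: abs_mult mult_ac)
  next
    case False
    then have "k1 (t - s) = 0 \<or> k2 (s - y) = 0"
      by (auto simp: k1_def k2_def causal_kernel_def)
    then show ?thesis
      using C1(1) C2(1) riemann_kernel_nonneg[OF \<mu>(1)] riemann_kernel_nonneg[OF \<mu>']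
      by (auto intro!: mult_nonneg_nonneg)
  qed
  have int_s: "integrable lborel (f y)" for y
    unfolding f_def using conv[of y] by (auto simp: has_bochner_integral_iff)
  have "integrable (lborel \<Otimes>\<^sub>M lborel) (case_prod f)"
  proof (rule lborel_pair.Fubini_integrable[OF f_meas])
    have "(LINT s|lborel. norm (f y s)) \<le> C1 * C2 * norm (u y)" for y
    proof (cases "y > 0")
      case True
      have "(LINT s|lborel. norm (f y s)) \<le>
          (LINT s|lborel. norm (u y) * (C1 * C2 * (riemann_kernel \<mu> (t - s) * riemann_kernel (1 - \<mu>) (s - y))))"
      proof (rule integral_mono)
        show "norm (f y s) \<le> norm (u y) * (C1 * C2 * (riemann_kernel \<mu> (t - s) * riemann_kernel (1 - \<mu>) (s - y)))" for s
          using mult_left_mono[OF bound[OF True, of s], of "norm (u y)"] by (simp add: f_def mult_ac)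
      qed (use int_s[of y] conv_h[of y] in \<open>auto simp: has_bochner_integral_iff\<close>)
      also have "\<dots> = norm (u y) * (C1 * C2 * riemann_kernel 1 (t - y))"
        using conv_h[of y] by (simp add: has_bochner_integral_iff)
      also have "\<dots> \<le> norm (u y) * (C1 * C2 * 1)"
        using C1(1) C2(1) by (intro mult_left_mono) (auto simp: riemann_kernel_def)
      finally show ?thesis
        by (simp add: mult_ac)
    qed (simp add: f_def u_0)
    moreover have "(\<lambda>y. LINT s|lborel. norm (f y s)) \<in> borel_measurable lborel"
      using f_meas by (intro lborel.borel_measurable_lebesgue_integral) simp
    moreover have "integrable lborel (\<lambda>y. C1 * C2 * norm (u y))"
      using u by simp
    ultimately show "integrable lborel (\<lambda>y. LINT s|lborel. norm (case_prod f (y, s)))"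
      by (intro Bochner_Integration.integrable_bound[where g = "\<lambda>y. LINT s|lborel. norm (case_prod f (y, s))" and f = "\<lambda>y. C1 * C2 * norm (u y)"])
        (use C1(1) C2(1) in auto)
  qed (use int_s in simp)
  then have "(LINT s|lborel. LINT y|lborel. f y s) = (LINT y|lborel. LINT s|lborel. f y s)"
    by (rule lborel_pair.Fubini_integral)
  moreover have "(LINT y|lborel. f y s) = k1 (t - s) *\<^sub>R (LINT y|lborel. k2 (s - y) *\<^sub>R u y)" for s
    unfolding f_def scaleR_scaleR[symmetric]
    by (rule integral_bounded_linear'[OF bounded_linear_scaleR_right bounded_linear_scaleR_right[of "1 / k1 (t - s)"]]) auto
  moreover have "(LINT s|lborel. f y s) = indicator {..<t} y *\<^sub>R u y" for y
    using conv[of y] by (simp add: f_def has_bochner_integral_iff)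
  ultimately show ?thesis
    by (simp add: k1_def k2_def)
qed

text \<open>Apply the inverse kernel to both sides of the fractional equation and evaluate the left side with
  the fundamental theorem for absolutely continuous functions.\<close>

lemma caputo_to_volterra:
  fixes G :: "real \<Rightarrow> complex"
  assumes \<rho>: "\<rho> > 0" and \<mu>: "0 < \<mu>" "\<mu> < 1" and t: "t > 0"
    and ac: "abs_continuous_on_interval 0 t G"
    and int: "\<And>s. s > 0 \<Longrightarrow> set_integrable lebesgue {0..s}
        (\<lambda>y. prabhakar_kernel (- \<gamma>) \<rho> (1 - \<mu>) \<omega> (s - y) *\<^sub>R vector_derivative G (at y))"
    and eq: "\<And>s. s > 0 \<Longrightarrow> (LINT y:{0..s}|lebesgue.
        prabhakar_kernel (- \<gamma>) \<rho> (1 - \<mu>) \<omega> (s - y) *\<^sub>R vector_derivative G (at y)) = z * G s"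
  shows "G t - G 0 = (LINT s|lborel. causal_kernel \<rho> \<omega> \<gamma> \<mu> (t - s) *\<^sub>R (indicator {0<..<t} s *\<^sub>R (z * G s)))"
proof -
  define D where "D y = vector_derivative G (at y)" for y
  have D_int: "set_integrable lebesgue {0..t} D"
    using abs_continuous_absolutely_integrable[OF ac] t unfolding D_def[abs_def] by simp
  then have D_int': "set_integrable lebesgue {0<..<t} D"
    by (rule set_integrable_subset) auto
  have "integrable lebesgue (\<lambda>y. indicator {0<..<t} y *\<^sub>R D y)"
    using D_int' by (simp add: set_integrable_def)
  then obtain u0 where u0: "integrable lborel u0" "AE y in lebesgue. u0 y = indicator {0<..<t} y *\<^sub>R D y"
    using integrable_lebesgue_borel_version by blast
  define u where "u y = indicator {0<..<t} y *\<^sub>R u0 y" for y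
  have u: "integrable lborel u"
    unfolding u_def using u0(1) by (intro integrable_mult_indicator) auto
  have u_ae: "AE y in lebesgue. u y = indicator {0<..<t} y *\<^sub>R D y"
    using u0(2) by eventually_elim (auto simp: u_def indicator_def)
  have um[measurable]: "u \<in> borel_measurable borel"
    using u by auto
  have \<mu>': "1 - \<mu> > 0"
    using \<mu> by simp
  define k2 where "k2 = causal_kernel \<rho> \<omega> (- \<gamma>) (1 - \<mu>)"
  have k2[measurable]: "k2 \<in> borel_measurable borel"
    unfolding k2_def by (rule measurable_causal_kernel[OF \<rho> \<mu>'])
  have inner: "(LINT y|lborel. k2 (s - y) *\<^sub>R u y) = z * G s" if s: "0 < s" "s < t" for s
  proof -
    have meas: "(\<lambda>y. k2 (s - y) *\<^sub>R u y) \<in> borel_measurable lborel"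
      by measurable
    have "(LINT y|lborel. k2 (s - y) *\<^sub>R u y) = (LINT y|lebesgue. k2 (s - y) *\<^sub>R u y)"
      by (rule integral_completion[OF meas, symmetric])
    also have "\<dots> = (LINT y:{0..s}|lebesgue. prabhakar_kernel (- \<gamma>) \<rho> (1 - \<mu>) \<omega> (s - y) *\<^sub>R D y)"
      unfolding set_lebesgue_integral_def
    proof (rule integral_cong_AE)
      show "(\<lambda>y. k2 (s - y) *\<^sub>R u y) \<in> borel_measurable lebesgue"
        using meas by (rule measurable_completion)
      show "(\<lambda>y. indicator {0..s} y *\<^sub>R prabhakar_kernel (- \<gamma>) \<rho> (1 - \<mu>) \<omega> (s - y) *\<^sub>R D y) \<in> borel_measurable lebesgue"
        using int[OF s(1)] unfolding set_integrable_def D_def by (rule borel_measurable_integrable)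
      have "AE y in lebesgue. y \<noteq> 0 \<and> y \<noteq> s"
        using AE_completion[OF AE_lborel_singleton[of "0::real"]] AE_completion[OF AE_lborel_singleton[of s]] by auto
      then show "AE y in lebesgue. k2 (s - y) *\<^sub>R u y = indicator {0..s} y *\<^sub>R prabhakar_kernel (- \<gamma>) \<rho> (1 - \<mu>) \<omega> (s - y) *\<^sub>R D y"
        using u_ae
      proof eventually_elim
        case (elim y)
        then show ?case
          unfolding elim(2) k2_def causal_kernel_def using s by (auto simp: indicator_def)
      qed
    qed
    also have "\<dots> = z * G s"
      using eq[OF s(1)] by (simp add: D_def)
    finally show ?thesis .
  qed
  have "causal_kernel \<rho> \<omega> \<gamma> \<mu> (t - s) *\<^sub>R (LINT y|lborel. k2 (s - y) *\<^sub>R u y) =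
      causal_kernel \<rho> \<omega> \<gamma> \<mu> (t - s) *\<^sub>R (indicator {0<..<t} s *\<^sub>R (z * G s))" for s
  proof -
    consider "s \<le> 0" | "0 < s" "s < t" | "s \<ge> t"
      by linarith
    then show ?thesis
    proof cases
      case 1
      then have "k2 (s - y) *\<^sub>R u y = 0" for y
        by (cases "y < s") (auto simp: k2_def causal_kernel_def u_def)
      then have "(LINT y|lborel. k2 (s - y) *\<^sub>R u y) = 0"
        by (simp only: Bochner_Integration.integral_zero)
      then show ?thesis
        using 1 by simp
    next
      case 2
      then show ?thesis
        by (simp add: inner)
    next
      case 3
      then show ?thesis
        by (simp add: causal_kernel_def)
    qed
  qed
  then have "(LINT s|lborel. causal_kernel \<rho> \<omega> \<gamma> \<mu> (t - s) *\<^sub>R (indicator {0<..<t} s *\<^sub>R (z * G s))) =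
      (LINT y|lborel. indicator {..<t} y *\<^sub>R u y)"
    using caputo_kernel_inverse[OF \<rho> \<mu> u, of \<omega> \<gamma> t] by (simp add: u_def k2_def)
  also have "(\<lambda>y. indicator {..<t} y *\<^sub>R u y) = u"
    by (auto simp: u_def indicator_def)
  also have "(LINT y|lborel. u y) = (LINT y|lebesgue. u y)"
    by (rule integral_completion[symmetric]) simp
  also have "\<dots> = (LINT y:{0<..<t}|lebesgue. D y)"
    unfolding set_lebesgue_integral_def
  proof (rule integral_cong_AE[OF _ _ u_ae])
    show "u \<in> borel_measurable lebesgue"
      by (rule measurable_completion) simp
    show "(\<lambda>y. indicator {0<..<t} y *\<^sub>R D y) \<in> borel_measurable lebesgue"
      using D_int' unfolding set_integrable_def by (rule borel_measurable_integrable)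
  qed
  also have "\<dots> = integral {0<..<t} D"
    by (rule set_lebesgue_integral_eq_integral(2)[OF D_int'])
  also have "\<dots> = G t - G 0"
    using abs_continuous_has_integral[OF ac] t
    by (simp add: D_def[abs_def] integral_unique integral_open_interval_real[symmetric])
  finally show ?thesis ..
qed

lemma volterra_integrable:
  fixes G :: "real \<Rightarrow> complex"
  assumes \<rho>: "\<rho> > 0" and \<mu>: "\<mu> > 0" and G: "continuous_on {0..t} G"
  shows "integrable lborel (\<lambda>s. causal_kernel \<rho> \<omega> \<gamma> \<mu> (t - s) *\<^sub>R (indicator {0<..<t} s *\<^sub>R (z * G s)))"
proof -
  have "bounded (G ` {0..t})"
    using G by (intro compact_imp_bounded compact_continuous_image) auto
  then obtain M where M: "M > 0" "\<And>s. s \<in> {0..t} \<Longrightarrow> norm (G s) \<le> M"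
    by (auto simp: bounded_pos)
  obtain C where C: "C > 0" "\<And>s. s \<le> t \<Longrightarrow> \<bar>causal_kernel \<rho> \<omega> \<gamma> \<mu> s\<bar> \<le> C * riemann_kernel \<mu> s"
    using causal_kernel_bound[OF \<rho> \<mu>] by blast
  have dom: "integrable lborel (\<lambda>s. C * norm z * M * (riemann_kernel \<mu> (t - s) * riemann_kernel 1 s))"
    using riemann_kernel_conv[OF \<mu>, of 1 t] by (auto simp: has_bochner_integral_iff)
  show ?thesis
  proof (rule Bochner_Integration.integrable_bound[OF dom])
    have [measurable]: "causal_kernel \<rho> \<omega> \<gamma> \<mu> \<in> borel_measurable borel"
      by (rule measurable_causal_kernel[OF \<rho> \<mu>])
    have "continuous_on {0<..<t} (\<lambda>s. z * G s)"
      by (intro continuous_intros continuous_on_subset[OF G]) auto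
    then have [measurable]: "(\<lambda>s. indicator {0<..<t} s *\<^sub>R (z * G s)) \<in> borel_measurable borel"
      by (intro borel_measurable_continuous_on_indicator) auto
    show "(\<lambda>s. causal_kernel \<rho> \<omega> \<gamma> \<mu> (t - s) *\<^sub>R (indicator {0<..<t} s *\<^sub>R (z * G s))) \<in> borel_measurable lborel"
      by measurable
    have "norm (causal_kernel \<rho> \<omega> \<gamma> \<mu> (t - s) *\<^sub>R (indicator {0<..<t} s *\<^sub>R (z * G s))) \<le>
        C * norm z * M * (riemann_kernel \<mu> (t - s) * riemann_kernel 1 s)" for s
    proof (cases "0 < s \<and> s < t")
      case True
      then have "\<bar>causal_kernel \<rho> \<omega> \<gamma> \<mu> (t - s)\<bar> * (norm z * norm (G s)) \<le> (C * riemann_kernel \<mu> (t - s)) * (norm z * M)"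
        using C(1) riemann_kernel_nonneg[OF \<mu>] by (intro mult_mono C(2) M(2)) auto
      then show ?thesis
        using True by (simp add: norm_mult riemann_kernel_def mult_ac)
    next
      case False
      then show ?thesis
        using C(1) M(1) riemann_kernel_nonneg[OF \<mu>] riemann_kernel_nonneg[of 1]
        by (auto intro!: mult_nonneg_nonneg)
    qed
    then show "AE s in lborel. norm (causal_kernel \<rho> \<omega> \<gamma> \<mu> (t - s) *\<^sub>R (indicator {0<..<t} s *\<^sub>R (z * G s))) \<le>
        norm (C * norm z * M * (riemann_kernel \<mu> (t - s) * riemann_kernel 1 s))"
      by (intro AE_I2) (metis abs_ge_self order_trans real_norm_def)
  qed
qed

text \<open>Iterating the equation for the difference \<open>d\<close> of two solutions gives
  \<open>\<bar>d t\<bar> \<le> M q\<^sup>n riemann_kernel (\<mu> n + 1) t\<close> for every \<open>n\<close>, where \<open>M\<close> bounds \<open>\<bar>d\<bar>\<close>. These are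
  terms of a convergent series.\<close>

lemma volterra_unique:
  fixes G H :: "real \<Rightarrow> complex"
  assumes \<rho>: "\<rho> > 0" and \<mu>: "\<mu> > 0" and t0: "t0 > 0"
    and G: "continuous_on {0..t0} G" and H: "continuous_on {0..t0} H"
    and eqG: "\<And>t. 0 < t \<Longrightarrow> t \<le> t0 \<Longrightarrow> G t - c = (LINT s|lborel. causal_kernel \<rho> \<omega> \<gamma> \<mu> (t - s) *\<^sub>R (indicator {0<..<t} s *\<^sub>R (z * G s)))"
    and eqH: "\<And>t. 0 < t \<Longrightarrow> t \<le> t0 \<Longrightarrow> H t - c = (LINT s|lborel. causal_kernel \<rho> \<omega> \<gamma> \<mu> (t - s) *\<^sub>R (indicator {0<..<t} s *\<^sub>R (z * H s)))"
  shows "G t0 = H t0"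
proof -
  define d where "d t = G t - H t" for t
  have d_cont: "continuous_on {0..t} d" if "t \<le> t0" for t
    unfolding d_def using that by (intro continuous_intros continuous_on_subset[OF G] continuous_on_subset[OF H]) auto
  have d_eq: "d t = (LINT s|lborel. causal_kernel \<rho> \<omega> \<gamma> \<mu> (t - s) *\<^sub>R (indicator {0<..<t} s *\<^sub>R (z * d s)))"
    if "0 < t" "t \<le> t0" for t
  proof -
    have "d t = (G t - c) - (H t - c)"
      by (simp add: d_def)
    also have "\<dots> = (LINT s|lborel. causal_kernel \<rho> \<omega> \<gamma> \<mu> (t - s) *\<^sub>R (indicator {0<..<t} s *\<^sub>R (z * G s)) -
        causal_kernel \<rho> \<omega> \<gamma> \<mu> (t - s) *\<^sub>R (indicator {0<..<t} s *\<^sub>R (z * H s)))"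
      unfolding eqG[OF that] eqH[OF that] using that
      by (intro Bochner_Integration.integral_diff[symmetric] volterra_integrable[OF \<rho> \<mu>]
          continuous_on_subset[OF G] continuous_on_subset[OF H]) auto
    also have "\<dots> = (LINT s|lborel. causal_kernel \<rho> \<omega> \<gamma> \<mu> (t - s) *\<^sub>R (indicator {0<..<t} s *\<^sub>R (z * d s)))"
      by (simp add: d_def algebra_simps)
    finally show ?thesis .
  qed
  have "bounded (d ` {0..t0})"
    using d_cont[of t0] by (intro compact_imp_bounded compact_continuous_image) auto
  then obtain M where M: "M > 0" "\<And>s. s \<in> {0..t0} \<Longrightarrow> norm (d s) \<le> M"
    by (auto simp: bounded_pos)
  obtain C where C: "C > 0" "\<And>s. s \<le> t0 \<Longrightarrow> \<bar>causal_kernel \<rho> \<omega> \<gamma> \<mu> s\<bar> \<le> C * riemann_kernel \<mu> s"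
    using causal_kernel_bound[OF \<rho> \<mu>] by blast
  define q where "q = norm z * C"
  have q: "q \<ge> 0"
    using C(1) by (simp add: q_def)
  have pos: "\<mu> * real n + 1 > 0" for n
    using \<mu> by (simp add: add_nonneg_pos)
  have bound: "norm (d t) \<le> M * q ^ n * riemann_kernel (\<mu> * real n + 1) t" if "0 < t" "t \<le> t0" for n t
    using that
  proof (induction n arbitrary: t)
    case 0
    then show ?case
      using M(2)[of t] by (simp add: riemann_kernel_def)
  next
    case (Suc n)
    have dom: "has_bochner_integral lborel
        (\<lambda>s. (M * q ^ Suc n) * (riemann_kernel \<mu> (t - s) * riemann_kernel (\<mu> * real n + 1) s))
        ((M * q ^ Suc n) * riemann_kernel (\<mu> * real (Suc n) + 1) t)"
    proof -
      have "\<mu> + (\<mu> * real n + 1) = \<mu> * real (Suc n) + 1"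
        by (simp add: algebra_simps)
      then show ?thesis
        using has_bochner_integral_mult_right[OF riemann_kernel_conv[OF \<mu> pos[of n], of t], of "M * q ^ Suc n"]
        by (simp only:)
    qed
    have "norm (d t) \<le> (LINT s|lborel. (M * q ^ Suc n) * (riemann_kernel \<mu> (t - s) * riemann_kernel (\<mu> * real n + 1) s))"
      unfolding d_eq[OF Suc.prems]
    proof (rule Bochner_Integration.integral_norm_bound_integral)
      show "integrable lborel (\<lambda>s. causal_kernel \<rho> \<omega> \<gamma> \<mu> (t - s) *\<^sub>R (indicator {0<..<t} s *\<^sub>R (z * d s)))"
        by (rule volterra_integrable[OF \<rho> \<mu> d_cont[OF Suc.prems(2)]])
      show "integrable lborel (\<lambda>s. (M * q ^ Suc n) * (riemann_kernel \<mu> (t - s) * riemann_kernel (\<mu> * real n + 1) s))"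
        using dom by (simp only: has_bochner_integral_iff)
      fix s
      show "norm (causal_kernel \<rho> \<omega> \<gamma> \<mu> (t - s) *\<^sub>R (indicator {0<..<t} s *\<^sub>R (z * d s))) \<le>
          (M * q ^ Suc n) * (riemann_kernel \<mu> (t - s) * riemann_kernel (\<mu> * real n + 1) s)"
      proof (cases "0 < s \<and> s < t")
        case True
        then have "\<bar>causal_kernel \<rho> \<omega> \<gamma> \<mu> (t - s)\<bar> * (norm z * norm (d s)) \<le>
            (C * riemann_kernel \<mu> (t - s)) * (norm z * (M * q ^ n * riemann_kernel (\<mu> * real n + 1) s))"
          using C(1) riemann_kernel_nonneg[OF \<mu>] Suc.prems
          by (intro mult_mono C(2) Suc.IH) auto
        then show ?thesis
          using True by (simp add: norm_mult q_def mult_ac)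
      next
        case False
        then show ?thesis
          using M(1) q riemann_kernel_nonneg[OF \<mu>] riemann_kernel_nonneg[OF pos[of n]]
          by (auto intro!: mult_nonneg_nonneg)
      qed
    qed
    then show ?case
      unfolding has_bochner_integral_integral_eq[OF dom] .
  qed
  have "summable (\<lambda>n. q ^ n * riemann_kernel (\<mu> * real n + 1) t0)"
    using \<mu> q by (intro summable_riemann_kernel) auto
  then have "(\<lambda>n. M * (q ^ n * riemann_kernel (\<mu> * real n + 1) t0)) \<longlonglongrightarrow> M * 0"
    by (intro tendsto_mult_left summable_LIMSEQ_zero)
  then have "norm (d t0) \<le> M * 0"
    by (rule LIMSEQ_le_const) (use bound[OF t0] in \<open>auto simp: mult_ac\<close>)
  then show ?thesis
    by (simp add: d_def)
qed

text \<open>For \<open>r = 0\<close> the condition reads \<open>\<mu> \<lceil>\<gamma>\<rceil> < \<gamma>\<close>, and \<open>\<gamma> \<le> \<lceil>\<gamma>\<rceil>\<close>.\<close>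

lemma parameter_cases:
  fixes \<gamma> \<mu> \<rho> :: real
  assumes "\<gamma> \<ge> 0" "\<mu> > 0" "\<mu> \<le> 1"
    and cond: "\<gamma> \<noteq> 0 \<Longrightarrow> \<forall>r::nat. int r \<le> \<lceil>\<gamma>\<rceil> \<longrightarrow>
           0 < \<mu> * of_int \<lceil>\<gamma>\<rceil> / \<gamma> - real r * \<rho> \<and> \<mu> * of_int \<lceil>\<gamma>\<rceil> / \<gamma> - real r * \<rho> < 1"
  shows "\<gamma> = 0 \<and> \<mu> = 1 \<or> \<mu> < 1"
proof (cases "\<gamma> = 0")
  case False
  have "int 0 \<le> \<lceil>\<gamma>\<rceil>"
    using assms(1) by simp
  then have "\<mu> * of_int \<lceil>\<gamma>\<rceil> / \<gamma> < 1"
    using cond[OF False] by fastforce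
  then have "\<mu> * of_int \<lceil>\<gamma>\<rceil> < \<gamma>"
    using False assms(1) by (simp add: field_simps)
  also have "\<gamma> \<le> 1 * of_int \<lceil>\<gamma>\<rceil>"
    by simp
  finally show ?thesis
    using False assms(1) by (simp add: mult_less_cancel_right_pos)
qed (use assms in auto)

lemma pgf_series_term_eq_causal_kernel:
  assumes "t > 0"
  shows "pgf_series_term lam \<phi> \<gamma> \<rho> \<mu> v t = (\<lambda>k. (- of_real lam * (1 - v)) ^ k *
    of_real (causal_kernel \<rho> (- \<phi>) (\<gamma> * real k) (\<mu> * real k + 1) t))"
proof
  fix k
  define E where "E = prabhakar_E (\<gamma> * real k) \<rho> (\<mu> * real k + 1) (- \<phi> * t powr \<rho>)"
  have "(t powr \<mu>) ^ k = t powr (\<mu> * real k)"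
    using assms by (simp add: powr_powr[symmetric] powr_realpow)
  then have kernel: "causal_kernel \<rho> (- \<phi>) (\<gamma> * real k) (\<mu> * real k + 1) t = (t powr \<mu>) ^ k * E"
    using assms by (simp add: causal_kernel_def prabhakar_kernel_def E_def)
  have "complex_of_real ((- lam * t powr \<mu>) ^ k) * (1 - v) ^ k = (- of_real lam * (1 - v)) ^ k * of_real ((t powr \<mu>) ^ k)"
    by (simp only: of_real_power of_real_mult of_real_minus power_mult_distrib mult_ac)
  then show "pgf_series_term lam \<phi> \<gamma> \<rho> \<mu> v t k = (- of_real lam * (1 - v)) ^ k *
    of_real (causal_kernel \<rho> (- \<phi>) (\<gamma> * real k) (\<mu> * real k + 1) t)"
    unfolding pgf_series_term_def E_def[symmetric] kernel of_real_mult[of _ E] mult.assoc[symmetric] by (rule arg_cong)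
qed

lemma pgf_series_term_0: "\<mu> > 0 \<Longrightarrow> pgf_series_term lam \<phi> \<gamma> \<rho> \<mu> v 0 k = (if k = 0 then 1 else 0)"
proof -
  have "prabhakar_E 0 \<rho> 1 0 = 1"
    unfolding prabhakar_E_def by (subst suminf_finite[of "{0}"]) (auto simp: pochhammer_0_left)
  then show "\<mu> > 0 \<Longrightarrow> ?thesis"
    by (simp add: pgf_series_term_def)
qed

text \<open>For \<open>\<gamma> = 0\<close> and \<open>\<mu> = 1\<close> the Volterra kernel is the constant \<open>1\<close>, and the equation is
  \<open>G' = z G\<close> integrated.\<close>

lemma solution_volterra:
  fixes G :: "complex \<Rightarrow> real \<Rightarrow> complex"
  assumes sol: "pgf_cauchy_solution lam \<phi> \<gamma> \<rho> \<mu> G" and v: "norm v \<le> 1"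
    and "\<rho> > 0" "\<mu> > 0" and cases: "\<gamma> = 0 \<and> \<mu> = 1 \<or> \<mu> < 1" and t: "t > 0"
  shows "G v t - 1 = (LINT s|lborel. causal_kernel \<rho> (- \<phi>) \<gamma> \<mu> (t - s) *\<^sub>R
      (indicator {0<..<t} s *\<^sub>R ((- of_real lam * (1 - v)) * G v s)))"
proof -
  have ac: "abs_continuous_on_interval 0 t (G v)"
    and diff: "\<And>s. s > 0 \<Longrightarrow> regularized_HP_differentiable \<gamma> \<mu> \<rho> (- \<phi>) (G v) s"
    and eq: "\<And>s. s > 0 \<Longrightarrow> regularized_HP_derivative \<gamma> \<mu> \<rho> (- \<phi>) (G v) s = - of_real lam * (1 - v) * G v s"
    and G0: "G v 0 = 1"
    using sol v t unfolding pgf_cauchy_solution_def by blast+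
  show ?thesis
  proof (cases "\<mu> < 1")
    case True
    then have "G v t - G v 0 = (LINT s|lborel. causal_kernel \<rho> (- \<phi>) \<gamma> \<mu> (t - s) *\<^sub>R
        (indicator {0<..<t} s *\<^sub>R ((- of_real lam * (1 - v)) * G v s)))"
    proof (intro caputo_to_volterra ac assms t)
      fix s :: real assume "s > 0"
      then show "set_integrable lebesgue {0..s}
          (\<lambda>y. prabhakar_kernel (- \<gamma>) \<rho> (1 - \<mu>) (- \<phi>) (s - y) *\<^sub>R vector_derivative (G v) (at y))"
        using diff[of s] True by (simp add: regularized_HP_differentiable_def)
      show "(LINT y:{0..s}|lebesgue.
          prabhakar_kernel (- \<gamma>) \<rho> (1 - \<mu>) (- \<phi>) (s - y) *\<^sub>R vector_derivative (G v) (at y)) = - of_real lam * (1 - v) * G v s"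
        using eq[OF \<open>s > 0\<close>] True by (simp add: regularized_HP_derivative_def prabhakar_integral_def)
    qed (use True in auto)
    then show ?thesis
      using G0 by simp
  next
    case False
    then have [simp]: "\<gamma> = 0" "\<mu> = 1"
      using cases by auto
    define z where "z = - of_real lam * (1 - v)"
    have deriv: "vector_derivative (G v) (at s) = z * G v s" if "s > 0" for s
      using eq[OF that] by (simp add: regularized_HP_derivative_def prabhakar_integral_def z_def)
    have cont: "continuous_on {0..t} (\<lambda>s. z * G v s)"
      by (intro continuous_intros abs_continuous_imp_continuous_on ac)
    have int: "((\<lambda>s. z * G v s) has_integral (G v t - G v 0)) {0..t}"
    proof (rule has_integral_spike[where S = "{0}"])
      show "((\<lambda>s. vector_derivative (G v) (at s)) has_integral (G v t - G v 0)) {0..t}"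
        using ac t by (intro abs_continuous_has_integral) auto
    qed (use deriv in auto)
    have "integral {0<..<t} (\<lambda>s. z * G v s) = G v t - 1"
      unfolding integral_open_interval_real[symmetric] integral_unique[OF int] G0 ..
    moreover have int: "set_integrable lborel {0<..<t} (\<lambda>s. z * G v s)"
      by (rule set_integrable_subset[OF borel_integrable_atLeastAtMost'[OF cont]]) auto
    moreover have "(LINT s:{0<..<t}|lborel. z * G v s) = integral {0<..<t} (\<lambda>s. z * G v s)"
      by (rule set_borel_integral_eq_integral(2)[OF int])
    moreover have "causal_kernel \<rho> (- \<phi>) \<gamma> \<mu> (t - s) *\<^sub>R (indicator {0<..<t} s *\<^sub>R (z * G v s)) =
        indicator {0<..<t} s *\<^sub>R (z * G v s)" for s
      by (simp add: causal_kernel_unit indicator_def)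
    ultimately show ?thesis
      unfolding set_lebesgue_integral_def z_def by (simp only:)
  qed
qed

lemma pgf_series_solves:
  fixes lam \<phi> \<gamma> \<rho> \<mu> :: real
  assumes \<rho>: "\<rho> > 0" and \<mu>: "\<mu> > 0" and cases: "\<gamma> = 0 \<and> \<mu> = 1 \<or> \<mu> < 1"
  shows "pgf_cauchy_solution lam \<phi> \<gamma> \<rho> \<mu> (\<lambda>v t. \<Sum>k. pgf_series_term lam \<phi> \<gamma> \<rho> \<mu> v t k)"
  unfolding pgf_cauchy_solution_def
proof (intro allI impI conjI)
  fix v :: complex
  define z where "z = - of_real lam * (1 - v)"
  define S where "S t = (\<Sum>k. pgf_series_term lam \<phi> \<gamma> \<rho> \<mu> v t k)" for t
  define P where "P = pgf_series \<rho> (- \<phi>) \<gamma> \<mu> z"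
  define g where "g = resolvent \<rho> (- \<phi>) \<gamma> \<mu> z"
  have S: "S t = P t" if "t > 0" for t
    unfolding S_def P_def pgf_series_def[OF \<rho> \<mu>] z_def pgf_series_term_eq_causal_kernel[OF that] ..
  have "(\<Sum>k. pgf_series_term lam \<phi> \<gamma> \<rho> \<mu> v 0 k) = 1"
    by (subst suminf_finite[of "{0}"]) (auto simp: pgf_series_term_0[OF \<mu>])
  then show S0: "(\<Sum>k. pgf_series_term lam \<phi> \<gamma> \<rho> \<mu> v 0 k) = 1" .
  show "abs_continuous_on_interval 0 T (\<lambda>t. \<Sum>k. pgf_series_term lam \<phi> \<gamma> \<rho> \<mu> v t k)" for T
    using pgf_series_abs_continuous[OF \<rho> \<mu>, of S "- \<phi>" \<gamma> z T] S S0 unfolding S_def P_def by blast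
  have deriv: "(S has_vector_derivative g t) (at t)" if "t > 0" for t
    by (rule has_vector_derivative_transform_within_open[OF _ open_greaterThan[of 0]])
      (use pgf_series_has_vector_derivative[OF \<rho> \<mu> that] that S in \<open>auto simp: g_def P_def\<close>)
  fix t :: real assume t: "t > 0"
  have main: "regularized_HP_differentiable \<gamma> \<mu> \<rho> (- \<phi>) S t \<and>
      regularized_HP_derivative \<gamma> \<mu> \<rho> (- \<phi>) S t = z * S t"
  proof (cases "\<mu> < 1")
    case True
    have "has_bochner_integral lborel (\<lambda>y. causal_kernel \<rho> (- \<phi>) (- \<gamma>) (1 - \<mu>) (t - y) *\<^sub>R g y) (z * P t)"
      unfolding g_def P_def by (rule caputo_kernel_resolvent[OF \<rho> \<mu> True])
    then have "has_bochner_integral lebesgue (\<lambda>y. causal_kernel \<rho> (- \<phi>) (- \<gamma>) (1 - \<mu>) (t - y) *\<^sub>R g y) (z * P t)"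
      unfolding has_bochner_integral_iff
      by (metis integrable_completion integral_completion borel_measurable_integrable)
    then have "has_bochner_integral lebesgue (\<lambda>y. indicator {0..t} y *\<^sub>R
        (prabhakar_kernel (- \<gamma>) \<rho> (1 - \<mu>) (- \<phi>) (t - y) *\<^sub>R vector_derivative S (at y))) (z * P t)"
    \<comment> \<open>At \<open>0\<close> the derivative is arbitrary, and at \<open>t\<close> the kernel is evaluated at \<open>0\<close>.\<close>
    proof (rule has_bochner_integral_discrete_difference[where X = "{0, t}", THEN iffD1, rotated -1])
      fix y assume "y \<notin> {0, t}"
      then consider "y < 0" | "0 < y" "y < t" | "y > t"
        by force
      then show "causal_kernel \<rho> (- \<phi>) (- \<gamma>) (1 - \<mu>) (t - y) *\<^sub>R g y = indicator {0..t} y *\<^sub>R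
          (prabhakar_kernel (- \<gamma>) \<rho> (1 - \<mu>) (- \<phi>) (t - y) *\<^sub>R vector_derivative S (at y))"
      proof cases
        case 1
        then show ?thesis by (simp add: g_def resolvent_eq_0[OF \<rho> \<mu>])
      next
        case 2
        then show ?thesis by (simp add: causal_kernel_def vector_derivative_at[OF deriv])
      next
        case 3
        then show ?thesis by (simp add: causal_kernel_def)
      qed
    qed auto
    then show ?thesis
      using True S[OF t]
      unfolding regularized_HP_differentiable_def regularized_HP_derivative_def prabhakar_integral_def
        set_integrable_def set_lebesgue_integral_def has_bochner_integral_iff by simp
  next
    case False
    then have [simp]: "\<gamma> = 0" "\<mu> = 1"
      using cases by auto
    have "g t = (\<Sum>k. z * (z ^ k * of_real (causal_kernel \<rho> (- \<phi>) (\<gamma> * real k) (\<mu> * real k + 1) t)))"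
      unfolding g_def resolvent_def[OF \<rho> \<mu>] by (simp add: mult.assoc add.commute)
    also have "\<dots> = z * P t"
      unfolding P_def pgf_series_def[OF \<rho> \<mu>] by (rule suminf_mult[OF summable_pgf_series[OF \<rho> \<mu>]])
    finally show ?thesis
      using deriv[OF t] S[OF t]
      by (auto simp: regularized_HP_differentiable_def regularized_HP_derivative_def prabhakar_integral_def
          vector_derivative_at intro: differentiableI_vector)
  qed
  then show "regularized_HP_differentiable \<gamma> \<mu> \<rho> (- \<phi>) (\<lambda>t. \<Sum>k. pgf_series_term lam \<phi> \<gamma> \<rho> \<mu> v t k) t"
    and "regularized_HP_derivative \<gamma> \<mu> \<rho> (- \<phi>) (\<lambda>t. \<Sum>k. pgf_series_term lam \<phi> \<gamma> \<rho> \<mu> v t k) t =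
      - of_real lam * (1 - v) * (\<Sum>k. pgf_series_term lam \<phi> \<gamma> \<rho> \<mu> v t k)"
    unfolding S_def[abs_def] z_def by auto
qed

theorem theorem5p4:
  fixes lam \<phi> \<gamma> \<rho> \<mu> :: real
  assumes "lam > 0" and "\<phi> > 0" and "\<gamma> \<ge> 0"
    and "0 < \<rho>" and "\<rho> \<le> 1" and "0 < \<mu>" and "\<mu> \<le> 1"
    and "\<gamma> \<noteq> 0 \<Longrightarrow> \<forall>r::nat. int r \<le> \<lceil>\<gamma>\<rceil> \<longrightarrow>
           0 < \<mu> * of_int \<lceil>\<gamma>\<rceil> / \<gamma> - real r * \<rho> \<and> \<mu> * of_int \<lceil>\<gamma>\<rceil> / \<gamma> - real r * \<rho> < 1"
  shows "(\<forall>v t. norm v \<le> 1 \<longrightarrow> t \<ge> 0 \<longrightarrow> summable (pgf_series_term lam \<phi> \<gamma> \<rho> \<mu> v t)) \<and>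
         pgf_cauchy_solution lam \<phi> \<gamma> \<rho> \<mu> (\<lambda>v t. \<Sum>k. pgf_series_term lam \<phi> \<gamma> \<rho> \<mu> v t k) \<and>
         (\<forall>G. pgf_cauchy_solution lam \<phi> \<gamma> \<rho> \<mu> G \<longrightarrow>
            (\<forall>v t. norm v \<le> 1 \<longrightarrow> t \<ge> 0 \<longrightarrow> G v t = (\<Sum>k. pgf_series_term lam \<phi> \<gamma> \<rho> \<mu> v t k)))"
proof (intro conjI allI impI)
  have cases: "\<gamma> = 0 \<and> \<mu> = 1 \<or> \<mu> < 1"
    using parameter_cases[of \<gamma> \<mu> \<rho>] assms by blast
  let ?S = "\<lambda>v t. \<Sum>k. pgf_series_term lam \<phi> \<gamma> \<rho> \<mu> v t k"
  show sol: "pgf_cauchy_solution lam \<phi> \<gamma> \<rho> \<mu> ?S"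
    by (rule pgf_series_solves[OF assms(4,6) cases])
  show "summable (pgf_series_term lam \<phi> \<gamma> \<rho> \<mu> v t)" if "t \<ge> 0" for v t
  proof (cases "t = 0")
    case True
    then show ?thesis
      using pgf_series_term_0[OF assms(6), of lam \<phi> \<gamma> \<rho> v]
      by (intro summable_finite[of "{0}"]) auto
  next
    case False
    then have "t > 0"
      using that by simp
    then show ?thesis
      by (simp only: pgf_series_term_eq_causal_kernel summable_pgf_series[OF assms(4,6)])
  qed
  show "G v t = ?S v t" if G: "pgf_cauchy_solution lam \<phi> \<gamma> \<rho> \<mu> G" and v: "norm v \<le> 1" and t: "t \<ge> 0" for G v t
  proof (cases "t = 0")
    case True
    then show ?thesis
      using G sol v unfolding pgf_cauchy_solution_def by simp
  next
    case False
    then have "t > 0"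
      using t by simp
    have "abs_continuous_on_interval 0 t (G v)" "abs_continuous_on_interval 0 t (?S v)"
      using G sol v \<open>t > 0\<close> unfolding pgf_cauchy_solution_def by blast+
    then show ?thesis
      using solution_volterra[OF G v assms(4,6) cases] solution_volterra[OF sol v assms(4,6) cases]
      by (intro volterra_unique[OF assms(4,6) \<open>t > 0\<close>] abs_continuous_imp_continuous_on)
  qed
qed

end
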